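(* Let $(M,\omega)$ be a presymplectic manifold with the characteristic foliation $\mathcal{I}$, and let $\nabla$ be a presymplectic connection on $M$. Assume that the curvature $R_\nabla$ of $\nabla$ satisfies the condition $$i(R_\nabla(Z,X)Y)\,\omega=0,\qquad \forall Z\in\Gamma T\mathcal{I},\ \forall X,Y\in\Gamma TM.$$ Then, if the reduced symplectic manifold $(Q=M/\mathcal{I},\omega')$ exists, it has a symplectic connection $\nabla'$ induced by $\nabla$.
   Context: Everything is $C^\infty$; $\Gamma$ denotes spaces of cross sections. A presymplectic manifold is a $(2n+p)$-dimensional manifold $M$ with a closed $2$-form $\omega$ of constant rank $2n$. The $p$-dimensional distribution $I=\{X\in TM : i(X)\omega=0\}$ is integrable; the corresponding foliation $\mathcal{I}$, with $T\mathcal{I}=I$, is the characteristic foliation. The reduced symplectic manifold exists if the space of leaves $Q=M/\mathcal{I}$ is a Hausdorff manifold (with the natural projection $\pi:M\to Q$ a submersion); then $\omega'$ is the symplectic form on $Q$ with $\pi^*\omega'=\omega$. A presymplectic connection on $(M,\omega)$ is a linear connection $\nabla$ on $M$ such that $\nabla\omega=0$ and its torsion $T_\nabla$ takes values in $I$. A symplectic connection on a symplectic manifold $(Q,\omega')$ is a torsionless linear connection $\nabla'$ with $\nabla'\omega'=0$. Curvature: $R_\nabla(Z,X)Y=\nabla_Z\nabla_XY-\nabla_X\nabla_ZY-\nabla_{[Z,X]}Y$. "$\nabla'$ is induced by $\nabla$" means: for all vector fields $\mathcal{X},\mathcal{Y}$ on $Q$ and all vector fields $X,Y$ on $M$ projecting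 by $\pi$ to $\mathcal{X},\mathcal{Y}$, the vector field $\nabla_XY$ is $\pi$-projectable and $\nabla'_{\mathcal{X}}\mathcal{Y}=\pi_*(\nabla_XY)$. (Equivalently, $\nabla'$ is the projection to $Q$ of the connection $\nabla'_X[Y]_{\mathcal{I}}:=[\nabla_XY]_{\mathcal{I}}$ on the normal bundle $TM/T\mathcal{I}$.) *)

theory Defs
  imports "HOL-Analysis.Analysis" "HOL-Library.Function_Algebras"
begin

section \<open>Functions as a real vector space\<close>

text \<open>Tangent vectors are functionals; with pointwise operations the library notions
  \<^term>\<open>dim\<close> and \<^term>\<open>span\<close> apply to them.\<close>

instantiation "fun" :: (type, real_vector) real_vector
begin

definition scaleR_fun_def: "c *\<^sub>R f = (\<lambda>x. c *\<^sub>R f x)"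

instance
  by standard (auto simp: scaleR_fun_def fun_eq_iff algebra_simps)

end


section \<open>Smooth maps between subsets of Euclidean spaces\<close>

text \<open>\<open>Ck_on r U f\<close> is the usual notion of \<open>f\<close> being of class $C^r$ only for open \<open>U\<close>.\<close>

primrec Ck_on :: "nat \<Rightarrow> 'e::euclidean_space set \<Rightarrow> ('e \<Rightarrow> 'f::euclidean_space) \<Rightarrow> bool" where
  "Ck_on 0 U f \<longleftrightarrow> continuous_on U f"
| "Ck_on (Suc r) U f \<longleftrightarrow>
     (\<forall>x\<in>U. f differentiable (at x)) \<and>
     (\<forall>v. Ck_on r U (\<lambda>x. frechet_derivative f (at x) v))"

text \<open>On an arbitrary subset, smooth means locally extendable to a smooth map on an open set.
  It is used for relatively open subsets of linear subspaces.\<close>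

definition smooth_on :: "'e::euclidean_space set \<Rightarrow> ('e \<Rightarrow> 'f::euclidean_space) \<Rightarrow> bool" where
  "smooth_on A f \<longleftrightarrow>
     (\<forall>x\<in>A. \<exists>U F. open U \<and> x \<in> U \<and> (\<forall>r. Ck_on r U F) \<and> (\<forall>y\<in>U \<inter> A. F y = f y))"


section \<open>Manifolds\<close>

record ('a, 'e) mfd =
  mtop :: "'a topology"
  atlas :: "('a set \<times> ('a \<Rightarrow> 'e)) set"

abbreviation carrier :: "('a, 'e) mfd \<Rightarrow> 'a set" where
  "carrier M \<equiv> topspace (mtop M)"

text \<open>The role of $\mathbb{R}^k$ is played by a \<open>k\<close>-dimensional linear subspace \<open>S\<close> of the type
  \<open>'e\<close>. Thus \<open>k\<close> is an ordinary natural number, \<open>k = 0\<close> is allowed, and manifolds of different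
  dimensions can be modelled on the same type (of dimension at least \<open>k\<close>).\<close>

definition chart :: "nat \<Rightarrow> 'a topology \<Rightarrow> 'a set \<Rightarrow> ('a \<Rightarrow> 'e::euclidean_space) \<Rightarrow> bool" where
  "chart k T U \<phi> \<longleftrightarrow>
     openin T U \<and>
     (\<exists>S. subspace S \<and> dim S = k \<and> openin (top_of_set S) (\<phi> ` U)) \<and>
     homeomorphic_map (subtopology T U) (top_of_set (\<phi> ` U)) \<phi>"

definition manifold :: "nat \<Rightarrow> ('a, 'e::euclidean_space) mfd \<Rightarrow> bool" where
  "manifold k M \<longleftrightarrow>
     Hausdorff_space (mtop M) \<and> second_countable (mtop M) \<and>
     (\<forall>(U, \<phi>)\<in>atlas M. chart k (mtop M) U \<phi>) \<and>
     (\<Union>(U, \<phi>)\<in>atlas M. U) = carrier M \<and>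
     (\<forall>(U, \<phi>)\<in>atlas M. \<forall>(V, \<psi>)\<in>atlas M.
        smooth_on (\<phi> ` (U \<inter> V)) (\<psi> \<circ> inv_into U \<phi>))"

text \<open>Only the values on the carrier matter.\<close>

definition Cinf :: "('a, 'e::euclidean_space) mfd \<Rightarrow> ('a \<Rightarrow> real) set" where
  "Cinf M = {f. \<forall>(U, \<phi>)\<in>atlas M. smooth_on (\<phi> ` U) (f \<circ> inv_into U \<phi>)}"

definition smooth_map ::
  "('a, 'e::euclidean_space) mfd \<Rightarrow> ('b, 'f::euclidean_space) mfd \<Rightarrow> ('a \<Rightarrow> 'b) \<Rightarrow> bool" where
  "smooth_map M N F \<longleftrightarrow>
     continuous_map (mtop M) (mtop N) F \<and>
     (\<forall>(U, \<phi>)\<in>atlas M. \<forall>(V, \<psi>)\<in>atlas N.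
        smooth_on (\<phi> ` (U \<inter> F -` V)) (\<psi> \<circ> F \<circ> inv_into U \<phi>))"


section \<open>Tangent vectors and vector fields\<close>

type_synonym 'a tvec = "('a \<Rightarrow> real) \<Rightarrow> real"
type_synonym 'a vfield = "'a \<Rightarrow> 'a tvec"

text \<open>Derivations at \<open>x\<close>. Vanishing off \<open>Cinf M\<close> makes the representation unique. That \<open>v f\<close>
  depends only on the restriction of \<open>f\<close> to the carrier follows from the product rule, applied to
  \<open>f\<close> and the indicator function of the carrier.\<close>

definition tangent_space :: "('a, 'e::euclidean_space) mfd \<Rightarrow> 'a \<Rightarrow> 'a tvec set" where
  "tangent_space M x = {v.
     (\<forall>f. f \<notin> Cinf M \<longrightarrow> v f = 0) \<and>
     (\<forall>f\<in>Cinf M. \<forall>g\<in>Cinf M. v (f + g) = v f + v g) \<and>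
     (\<forall>c. \<forall>f\<in>Cinf M. v (c *\<^sub>R f) = c * v f) \<and>
     (\<forall>f\<in>Cinf M. \<forall>g\<in>Cinf M. v (f * g) = f x * v g + g x * v f)}"

definition differential ::
  "('a, 'e::euclidean_space) mfd \<Rightarrow> ('b, 'f::euclidean_space) mfd \<Rightarrow> ('a \<Rightarrow> 'b) \<Rightarrow> 'a tvec \<Rightarrow> 'b tvec"
  where "differential M N F v = (\<lambda>g. if g \<in> Cinf N then v (g \<circ> F) else 0)"

definition submersion ::
  "('a, 'e::euclidean_space) mfd \<Rightarrow> ('b, 'f::euclidean_space) mfd \<Rightarrow> ('a \<Rightarrow> 'b) \<Rightarrow> bool" where
  "submersion M N F \<longleftrightarrow> smooth_map M N F \<and>
     (\<forall>x\<in>carrier M. differential M N F ` tangent_space M x = tangent_space N (F x))"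

definition immersion ::
  "('a, 'e::euclidean_space) mfd \<Rightarrow> ('b, 'f::euclidean_space) mfd \<Rightarrow> ('a \<Rightarrow> 'b) \<Rightarrow> bool" where
  "immersion M N F \<longleftrightarrow> smooth_map M N F \<and>
     (\<forall>x\<in>carrier M. inj_on (differential M N F) (tangent_space M x))"

definition vapply :: "'a vfield \<Rightarrow> ('a \<Rightarrow> real) \<Rightarrow> 'a \<Rightarrow> real" where
  "vapply X f = (\<lambda>x. X x f)"

text \<open>Vector fields are set to zero outside the carrier, so that they are equal as functions
  whenever they agree on the carrier.\<close>

definition vfields :: "('a, 'e::euclidean_space) mfd \<Rightarrow> 'a vfield set" where
  "vfields M = {X. (\<forall>x\<in>carrier M. X x \<in> tangent_space M x) \<and>
                   (\<forall>x. x \<notin> carrier M \<longrightarrow> X x = 0) \<and>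
                   (\<forall>f\<in>Cinf M. vapply X f \<in> Cinf M)}"

definition fmult :: "('a \<Rightarrow> real) \<Rightarrow> 'a vfield \<Rightarrow> 'a vfield" where
  "fmult f X = (\<lambda>x. f x *\<^sub>R X x)"

definition bracket :: "'a vfield \<Rightarrow> 'a vfield \<Rightarrow> 'a vfield" where
  "bracket X Y = (\<lambda>x f. X x (vapply Y f) - Y x (vapply X f))"


section \<open>Two-forms\<close>

type_synonym 'a form2 = "'a \<Rightarrow> 'a tvec \<Rightarrow> 'a tvec \<Rightarrow> real"

definition eval2 :: "'a form2 \<Rightarrow> 'a vfield \<Rightarrow> 'a vfield \<Rightarrow> 'a \<Rightarrow> real" where
  "eval2 \<omega> X Y = (\<lambda>x. \<omega> x (X x) (Y x))"

definition two_form :: "('a, 'e::euclidean_space) mfd \<Rightarrow> 'a form2 \<Rightarrow> bool" where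
  "two_form M \<omega> \<longleftrightarrow>
     (\<forall>x\<in>carrier M. \<forall>u\<in>tangent_space M x. \<forall>v\<in>tangent_space M x. \<forall>w\<in>tangent_space M x. \<forall>c.
        \<omega> x (u + v) w = \<omega> x u w + \<omega> x v w \<and>
        \<omega> x (c *\<^sub>R u) w = c * \<omega> x u w \<and>
        \<omega> x u w = - \<omega> x w u) \<and>
     (\<forall>X\<in>vfields M. \<forall>Y\<in>vfields M. eval2 \<omega> X Y \<in> Cinf M)"

definition ext_deriv2 :: "'a form2 \<Rightarrow> 'a vfield \<Rightarrow> 'a vfield \<Rightarrow> 'a vfield \<Rightarrow> 'a \<Rightarrow> real" where
  "ext_deriv2 \<omega> X Y Z = (\<lambda>x.
     X x (eval2 \<omega> Y Z) - Y x (eval2 \<omega> X Z) + Z x (eval2 \<omega> X Y)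
     - eval2 \<omega> (bracket X Y) Z x + eval2 \<omega> (bracket X Z) Y x - eval2 \<omega> (bracket Y Z) X x)"

definition closed_form2 :: "('a, 'e::euclidean_space) mfd \<Rightarrow> 'a form2 \<Rightarrow> bool" where
  "closed_form2 M \<omega> \<longleftrightarrow>
     (\<forall>X\<in>vfields M. \<forall>Y\<in>vfields M. \<forall>Z\<in>vfields M. \<forall>x\<in>carrier M. ext_deriv2 \<omega> X Y Z x = 0)"

text \<open>The rank of the linear map sending a tangent vector \<open>v\<close> to the covector \<open>i(v) \<omega>\<close>,
  where covectors are set to zero outside the tangent space.\<close>

definition rank2 :: "('a, 'e::euclidean_space) mfd \<Rightarrow> 'a form2 \<Rightarrow> 'a \<Rightarrow> nat" where
  "rank2 M \<omega> x =
     dim ((\<lambda>v w. if w \<in> tangent_space M x then \<omega> x v w else 0) ` tangent_space M x)"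

definition ker2 :: "('a, 'e::euclidean_space) mfd \<Rightarrow> 'a form2 \<Rightarrow> 'a \<Rightarrow> 'a tvec set" where
  "ker2 M \<omega> x = {v \<in> tangent_space M x. \<forall>w\<in>tangent_space M x. \<omega> x v w = 0}"

definition presymplectic_manifold ::
  "nat \<Rightarrow> nat \<Rightarrow> ('a, 'e::euclidean_space) mfd \<Rightarrow> 'a form2 \<Rightarrow> bool" where
  "presymplectic_manifold n p M \<omega> \<longleftrightarrow>
     manifold (2 * n + p) M \<and> two_form M \<omega> \<and> closed_form2 M \<omega> \<and>
     (\<forall>x\<in>carrier M. rank2 M \<omega> x = 2 * n)"

definition symplectic_manifold ::
  "nat \<Rightarrow> ('a, 'e::euclidean_space) mfd \<Rightarrow> 'a form2 \<Rightarrow> bool" where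
  "symplectic_manifold n M \<omega> \<longleftrightarrow>
     manifold (2 * n) M \<and> two_form M \<omega> \<and> closed_form2 M \<omega> \<and>
     (\<forall>x\<in>carrier M. ker2 M \<omega> x = {0})"


section \<open>The characteristic foliation and the reduced manifold\<close>

definition sections :: "('a, 'e::euclidean_space) mfd \<Rightarrow> ('a \<Rightarrow> 'a tvec set) \<Rightarrow> 'a vfield set" where
  "sections M D = {Z \<in> vfields M. \<forall>x\<in>carrier M. Z x \<in> D x}"

text \<open>The set \<open>L\<close> carries its own topology and atlas, the former possibly finer than
  the subspace topology.\<close>

definition integral_manifold ::
  "nat \<Rightarrow> ('a, 'e::euclidean_space) mfd \<Rightarrow> ('a \<Rightarrow> 'a tvec set) \<Rightarrow> 'a set \<Rightarrow> bool" where
  "integral_manifold k M D L \<longleftrightarrow>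
     (\<exists>N :: ('a, 'e) mfd. manifold k N \<and> carrier N = L \<and> connected_space (mtop N) \<and>
        immersion N M (\<lambda>x. x) \<and>
        (\<forall>x\<in>L. differential N M (\<lambda>x. x) ` tangent_space N x = D x))"

definition leaf ::
  "nat \<Rightarrow> ('a, 'e::euclidean_space) mfd \<Rightarrow> ('a \<Rightarrow> 'a tvec set) \<Rightarrow> 'a set \<Rightarrow> bool" where
  "leaf k M D L \<longleftrightarrow> L \<noteq> {} \<and> integral_manifold k M D L \<and>
     (\<forall>L'. integral_manifold k M D L' \<and> L \<subseteq> L' \<longrightarrow> L' = L)"

text \<open>\<open>Q\<close> is a manifold whose points are the leaves of the characteristic foliation, with the
  quotient topology; \<open>\<pi>\<close> sends each point to the unique leaf through it.\<close>

definition reduced_symplectic_manifold ::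
  "nat \<Rightarrow> nat \<Rightarrow> ('a, 'e::euclidean_space) mfd \<Rightarrow> 'a form2 \<Rightarrow>
   ('a set, 'e) mfd \<Rightarrow> ('a \<Rightarrow> 'a set) \<Rightarrow> 'a set form2 \<Rightarrow> bool" where
  "reduced_symplectic_manifold n p M \<omega> Q \<pi> \<omega>' \<longleftrightarrow>
     carrier Q = {L. leaf p M (ker2 M \<omega>) L} \<and>
     (\<forall>x\<in>carrier M. \<forall>L\<in>carrier Q. \<pi> x = L \<longleftrightarrow> x \<in> L) \<and>
     quotient_map (mtop M) (mtop Q) \<pi> \<and>
     submersion M Q \<pi> \<and>
     symplectic_manifold n Q \<omega>' \<and>
     (\<forall>x\<in>carrier M. \<forall>v\<in>tangent_space M x. \<forall>w\<in>tangent_space M x.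
        \<omega>' (\<pi> x) (differential M Q \<pi> v) (differential M Q \<pi> w) = \<omega> x v w)"


section \<open>Connections\<close>

type_synonym 'a conn = "'a vfield \<Rightarrow> 'a vfield \<Rightarrow> 'a vfield"

definition linear_connection :: "('a, 'e::euclidean_space) mfd \<Rightarrow> 'a conn \<Rightarrow> bool" where
  "linear_connection M \<D> \<longleftrightarrow>
     (\<forall>X\<in>vfields M. \<forall>Y\<in>vfields M. \<D> X Y \<in> vfields M) \<and>
     (\<forall>X\<in>vfields M. \<forall>X'\<in>vfields M. \<forall>Y\<in>vfields M. \<D> (X + X') Y = \<D> X Y + \<D> X' Y) \<and>
     (\<forall>X\<in>vfields M. \<forall>Y\<in>vfields M. \<forall>Y'\<in>vfields M. \<D> X (Y + Y') = \<D> X Y + \<D> X Y') \<and>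
     (\<forall>f\<in>Cinf M. \<forall>X\<in>vfields M. \<forall>Y\<in>vfields M. \<D> (fmult f X) Y = fmult f (\<D> X Y)) \<and>
     (\<forall>f\<in>Cinf M. \<forall>X\<in>vfields M. \<forall>Y\<in>vfields M.
        \<D> X (fmult f Y) = fmult (vapply X f) Y + fmult f (\<D> X Y))"

definition torsion :: "'a conn \<Rightarrow> 'a vfield \<Rightarrow> 'a vfield \<Rightarrow> 'a vfield" where
  "torsion \<D> X Y = \<D> X Y - \<D> Y X - bracket X Y"

definition curvature :: "'a conn \<Rightarrow> 'a vfield \<Rightarrow> 'a vfield \<Rightarrow> 'a vfield \<Rightarrow> 'a vfield" where
  "curvature \<D> Z X Y = \<D> Z (\<D> X Y) - \<D> X (\<D> Z Y) - \<D> (bracket Z X) Y"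

definition parallel2 :: "('a, 'e::euclidean_space) mfd \<Rightarrow> 'a conn \<Rightarrow> 'a form2 \<Rightarrow> bool" where
  "parallel2 M \<D> \<omega> \<longleftrightarrow>
     (\<forall>X\<in>vfields M. \<forall>Y\<in>vfields M. \<forall>Z\<in>vfields M. \<forall>x\<in>carrier M.
        X x (eval2 \<omega> Y Z) - eval2 \<omega> (\<D> X Y) Z x - eval2 \<omega> Y (\<D> X Z) x = 0)"

definition presymplectic_connection ::
  "('a, 'e::euclidean_space) mfd \<Rightarrow> 'a form2 \<Rightarrow> 'a conn \<Rightarrow> bool" where
  "presymplectic_connection M \<omega> \<D> \<longleftrightarrow>
     linear_connection M \<D> \<and> parallel2 M \<D> \<omega> \<and>
     (\<forall>X\<in>vfields M. \<forall>Y\<in>vfields M. \<forall>x\<in>carrier M. torsion \<D> X Y x \<in> ker2 M \<omega> x)"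

definition symplectic_connection ::
  "('a, 'e::euclidean_space) mfd \<Rightarrow> 'a form2 \<Rightarrow> 'a conn \<Rightarrow> bool" where
  "symplectic_connection M \<omega> \<D> \<longleftrightarrow>
     linear_connection M \<D> \<and> parallel2 M \<D> \<omega> \<and>
     (\<forall>X\<in>vfields M. \<forall>Y\<in>vfields M. torsion \<D> X Y = 0)"

definition projects_to ::
  "('a, 'e::euclidean_space) mfd \<Rightarrow> ('b, 'f::euclidean_space) mfd \<Rightarrow> ('a \<Rightarrow> 'b) \<Rightarrow>
   'a vfield \<Rightarrow> 'b vfield \<Rightarrow> bool" where
  "projects_to M Q \<pi> X X' \<longleftrightarrow> (\<forall>x\<in>carrier M. differential M Q \<pi> (X x) = X' (\<pi> x))"

text \<open>As \<open>\<D>' X' Y'\<close> is a vector field on \<open>Q\<close> (when \<open>\<D>'\<close> is a linear connection), the conclusion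
  says both that \<open>\<D> X Y\<close> is projectable and that its projection is \<open>\<D>' X' Y'\<close>.\<close>

definition induced_connection ::
  "('a, 'e::euclidean_space) mfd \<Rightarrow> ('b, 'f::euclidean_space) mfd \<Rightarrow> ('a \<Rightarrow> 'b) \<Rightarrow>
   'a conn \<Rightarrow> 'b conn \<Rightarrow> bool" where
  "induced_connection M Q \<pi> \<D> \<D>' \<longleftrightarrow>
     (\<forall>X'\<in>vfields Q. \<forall>Y'\<in>vfields Q. \<forall>X\<in>vfields M. \<forall>Y\<in>vfields M.
        projects_to M Q \<pi> X X' \<and> projects_to M Q \<pi> Y Y' \<longrightarrow>
        projects_to M Q \<pi> (\<D> X Y) (\<D>' X' Y'))"

end

(* Vectors in the characteristic distribution I are exactly those killed by d pi, because
   omega is the pullback of a nondegenerate form. If X, Y project to Q and Z is a section of I, then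
   nabla Z is vertical (nabla omega = 0), hence so is nabla_Z Y (the torsion is vertical and
   [Z, Y] is), and the curvature condition makes nabla_Z nabla_X Y and therefore
   [Z, nabla_X Y] vertical. So d pi (nabla_X Y) is locally constant along the connected leaves.

   Instead of global lifts, which would need partitions of unity, nabla' is computed at a point of Q
   from lifts defined near one point of the fibre. Smoothness of a function h' on Q with h' o pi
   smooth is obtained from the inverse function theorem applied to an affine slice: it gives
   differentiability of h', and its partial derivatives again pull back to smooth functions.

   Tangent vectors are derivations, so Hadamard's lemma is needed to expand them in coordinates. *)

theory Submission
  imports Defs
begin

section \<open>Calculus of smooth functions on open sets\<close>

text \<open>A connection takes global fields as arguments, while fields on Q are lifted only near a
  point. The bridge is \<open>lifts N X X'\<close>: \<open>X\<close> is a global field on M that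
  projects correctly over the open set \<open>N\<close>. Two such lifts differ by a field vertical
  on \<open>N\<close>. Verticality on \<open>N\<close> is inherited both by the covariant derivative
  of such a field and by the covariant derivative of a lift along it. Hence the projection of
  \<open>\<D> X Y\<close> at points of \<open>N\<close> is independent of the lifts, and no separate
  locality statement about \<open>\<D>\<close> is required. The curvature condition concerns
  sections of I, whereas constancy along a leaf concerns single tangent vectors. A vertical vector
  therefore has to be extended to a vertical field on all of M; a frame dual to pulled-back
  coordinates achieves this, and the same frame provides lifts and partial derivatives on Q.
  Constancy is shown for the real functions obtained by applying the projected derivative to each
  smooth \<open>g\<close> on Q, and the leaf is taken with its own manifold structure, in which it
  is connected.\<close>

lemma frechet_derivativeI:
  "(f has_derivative f') (at x) \<Longrightarrow> frechet_derivative f (at x) = f'"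
  by (metis frechet_derivative_at)

lemma has_frechet_derivative:
  "f differentiable (at x) \<Longrightarrow> (f has_derivative frechet_derivative f (at x)) (at x)"
  using frechet_derivative_works by blast

lemma frechet_derivative_cong_open:
  assumes "open U" "x \<in> U" "\<And>y. y \<in> U \<Longrightarrow> f y = g y" "f differentiable (at x)"
  shows "g differentiable (at x)" "frechet_derivative g (at x) = frechet_derivative f (at x)"
proof -
  have "(g has_derivative frechet_derivative f (at x)) (at x)"
    using has_derivative_transform_within_open[OF has_frechet_derivative[OF assms(4)] assms(1,2)]
      assms(3) by auto
  then show "g differentiable (at x)" "frechet_derivative g (at x) = frechet_derivative f (at x)"
    using frechet_derivativeI differentiableI by blast+
qed

lemma Ck_on_cong:
  assumes "open U" "\<And>x. x \<in> U \<Longrightarrow> f x = g x" "Ck_on r U f"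
  shows "Ck_on r U g"
  using assms(2,3)
proof (induction r arbitrary: f g)
  case 0
  then show ?case by (auto cong: continuous_on_cong)
next
  case (Suc r)
  have d: "f differentiable (at x)" if "x \<in> U" for x
    using Suc.prems(2) that by simp
  note c = frechet_derivative_cong_open[OF assms(1) _ Suc.prems(1) d]
  have "Ck_on r U (\<lambda>x. frechet_derivative g (at x) v)" for v
    by (rule Suc.IH[of "\<lambda>x. frechet_derivative f (at x) v"]) (use Suc.prems(2) c in auto)
  then show ?case using c by auto
qed

lemma Ck_on_subset: "Ck_on r U f \<Longrightarrow> V \<subseteq> U \<Longrightarrow> Ck_on r V f"
  by (induction r arbitrary: f) (auto intro: continuous_on_subset)

lemma Ck_on_Suc_D: "Ck_on (Suc r) U f \<Longrightarrow> Ck_on r U f"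
proof (induction r arbitrary: f)
  case 0
  then show ?case
    by (auto intro!: continuous_at_imp_continuous_on differentiable_imp_continuous_within)
next
  case (Suc r)
  then show ?case by (metis Ck_on.simps(2))
qed

lemma Ck_on_local:
  assumes "\<And>x. x \<in> U \<Longrightarrow> \<exists>V. open V \<and> x \<in> V \<and> Ck_on r V f"
  shows "Ck_on r U f"
  using assms
proof (induction r arbitrary: f)
  case 0
  have "isCont f x" if "x \<in> U" for x
    using 0[OF that] by (auto simp: continuous_on_eq_continuous_at)
  then show ?case by (simp add: continuous_at_imp_continuous_on)
next
  case (Suc r)
  have "Ck_on r U (\<lambda>x. frechet_derivative f (at x) v)" for v
    by (rule Suc.IH) (use Suc.prems in fastforce)
  moreover have "f differentiable (at x)" if "x \<in> U" for x
    using Suc.prems[OF that] by auto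
  ultimately show ?case by simp
qed

lemma Ck_on_const: "Ck_on r U (\<lambda>x. c)"
  by (induction r arbitrary: c) auto

lemma Ck_on_bounded_linear:
  assumes "bounded_linear f"
  shows "Ck_on r U f"
proof (cases r)
  case 0
  then show ?thesis using assms by (simp add: linear_continuous_on)
next
  case (Suc k)
  have "(f has_derivative f) (at x)" for x
    using assms bounded_linear_imp_has_derivative by blast
  then show ?thesis using Suc frechet_derivativeI[of f f]
    by (auto simp: Ck_on_const intro: differentiableI)
qed

lemma Ck_on_add:
  assumes "open U" "Ck_on r U f" "Ck_on r U g"
  shows "Ck_on r U (\<lambda>x. f x + g x)"
  using assms(2,3)
proof (induction r arbitrary: f g)
  case 0
  then show ?case by (auto intro: continuous_intros)
next
  case (Suc r)
  have h: "((\<lambda>x. f x + g x) has_derivative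
      (\<lambda>v. frechet_derivative f (at x) v + frechet_derivative g (at x) v)) (at x)" if "x \<in> U" for x
    using Suc.prems that by (auto intro!: has_derivative_add has_frechet_derivative)
  have "Ck_on r U (\<lambda>x. frechet_derivative (\<lambda>x. f x + g x) (at x) v)" for v
    by (rule Ck_on_cong[OF assms(1) _ Suc.IH[of "\<lambda>x. frechet_derivative f (at x) v"
            "\<lambda>x. frechet_derivative g (at x) v"]])
      (use Suc.prems frechet_derivativeI[OF h] in auto)
  then show ?case using h by (auto intro: differentiableI)
qed

lemma Ck_on_scaleR:
  fixes f :: "'e::euclidean_space \<Rightarrow> real"
  assumes "open U" "Ck_on r U f" "Ck_on r U g"
  shows "Ck_on r U (\<lambda>x. f x *\<^sub>R g x)"
  using assms(2,3)
proof (induction r arbitrary: f g)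
  case 0
  then show ?case by (auto intro: continuous_intros)
next
  case (Suc r)
  have h: "((\<lambda>x. f x *\<^sub>R g x) has_derivative
      (\<lambda>v. f x *\<^sub>R frechet_derivative g (at x) v + frechet_derivative f (at x) v *\<^sub>R g x)) (at x)"
    if "x \<in> U" for x
    using Suc.prems that by (auto intro!: has_derivative_scaleR has_frechet_derivative)
  have "Ck_on r U (\<lambda>x. frechet_derivative (\<lambda>x. f x *\<^sub>R g x) (at x) v)" for v
  proof (rule Ck_on_cong[OF assms(1)])
    show "Ck_on r U (\<lambda>x. f x *\<^sub>R frechet_derivative g (at x) v + frechet_derivative f (at x) v *\<^sub>R g x)"
      \<comment> \<open>The product rule leaves \<open>f\<close> and \<open>g\<close> themselves
        undifferentiated, so their order has to be lowered to \<open>r\<close> before the induction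
        hypothesis applies.\<close>
      using Suc.prems Ck_on_Suc_D[OF Suc.prems(1)] Ck_on_Suc_D[OF Suc.prems(2)]
      by (auto intro!: Ck_on_add Suc.IH assms(1))
  qed (use frechet_derivativeI[OF h] in auto)
  then show ?case using h by (auto intro: differentiableI)
qed

lemma Ck_on_sum:
  assumes "open U" "\<And>i. i \<in> I \<Longrightarrow> Ck_on r U (f i)"
  shows "Ck_on r U (\<lambda>x. \<Sum>i\<in>I. f i x)"
  using assms(2) by (induction I rule: infinite_finite_induct)
    (auto intro: Ck_on_const Ck_on_add[OF assms(1)])

lemma Ck_on_linear_comp:
  fixes f :: "'e::euclidean_space \<Rightarrow> 'f::euclidean_space"
  assumes "open U" "bounded_linear L" "Ck_on r U f"
  shows "Ck_on r U (\<lambda>x. L (f x))"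
  using assms(3)
proof (induction r arbitrary: f)
  case 0
  then show ?case using assms(2) by (auto intro: bounded_linear.continuous_on)
next
  case (Suc r)
  have h: "((\<lambda>x. L (f x)) has_derivative (\<lambda>v. L (frechet_derivative f (at x) v))) (at x)"
    if "x \<in> U" for x
    using Suc.prems that
    by (auto intro!: bounded_linear.has_derivative[OF assms(2)] has_frechet_derivative)
  have "Ck_on r U (\<lambda>x. frechet_derivative (\<lambda>x. L (f x)) (at x) v)" for v
    by (rule Ck_on_cong[OF assms(1) _ Suc.IH[of "\<lambda>x. frechet_derivative f (at x) v"]])
      (use Suc.prems frechet_derivativeI[OF h] in auto)
  then show ?case using h by (auto intro: differentiableI)
qed

text \<open>In the chain rule the direction \<open>?Df x v\<close> depends on \<open>x\<close>, so
  the derivative is not of the form \<open>g' (f x)\<close> with a fixed \<open>g'\<close>.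
  Expanding the direction in \<open>Basis\<close> gives a sum of products of components of
  \<open>?Df x v\<close> with functions \<open>?Dg (f x) b\<close>, to which the induction
  hypothesis for varying \<open>g\<close> applies.\<close>

lemma Ck_on_compose:
  fixes f :: "'e::euclidean_space \<Rightarrow> 'f::euclidean_space"
  assumes "open U" "open V" "f ` U \<subseteq> V" "Ck_on r U f" "Ck_on r V g"
  shows "Ck_on r U (\<lambda>x. g (f x))"
  using assms(4,5)
proof (induction r arbitrary: g)
  case 0
  then show ?case using assms(3) by (auto intro: continuous_on_compose2)
next
  case (Suc r)
  let ?Df = "\<lambda>x. frechet_derivative f (at x)" and ?Dg = "\<lambda>x. frechet_derivative g (at x)"
  have h: "((\<lambda>x. g (f x)) has_derivative (\<lambda>v. ?Dg (f x) (?Df x v))) (at x)" if "x \<in> U" for x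
    using Suc.prems that assms(3)
    by (auto intro!: has_derivative_compose[of f _ x UNIV g] has_frechet_derivative)
  have e: "?Dg (f x) (?Df x v) = (\<Sum>b\<in>Basis. (?Df x v \<bullet> b) *\<^sub>R ?Dg (f x) b)" if "x \<in> U" for x v
  proof -
    have "linear (?Dg (f x))"
      using Suc.prems(2) that assms(3) by (auto intro!: linear_frechet_derivative)
    then have "?Dg (f x) (\<Sum>b\<in>Basis. (?Df x v \<bullet> b) *\<^sub>R b) = (\<Sum>b\<in>Basis. (?Df x v \<bullet> b) *\<^sub>R ?Dg (f x) b)"
      by (simp add: linear_sum linear_cmul o_def)
    then show ?thesis by (simp add: euclidean_representation)
  qed
  have "Ck_on r U (\<lambda>x. frechet_derivative (\<lambda>x. g (f x)) (at x) v)" for v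
  proof (rule Ck_on_cong[OF assms(1)])
    show "Ck_on r U (\<lambda>x. \<Sum>b\<in>Basis. (?Df x v \<bullet> b) *\<^sub>R ?Dg (f x) b)"
      using Suc.prems Ck_on_Suc_D[OF Suc.prems(1)]
      by (auto intro!: Ck_on_sum Ck_on_scaleR Suc.IH assms(1) Ck_on_linear_comp[OF assms(1), of "\<lambda>z. z \<bullet> b" for b]
          bounded_linear_intros)
  qed (use frechet_derivativeI[OF h] e in auto)
  then show ?case using h by (auto intro: differentiableI)
qed

text \<open>The derivative of \<open>inverse (f x)\<close> is a product of two copies of
  \<open>inverse (f x)\<close> and the derivative of \<open>f\<close>, so the induction can keep
  \<open>f\<close> fixed.\<close>

lemma Ck_on_inverse:
  fixes f :: "'e::euclidean_space \<Rightarrow> real"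
  assumes "open U" "\<And>x. x \<in> U \<Longrightarrow> f x \<noteq> 0" "Ck_on r U f"
  shows "Ck_on r U (\<lambda>x. inverse (f x))"
  using assms(3)
proof (induction r)
  case 0
  then show ?case using assms(2) by (auto intro: continuous_intros)
next
  case (Suc r)
  let ?Df = "\<lambda>x. frechet_derivative f (at x)"
  have h: "((\<lambda>x. inverse (f x)) has_derivative
      (\<lambda>v. (- inverse (f x) * inverse (f x)) *\<^sub>R ?Df x v)) (at x)" if "x \<in> U" for x
  proof -
    have "(f has_derivative ?Df x) (at x)" "f x \<noteq> 0"
      using Suc.prems that assms(2) by (auto intro!: has_frechet_derivative)
    from Deriv.has_derivative_inverse[OF this(2,1)] show ?thesis
      by (simp add: algebra_simps)
  qed
  have i: "Ck_on r U (\<lambda>x. inverse (f x))"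
    using Suc.IH Ck_on_Suc_D[OF Suc.prems] by blast
  have "Ck_on r U (\<lambda>x. frechet_derivative (\<lambda>x. inverse (f x)) (at x) v)" for v
  proof (rule Ck_on_cong[OF assms(1)])
    show "Ck_on r U (\<lambda>x. (((-1) *\<^sub>R inverse (f x)) *\<^sub>R inverse (f x)) *\<^sub>R ?Df x v)"
      using Suc.prems i by (intro Ck_on_scaleR assms(1) Ck_on_const) auto
  qed (use frechet_derivativeI[OF h] in auto)
  then show ?case using h by (auto intro: differentiableI)
qed

definition Cinf_on :: "'e::euclidean_space set \<Rightarrow> ('e \<Rightarrow> 'f::euclidean_space) \<Rightarrow> bool" where
  "Cinf_on U f \<longleftrightarrow> (\<forall>r. Ck_on r U f)"

lemma Cinf_on_differentiable: "Cinf_on U f \<Longrightarrow> x \<in> U \<Longrightarrow> f differentiable (at x)"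
  using Ck_on.simps(2) unfolding Cinf_on_def by blast

lemma Cinf_on_has_derivative:
  "Cinf_on U f \<Longrightarrow> x \<in> U \<Longrightarrow> (f has_derivative frechet_derivative f (at x)) (at x)"
  by (simp add: Cinf_on_differentiable has_frechet_derivative)

lemma Cinf_on_derivative: "Cinf_on U f \<Longrightarrow> Cinf_on U (\<lambda>x. frechet_derivative f (at x) v)"
  using Ck_on.simps(2) unfolding Cinf_on_def by blast

lemma Cinf_on_continuous: "Cinf_on U f \<Longrightarrow> continuous_on U f"
  unfolding Cinf_on_def using Ck_on.simps(1) by blast

lemma Cinf_on_cong:
  "open U \<Longrightarrow> (\<And>x. x \<in> U \<Longrightarrow> f x = g x) \<Longrightarrow> Cinf_on U f \<Longrightarrow> Cinf_on U g"
  unfolding Cinf_on_def using Ck_on_cong by blast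

lemma Cinf_on_subset: "Cinf_on U f \<Longrightarrow> V \<subseteq> U \<Longrightarrow> Cinf_on V f"
  unfolding Cinf_on_def using Ck_on_subset by blast

lemma Cinf_on_local:
  "(\<And>x. x \<in> U \<Longrightarrow> \<exists>V. open V \<and> x \<in> V \<and> Cinf_on V f) \<Longrightarrow> Cinf_on U f"
  unfolding Cinf_on_def using Ck_on_local by metis

lemma Cinf_on_const [simp]: "Cinf_on U (\<lambda>x. c)"
  unfolding Cinf_on_def by (simp add: Ck_on_const)

lemma Cinf_on_bounded_linear: "bounded_linear f \<Longrightarrow> Cinf_on U f"
  unfolding Cinf_on_def by (simp add: Ck_on_bounded_linear)

lemma Cinf_on_add: "open U \<Longrightarrow> Cinf_on U f \<Longrightarrow> Cinf_on U g \<Longrightarrow> Cinf_on U (\<lambda>x. f x + g x)"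
  unfolding Cinf_on_def by (simp add: Ck_on_add)

lemma Cinf_on_scaleR:
  "open U \<Longrightarrow> Cinf_on U f \<Longrightarrow> Cinf_on U g \<Longrightarrow> Cinf_on U (\<lambda>x. f x *\<^sub>R g x)"
  unfolding Cinf_on_def by (simp add: Ck_on_scaleR)

lemma Cinf_on_mult:
  fixes f g :: "'e::euclidean_space \<Rightarrow> real"
  shows "open U \<Longrightarrow> Cinf_on U f \<Longrightarrow> Cinf_on U g \<Longrightarrow> Cinf_on U (\<lambda>x. f x * g x)"
  using Cinf_on_scaleR[of U f g] by simp

lemma Cinf_on_sum:
  "open U \<Longrightarrow> (\<And>i. i \<in> I \<Longrightarrow> Cinf_on U (f i)) \<Longrightarrow> Cinf_on U (\<lambda>x. \<Sum>i\<in>I. f i x)"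
  unfolding Cinf_on_def by (simp add: Ck_on_sum)

lemma Cinf_on_compose:
  assumes "open U" "open V" "f ` U \<subseteq> V" "Cinf_on U f" "Cinf_on V g"
  shows "Cinf_on U (\<lambda>x. g (f x))"
  using assms Ck_on_compose[OF assms(1-3)] unfolding Cinf_on_def by blast

lemma Cinf_on_inverse:
  fixes f :: "'e::euclidean_space \<Rightarrow> real"
  shows "open U \<Longrightarrow> (\<And>x. x \<in> U \<Longrightarrow> f x \<noteq> 0) \<Longrightarrow> Cinf_on U f \<Longrightarrow> Cinf_on U (\<lambda>x. inverse (f x))"
  unfolding Cinf_on_def by (simp add: Ck_on_inverse)

text \<open>Smoothness is read off from closure under differentiation. It serves the two places
  where derivatives stay in an explicit family: integrals along segments, and functions on Q that
  pull back to smooth functions on M.\<close>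

lemma Cinf_on_coinduct:
  assumes "open U" "f \<in> K"
    and diff: "\<And>f x. f \<in> K \<Longrightarrow> x \<in> U \<Longrightarrow> f differentiable (at x)"
    and deriv: "\<And>f v. f \<in> K \<Longrightarrow> \<exists>g\<in>K. \<forall>x\<in>U. frechet_derivative f (at x) v = g x"
  shows "Cinf_on U f"
proof -
  have "Ck_on r U f" for r
    using assms(2)
  proof (induction r arbitrary: f)
    case 0
    then show ?case using diff
      by (auto intro!: continuous_at_imp_continuous_on differentiable_imp_continuous_within)
  next
    case (Suc r)
    have "Ck_on r U (\<lambda>x. frechet_derivative f (at x) v)" for v
    proof -
      obtain g where "g \<in> K" "\<forall>x\<in>U. frechet_derivative f (at x) v = g x"
        using deriv[OF Suc.prems] by blast
      then show ?thesis by (intro Ck_on_cong[OF assms(1) _ Suc.IH[of g]]) auto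
    qed
    then show ?case using diff[OF Suc.prems] by simp
  qed
  then show ?thesis by (simp add: Cinf_on_def)
qed

section \<open>Bump functions and Hadamard's lemma\<close>

text \<open>For \<open>k = 0\<close> this is the classical smooth function that is flat at the
  origin. The extra negative power of \<open>t\<close> makes the span of the family closed under
  differentiation.\<close>

definition flat :: "nat \<Rightarrow> real \<Rightarrow> real" where
  "flat k t = (if t \<le> 0 then 0 else inverse t ^ k * exp (- inverse t))"

text \<open>With \<open>s = inverse t\<close> this is the decay of \<open>s ^ Suc k / exp s\<close>
  at infinity. It is the limit of the difference quotient of \<open>flat k\<close> at 0.\<close>

lemma flat_div_tendsto_0: "((\<lambda>t. flat k t / t) \<longlongrightarrow> 0) (at 0)"
proof -
  have "((\<lambda>s::real. s ^ Suc k / exp s) \<longlongrightarrow> 0) at_top"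
    by (rule tendsto_power_div_exp_0)
  then have "((\<lambda>t::real. inverse t ^ Suc k / exp (inverse t)) \<longlongrightarrow> 0) (at_right 0)"
    by (rule filterlim_compose[OF _ filterlim_inverse_at_top_right])
  then have r: "((\<lambda>t. flat k t / t) \<longlongrightarrow> 0) (at_right 0)"
  proof (rule Lim_transform_eventually)
    show "\<forall>\<^sub>F t in at_right (0::real). inverse t ^ Suc k / exp (inverse t) = flat k t / t"
      unfolding eventually_at_right_field flat_def
      by (intro exI[of _ 1]) (auto simp: exp_minus divide_simps)
  qed
  have l: "((\<lambda>t. flat k t / t) \<longlongrightarrow> 0) (at_left 0)"
    by (rule Lim_transform_eventually[of "\<lambda>_. 0"])
      (auto simp: eventually_at_left_field flat_def intro!: exI[of _ "-1"])
  show ?thesis using l r filterlim_split_at by blast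
qed

lemma flat_has_derivative:
  "(flat k has_field_derivative (flat (k + 2) t - k * flat (k + 1) t)) (at t)"
proof -
  consider "t < 0" | "t > 0" | "t = 0" by linarith
  then show ?thesis
  proof cases
    case 1
    have "(flat k has_field_derivative 0) (at t)"
      by (rule has_field_derivative_transform_within_open[of "\<lambda>_. 0" _ _ "{..<0}"])
        (use 1 in \<open>auto simp: flat_def\<close>)
    with 1 show ?thesis by (simp add: flat_def)
  next
    case 2
    let ?s = "inverse t"
    have i: "(inverse has_field_derivative - (?s * ?s)) (at t)"
      using DERIV_inverse[of t] 2 by simp
    have e: "((\<lambda>t. exp (- inverse t)) has_field_derivative exp (- ?s) * (?s * ?s)) (at t)"
      using DERIV_chain2[OF DERIV_exp DERIV_minus[OF i]] by simp
    \<comment> \<open>The exponent \<open>k - Suc 0\<close> from the power rule is truncated at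
      \<open>k = 0\<close>, where the factor \<open>real k\<close> vanishes anyway.\<close>
    have m: "real k * (- (?s * ?s) * ?s ^ (k - Suc 0)) = - real k * ?s ^ (k + 1)"
      by (cases k) (auto simp: algebra_simps)
    have "((\<lambda>t. inverse t ^ k * exp (- inverse t)) has_field_derivative
        (- real k * ?s ^ (k + 1)) * exp (- ?s) + (exp (- ?s) * (?s * ?s)) * ?s ^ k) (at t)"
      using DERIV_mult[OF DERIV_power[OF i, of k] e] unfolding m .
    moreover have "(- real k * ?s ^ (k + 1)) * exp (- ?s) + (exp (- ?s) * (?s * ?s)) * ?s ^ k =
        flat (k + 2) t - k * flat (k + 1) t"
      using 2 by (simp add: flat_def)
    ultimately have "((\<lambda>t. inverse t ^ k * exp (- inverse t)) has_field_derivative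
        (flat (k + 2) t - k * flat (k + 1) t)) (at t)" by simp
    then show ?thesis
      by (rule has_field_derivative_transform_within_open[of _ _ _ "{0<..}"])
        (use 2 in \<open>auto simp: flat_def\<close>)
  next
    case 3
    have "((\<lambda>h. (flat k (0 + h) - flat k 0) / h) \<longlongrightarrow> 0) (at 0)"
      using flat_div_tendsto_0[of k] by (simp add: flat_def)
    then show ?thesis using 3 by (simp add: DERIV_def flat_def)
  qed
qed

lemma Cinf_on_flat: "Cinf_on U (flat k)"
proof -
  have d: "(flat k has_derivative (\<lambda>h. (flat (k + 2) t + (- real k) * flat (k + 1) t) * h)) (at t)" for k t
    using flat_has_derivative[of k t] unfolding has_field_derivative_def by simp
  have "Ck_on r UNIV (flat k)" for r
  proof (induction r arbitrary: k)
    case 0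
    then show ?case
      using d by (auto intro!: continuous_at_imp_continuous_on has_derivative_continuous)
  next
    case (Suc r)
    have "Ck_on r UNIV (\<lambda>t. (flat (k + 2) t + (- real k) *\<^sub>R flat (k + 1) t) *\<^sub>R v)" for v :: real
      by (intro Ck_on_scaleR Ck_on_add Ck_on_const open_UNIV Suc.IH)
    then show ?case using d by (auto simp: frechet_derivativeI[OF d] intro: differentiableI)
  qed
  then show ?thesis unfolding Cinf_on_def using Ck_on_subset by blast
qed

text \<open>In the quotient \<open>a z / (a z + b z)\<close>, \<open>a\<close> is positive exactly
  within distance \<open>s\<close> of the centre and \<open>b\<close> exactly beyond distance
  \<open>r\<close>. Since \<open>r < s\<close> they never vanish together.\<close>

lemma ex_bump:
  fixes z0 :: "'e::euclidean_space"
  assumes "0 < r" "r < s"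
  obtains \<beta> :: "'e \<Rightarrow> real" where "Cinf_on UNIV \<beta>" "\<And>z. z \<in> cball z0 r \<Longrightarrow> \<beta> z = 1"
    "\<And>z. z \<notin> ball z0 s \<Longrightarrow> \<beta> z = 0"
proof
  \<comment> \<open>The squared distance is used because the distance itself is not smooth at the
    centre.\<close>
  define q where "q = (\<lambda>z::'e. (z - z0) \<bullet> (z - z0))"
  define a where "a = (\<lambda>z. flat 0 (s\<^sup>2 - q z))"
  define b where "b = (\<lambda>z. flat 0 (q z - r\<^sup>2))"
  define \<beta> where "\<beta> = (\<lambda>z. a z * inverse (a z + b z))"
  have q: "Cinf_on UNIV q"
  proof -
    have i: "Cinf_on UNIV (\<lambda>z. (z - z0) \<bullet> i)" for i
      using Cinf_on_add[OF open_UNIV Cinf_on_bounded_linear[OF bounded_linear_inner_left[of i]] Cinf_on_const[of _ "- (z0 \<bullet> i)"]]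
      by (simp add: inner_diff_left)
    have "Cinf_on UNIV (\<lambda>z. \<Sum>i\<in>Basis. ((z - z0) \<bullet> i) * ((z - z0) \<bullet> i))"
      by (intro Cinf_on_sum Cinf_on_mult i open_UNIV)
    then show ?thesis unfolding q_def by (subst euclidean_inner)
  qed
  have c: "Cinf_on UNIV (\<lambda>z. flat 0 (m * q z + c))" for m c
    by (intro Cinf_on_compose[OF open_UNIV open_UNIV _ _ Cinf_on_flat] Cinf_on_add Cinf_on_mult q) auto
  have ab: "Cinf_on UNIV a" "Cinf_on UNIV b"
    using c[of "-1" "s\<^sup>2"] c[of 1 "- r\<^sup>2"] by (simp_all add: a_def b_def)
  have qn: "q z = (dist z0 z)\<^sup>2" for z 
    by (metis q_def dist_norm dist_commute power2_norm_eq_inner)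
  have rs: "r\<^sup>2 < s\<^sup>2" using assms by (simp add: power_strict_mono)
  have pos: "a z + b z > 0" for z
    using rs unfolding a_def b_def flat_def by (auto simp: add_pos_pos add_nonneg_pos)
  show "Cinf_on UNIV \<beta>"
    unfolding \<beta>_def using pos by (intro Cinf_on_mult Cinf_on_inverse Cinf_on_add ab open_UNIV) (metis less_irrefl)
  show "\<beta> z = 1" if "z \<in> cball z0 r" for z
  proof -
    have "q z \<le> r\<^sup>2" using that assms by (simp add: qn power_mono)
    then have "b z = 0" by (simp add: b_def flat_def)
    then show ?thesis using pos[of z] by (simp add: \<beta>_def)
  qed
  show "\<beta> z = 0" if "z \<notin> ball z0 s" for z
  proof -
    have "q z \<ge> s\<^sup>2" using that assms by (simp add: qn power_mono)
    then show ?thesis by (simp add: \<beta>_def a_def flat_def)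
  qed
qed

text \<open>Differentiation under the integral sign. The chain rule contributes a factor
  \<open>t\<close>, so the weight \<open>t ^ m\<close> is carried along to make this family of
  integrals closed under differentiation.\<close>

lemma has_derivative_integral_segment:
  fixes F :: "'e::euclidean_space \<Rightarrow> real"
  assumes "open U" "convex U" "a \<in> U" "Cinf_on U F" "z \<in> U"
  defines "\<gamma> \<equiv> (\<lambda>z t. a + t *\<^sub>R (z - a))"
  shows "((\<lambda>z. integral (cbox 0 1) (\<lambda>t. t ^ m * F (\<gamma> z t))) has_derivative
    (\<lambda>v. integral (cbox 0 1) (\<lambda>t. t ^ Suc m * frechet_derivative F (at (\<gamma> z t)) v))) (at z)"
proof -
  have \<gamma>: "\<gamma> z t \<in> U" if "z \<in> U" "t \<in> cbox 0 1" for z t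
  proof -
    have "\<gamma> z t = (1 - t) *\<^sub>R a + t *\<^sub>R z" by (simp add: \<gamma>_def algebra_simps)
    then show ?thesis using assms(2,3) that by (auto simp: convex_alt)
  qed
  let ?D = "\<lambda>x. frechet_derivative F (at x)"
  \<comment> \<open>\<open>leibniz_rule\<close> expects the derivatives as a jointly continuous
    family of bounded linear maps.\<close>
  define G where "G = (\<lambda>z t. Blinfun (\<lambda>v. t ^ Suc m * ?D (\<gamma> z t) v))"
  have bl: "bounded_linear (\<lambda>v. t ^ Suc m * ?D (\<gamma> z t) v)" if "z \<in> U" "t \<in> cbox 0 1" for z t
    using Cinf_on_has_derivative[OF assms(4) \<gamma>[OF that]]
    by (intro bounded_linear_intros has_derivative_bounded_linear)
  have G: "blinfun_apply (G z t) v = t ^ Suc m * ?D (\<gamma> z t) v" if "z \<in> U" "t \<in> cbox 0 1" for z t v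
    unfolding G_def using bounded_linear_Blinfun_apply[OF bl[OF that]] by simp
  have c\<gamma>: "continuous_on A (\<lambda>p. \<gamma> (fst p) (snd p))" for A
    unfolding \<gamma>_def by (intro continuous_intros)
  have cont: "continuous_on (U \<times> cbox 0 1) (\<lambda>(z, t). G z t)"
    unfolding case_prod_beta
  proof (rule continuous_on_blinfun_componentwise)
    fix v :: 'e assume "v \<in> Basis"
    have "continuous_on (U \<times> cbox 0 1) (\<lambda>p. snd p ^ Suc m * ?D (\<gamma> (fst p) (snd p)) v)"
      using \<gamma> by (intro continuous_intros
          continuous_on_compose2[OF Cinf_on_continuous[OF Cinf_on_derivative[OF assms(4)]] c\<gamma>]) auto
    then show "continuous_on (U \<times> cbox 0 1) (\<lambda>p. blinfun_apply (G (fst p) (snd p)) v)"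
      by (rule continuous_on_eq) (auto simp: G)
  qed
  have contz: "continuous_on (cbox 0 1) (\<lambda>t. t ^ m * F (\<gamma> z t))" if "z \<in> U" for z
    using \<gamma>[OF that] by (intro continuous_intros continuous_on_compose2[OF Cinf_on_continuous[OF assms(4)]])
      (auto simp: \<gamma>_def intro!: continuous_intros)
  have "((\<lambda>z. integral (cbox 0 1) (\<lambda>t. t ^ m * F (\<gamma> z t))) has_derivative
      integral (cbox 0 1) (G z)) (at z within U)"
  proof (rule leibniz_rule)
    fix y t assume yt: "y \<in> U" "t \<in> cbox (0::real) 1"
    have "((\<lambda>z. \<gamma> z t) has_derivative (\<lambda>v. t *\<^sub>R v)) (at y)"
      unfolding \<gamma>_def by (auto intro!: derivative_eq_intros)
    from has_derivative_compose[OF this Cinf_on_has_derivative[OF assms(4) \<gamma>[OF yt]]]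
    have "((\<lambda>z. F (\<gamma> z t)) has_derivative (\<lambda>v. ?D (\<gamma> y t) (t *\<^sub>R v))) (at y)" .
    from has_derivative_mult_right[OF this, of "t ^ m"]
    have "((\<lambda>z. t ^ m * F (\<gamma> z t)) has_derivative (\<lambda>v. t ^ m * ?D (\<gamma> y t) (t *\<^sub>R v))) (at y)" .
    moreover have "t ^ m * ?D (\<gamma> y t) (t *\<^sub>R v) = G y t v" for v
      using linear_cmul[OF linear_frechet_derivative[OF Cinf_on_differentiable[OF assms(4) \<gamma>[OF yt]]]]
      by (simp add: G[OF yt])
    ultimately show "((\<lambda>z. t ^ m * F (\<gamma> z t)) has_derivative blinfun_apply (G y t)) (at y within U)"
      by (auto intro: has_derivative_at_withinI)
  qed (use assms(2,5) cont in \<open>auto intro!: integrable_continuous[OF contz, unfolded cbox_interval]\<close>)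
  then have "((\<lambda>z. integral (cbox 0 1) (\<lambda>t. t ^ m * F (\<gamma> z t))) has_derivative
      (\<lambda>v. blinfun_apply (integral (cbox 0 1) (G z)) v)) (at z)"
    using at_within_open[OF assms(5,1)] by simp
  moreover have "blinfun_apply (integral (cbox 0 1) (G z)) v =
      integral (cbox 0 1) (\<lambda>t. t ^ Suc m * ?D (\<gamma> z t) v)" for v
  proof -
    have "continuous_on (cbox 0 1) (G z)"
      by (rule continuous_on_compose2[OF cont, of _ "\<lambda>t. (z, t)", simplified])
        (use assms(5) in \<open>auto intro!: continuous_intros\<close>)
    then have "blinfun_apply (integral (cbox 0 1) (G z)) v = integral (cbox 0 1) (\<lambda>t. G z t v)"
      by (intro blinfun_apply_integral integrable_continuous)
    also have "\<dots> = integral (cbox 0 1) (\<lambda>t. t ^ Suc m * ?D (\<gamma> z t) v)"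
      by (intro integral_cong) (use assms(5) in \<open>auto simp: G\<close>)
    finally show ?thesis .
  qed
  ultimately show ?thesis by simp
qed

lemma Cinf_on_integral_segment:
  fixes F :: "'e::euclidean_space \<Rightarrow> real"
  assumes "open U" "convex U" "a \<in> U" "Cinf_on U F"
  shows "Cinf_on U (\<lambda>z. integral (cbox 0 1) (\<lambda>t. F (a + t *\<^sub>R (z - a))))"
proof -
  define J where "J = (\<lambda>m (F :: 'e \<Rightarrow> real) z. integral (cbox 0 1) (\<lambda>t. t ^ m * F (a + t *\<^sub>R (z - a))))"
  note d = has_derivative_integral_segment[OF assms(1-3), folded J_def]
  have "Cinf_on U (J 0 F)"
  proof (rule Cinf_on_coinduct[OF assms(1), of _ "{J m F | m F. Cinf_on U F}"])
    show "J 0 F \<in> {J m F | m F. Cinf_on U F}" using assms(4) by blast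
    fix f assume "f \<in> {J m F | m F. Cinf_on U F}"
    then obtain m F where f: "f = J m F" "Cinf_on U F" by blast
    show "f differentiable at x" if "x \<in> U" for x
      unfolding f(1) J_def using d[OF f(2) that, of m] by (rule differentiableI)
    fix v
    have "frechet_derivative f (at x) v = J (Suc m) (\<lambda>x. frechet_derivative F (at x) v) x" if "x \<in> U" for x
      using frechet_derivativeI[OF d[OF f(2) that, of m]] f(1) by (simp add: J_def)
    then show "\<exists>g\<in>{J m F | m F. Cinf_on U F}. \<forall>x\<in>U. frechet_derivative f (at x) v = g x"
      using Cinf_on_derivative[OF f(2)] by blast
  qed
  then show ?thesis by (simp add: J_def)
qed

text \<open>The fundamental theorem of calculus along the segment from \<open>a\<close> to
  \<open>z\<close>, with the velocity \<open>z - a\<close> expanded into the vectors of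
  \<open>I\<close>. The set \<open>I\<close> is left open because later increments lie in the model
  subspace of a chart and are expanded in its basis, while \<open>U\<close> is open in the whole
  ambient space.\<close>

lemma Hadamard:
  fixes F :: "'e::euclidean_space \<Rightarrow> real"
  assumes "open U" "convex U" "a \<in> U" "Cinf_on U F"
  obtains G :: "'e \<Rightarrow> 'e \<Rightarrow> real" where "\<And>b. Cinf_on U (G b)" "\<And>b. G b a = frechet_derivative F (at a) b"
    "\<And>z I c. z \<in> U \<Longrightarrow> finite I \<Longrightarrow> z - a = (\<Sum>b\<in>I. c b *\<^sub>R b) \<Longrightarrow> F z = F a + (\<Sum>b\<in>I. c b * G b z)"
proof
  define G where "G = (\<lambda>b z. integral (cbox 0 1) (\<lambda>t. frechet_derivative F (at (a + t *\<^sub>R (z - a))) b))"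
  show "Cinf_on U (G b)" for b
    unfolding G_def by (intro Cinf_on_integral_segment assms Cinf_on_derivative)
  show "G b a = frechet_derivative F (at a) b" for b
    by (simp add: G_def)
  fix z and I :: "'e set" and c assume z: "z \<in> U" "finite I" "z - a = (\<Sum>b\<in>I. c b *\<^sub>R b)"
  let ?\<gamma> = "\<lambda>t. a + t *\<^sub>R (z - a)"
  let ?D = "\<lambda>x. frechet_derivative F (at x)"
  have \<gamma>: "?\<gamma> t \<in> U" if "t \<in> {0..1}" for t
  proof -
    have "?\<gamma> t = (1 - t) *\<^sub>R a + t *\<^sub>R z" by (simp add: algebra_simps)
    then show ?thesis using assms(2,3) that z by (auto simp: convex_alt)
  qed
  have D: "?D (?\<gamma> t) (z - a) = (\<Sum>b\<in>I. c b * ?D (?\<gamma> t) b)" if "t \<in> {0..1}" for t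
  proof -
    have "linear (?D (?\<gamma> t))"
      using Cinf_on_differentiable[OF assms(4) \<gamma>[OF that]] by (rule linear_frechet_derivative)
    then have "?D (?\<gamma> t) (\<Sum>b\<in>I. c b *\<^sub>R b) = (\<Sum>b\<in>I. c b * ?D (?\<gamma> t) b)"
      by (simp add: linear_sum linear_cmul)
    then show ?thesis unfolding z(3)[symmetric] .
  qed
  have cont: "continuous_on {0..1} (\<lambda>t. ?D (?\<gamma> t) b)" for b
    using \<gamma> by (intro continuous_on_compose2[OF Cinf_on_continuous[OF Cinf_on_derivative[OF assms(4)]]])
      (auto intro!: continuous_intros)
  have "((\<lambda>t. ?D (?\<gamma> t) (z - a)) has_integral (F (?\<gamma> 1) - F (?\<gamma> 0))) {0..1}"
  proof (rule fundamental_theorem_of_calculus)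
    fix t :: real assume t: "t \<in> {0..1}"
    have "(?\<gamma> has_derivative (\<lambda>h. h *\<^sub>R (z - a))) (at t)"
      by (auto intro!: derivative_eq_intros)
    from has_derivative_compose[OF this Cinf_on_has_derivative[OF assms(4) \<gamma>[OF t]]]
    have "((\<lambda>t. F (?\<gamma> t)) has_derivative (\<lambda>h. h *\<^sub>R ?D (?\<gamma> t) (z - a))) (at t)"
      using linear_cmul[OF linear_frechet_derivative[OF Cinf_on_differentiable[OF assms(4) \<gamma>[OF t]]]]
      by simp
    then show "((\<lambda>t. F (?\<gamma> t)) has_vector_derivative ?D (?\<gamma> t) (z - a)) (at t within {0..1})"
      unfolding has_vector_derivative_def by (rule has_derivative_at_withinI)
  qed simp
  then have "F z - F a = integral {0..1} (\<lambda>t. ?D (?\<gamma> t) (z - a))"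
    by (simp add: integral_unique)
  also have "\<dots> = integral {0..1} (\<lambda>t. \<Sum>b\<in>I. c b * ?D (?\<gamma> t) b)"
    using D by (intro integral_cong)
  also have "\<dots> = (\<Sum>b\<in>I. c b * G b z)"
    using z(2) cont by (subst integral_sum)
      (auto simp: G_def intro!: integrable_continuous_real continuous_intros)
  finally show "F z = F a + (\<Sum>b\<in>I. c b * G b z)" by simp
qed

section \<open>Smooth functions and charts\<close>

lemma smooth_on_Cinf_on:
  "smooth_on A f \<longleftrightarrow> (\<forall>x\<in>A. \<exists>U F. open U \<and> x \<in> U \<and> Cinf_on U F \<and> (\<forall>y\<in>U \<inter> A. F y = f y))"
  unfolding smooth_on_def Cinf_on_def ..

lemma smooth_onE:
  assumes "smooth_on A f" "x \<in> A"
  obtains U F where "open U" "x \<in> U" "Cinf_on U F" "\<And>y. y \<in> U \<Longrightarrow> y \<in> A \<Longrightarrow> F y = f y"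
  using bspec[OF assms(1)[unfolded smooth_on_Cinf_on] assms(2)] that by (metis IntI)

text \<open>Local extensions of \<open>f\<close> agree with \<open>f\<close> on the image of
  \<open>g\<close>, so the choice of extension disappears after composition. With \<open>g\<close>
  an orthogonal projection, smoothness on a relatively open set becomes ordinary smoothness on an
  open set.\<close>

lemma smooth_on_pullback:
  assumes "smooth_on A f" "open V" "Cinf_on V g" "g ` V \<subseteq> A"
  shows "Cinf_on V (\<lambda>z. f (g z))"
proof (rule Cinf_on_local)
  fix z assume z: "z \<in> V"
  obtain W F where W: "open W" "g z \<in> W" "Cinf_on W F" "\<And>y. y \<in> W \<Longrightarrow> y \<in> A \<Longrightarrow> F y = f y"
    using smooth_onE[OF assms(1)] assms(4) z by blast
  let ?V = "V \<inter> g -` W"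
  have o: "open ?V"
    using continuous_open_preimage[OF Cinf_on_continuous[OF assms(3)] assms(2) W(1)] .
  have "Cinf_on ?V (\<lambda>z. F (g z))"
    by (rule Cinf_on_compose[OF o W(1) _ Cinf_on_subset[OF assms(3)] W(3)]) auto
  then have "Cinf_on ?V (\<lambda>z. f (g z))"
    by (rule Cinf_on_cong[OF o, rotated]) (use W assms(4) in auto)
  then show "\<exists>V. open V \<and> z \<in> V \<and> Cinf_on V (\<lambda>z. f (g z))"
    using o z W by blast
qed

lemma smooth_on_const: "smooth_on A (\<lambda>x. c)"
  unfolding smooth_on_Cinf_on by (intro ballI exI[of _ UNIV] exI[of _ "\<lambda>x. c"]) simp

lemma smooth_on_binop:
  fixes f g :: "'d::euclidean_space \<Rightarrow> 'f::euclidean_space" and h :: "'f \<Rightarrow> 'f \<Rightarrow> 'f"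
  assumes "smooth_on A f" "smooth_on A g"
    and op: "\<And>(U :: 'd set) F G. open U \<Longrightarrow> Cinf_on U F \<Longrightarrow> Cinf_on U G \<Longrightarrow> Cinf_on U (\<lambda>x. h (F x) (G x))"
  shows "smooth_on A (\<lambda>x. h (f x) (g x))"
  unfolding smooth_on_Cinf_on
proof
  fix x assume x: "x \<in> A"
  obtain U F V G where "open U" "x \<in> U" "Cinf_on U F" "\<And>y. y \<in> U \<Longrightarrow> y \<in> A \<Longrightarrow> F y = f y"
    and "open V" "x \<in> V" "Cinf_on V G" "\<And>y. y \<in> V \<Longrightarrow> y \<in> A \<Longrightarrow> G y = g y"
    using smooth_onE[OF assms(1) x] smooth_onE[OF assms(2) x] by metis
  moreover from this have "Cinf_on (U \<inter> V) (\<lambda>x. h (F x) (G x))"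
    by (intro op[of "U \<inter> V"]) (auto elim: Cinf_on_subset)
  ultimately show "\<exists>U H. open U \<and> x \<in> U \<and> Cinf_on U H \<and> (\<forall>y\<in>U \<inter> A. H y = h (f y) (g y))"
    by (intro exI[of _ "U \<inter> V"] exI[of _ "\<lambda>x. h (F x) (G x)"]) auto
qed

lemma Cinf_const [simp]: "(\<lambda>x. c) \<in> Cinf M"
  by (auto simp: Cinf_def o_def smooth_on_const)

lemma Cinf_0 [simp]: "0 \<in> Cinf M"
  using Cinf_const[of 0] by (simp add: zero_fun_def)

lemma Cinf_add: "f \<in> Cinf M \<Longrightarrow> g \<in> Cinf M \<Longrightarrow> f + g \<in> Cinf M"
  by (auto simp: Cinf_def o_def plus_fun_def intro: smooth_on_binop Cinf_on_add)

lemma Cinf_mult: "f \<in> Cinf M \<Longrightarrow> g \<in> Cinf M \<Longrightarrow> f * g \<in> Cinf M"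
  by (auto simp: Cinf_def o_def times_fun_def intro: smooth_on_binop Cinf_on_mult)

lemma Cinf_scaleR: "f \<in> Cinf M \<Longrightarrow> c *\<^sub>R f \<in> Cinf M"
  using Cinf_mult[OF Cinf_const[of c M]] by (simp add: times_fun_def scaleR_fun_def)

lemma Cinf_minus: "f \<in> Cinf M \<Longrightarrow> - f \<in> Cinf M"
  using Cinf_scaleR[of f M "-1"] by simp

lemma Cinf_diff: "f \<in> Cinf M \<Longrightarrow> g \<in> Cinf M \<Longrightarrow> f - g \<in> Cinf M"
  using Cinf_add[OF _ Cinf_minus, of f M g] by simp

lemma Cinf_sum: "(\<And>i. i \<in> I \<Longrightarrow> f i \<in> Cinf M) \<Longrightarrow> (\<Sum>i\<in>I. f i) \<in> Cinf M"
  by (induction I rule: infinite_finite_induct) (auto intro: Cinf_add)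

section \<open>Derivations at a point\<close>

lemma tangent_add: "v \<in> tangent_space M x \<Longrightarrow> f \<in> Cinf M \<Longrightarrow> g \<in> Cinf M \<Longrightarrow> v (f + g) = v f + v g"
  by (simp add: tangent_space_def)

lemma tangent_scaleR: "v \<in> tangent_space M x \<Longrightarrow> f \<in> Cinf M \<Longrightarrow> v (c *\<^sub>R f) = c * v f"
  by (simp add: tangent_space_def)

lemma tangent_mult:
  "v \<in> tangent_space M x \<Longrightarrow> f \<in> Cinf M \<Longrightarrow> g \<in> Cinf M \<Longrightarrow> v (f * g) = f x * v g + g x * v f"
  by (simp add: tangent_space_def)

lemma tangent_notin: "v \<in> tangent_space M x \<Longrightarrow> f \<notin> Cinf M \<Longrightarrow> v f = 0"
  by (simp add: tangent_space_def)

lemma tangent_zero: "v \<in> tangent_space M x \<Longrightarrow> v 0 = 0"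
  using tangent_scaleR[of v M x 0 0] by simp

lemma tangent_const:
  assumes "v \<in> tangent_space M x"
  shows "v (\<lambda>x. c) = 0"
proof -
  define e :: "'a \<Rightarrow> real" where "e = (\<lambda>x. 1)"
  have e: "e \<in> Cinf M" "e * e = e" "e x = 1" and c: "(\<lambda>x. c) = c *\<^sub>R e"
    by (simp_all add: e_def times_fun_def scaleR_fun_def)
  have "v (e * e) = 2 * v e"
    using tangent_mult[OF assms e(1) e(1)] e(3) by simp
  then have "v e = 0" using e(2) by simp
  then show ?thesis
    using tangent_scaleR[OF assms e(1), of c] c by simp
qed

lemma tangent_diff:
  "v \<in> tangent_space M x \<Longrightarrow> f \<in> Cinf M \<Longrightarrow> g \<in> Cinf M \<Longrightarrow> v (f - g) = v f - v g"
  using tangent_add[of v M x f "(-1) *\<^sub>R g"] tangent_scaleR[of v M x g "-1"] Cinf_scaleR[of g M "-1"]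
  by simp

lemma tangent_sum:
  assumes "v \<in> tangent_space M x" "\<And>i. i \<in> I \<Longrightarrow> f i \<in> Cinf M"
  shows "v (\<Sum>i\<in>I. f i) = (\<Sum>i\<in>I. v (f i))"
  using assms(2) by (induction I rule: infinite_finite_induct)
    (auto simp: tangent_zero[OF assms(1)] tangent_add[OF assms(1)] Cinf_sum)

lemma tangent_space_add: "u \<in> tangent_space M x \<Longrightarrow> v \<in> tangent_space M x \<Longrightarrow> u + v \<in> tangent_space M x"
  by (auto simp: tangent_space_def algebra_simps)

lemma tangent_space_scaleR: "v \<in> tangent_space M x \<Longrightarrow> c *\<^sub>R v \<in> tangent_space M x"
  by (auto simp: tangent_space_def scaleR_fun_def algebra_simps)

lemma tangent_space_zero [simp]: "0 \<in> tangent_space M x"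
  by (auto simp: tangent_space_def)

text \<open>Besides the chart, an orthonormal basis of its model subspace is fixed, so that the
  orthogonal projection onto that subspace has a simple formula.\<close>

locale manifold_chart =
  fixes M :: "('a, 'e::euclidean_space) mfd" and k :: nat and U :: "'a set" and \<phi> :: "'a \<Rightarrow> 'e" and B :: "'e set"
  assumes manifold: "manifold k M"
    and atlas: "(U, \<phi>) \<in> atlas M"
    and finite_B: "finite B"
    and orthonormal: "\<And>b c. b \<in> B \<Longrightarrow> c \<in> B \<Longrightarrow> b \<bullet> c = (if b = c then 1 else 0)"
    and open_image: "openin (top_of_set (span B)) (\<phi> ` U)"
begin

text \<open>\<open>dom\<close> is the open cylinder over the chart image in the ambient space, and
  \<open>param\<close> is the inverse chart made constant along the directions orthogonal to the
  model subspace. Functions on the manifold thus have Frechet derivatives in the full space even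
  when the chart image is not open there.\<close>

definition proj :: "'e \<Rightarrow> 'e" where "proj z = (\<Sum>b\<in>B. (z \<bullet> b) *\<^sub>R b)"
definition dom :: "'e set" where "dom = {z. proj z \<in> \<phi> ` U}"
definition param :: "'e \<Rightarrow> 'a" where "param z = inv_into U \<phi> (proj z)"

lemma chart: "chart k (mtop M) U \<phi>"
  using manifold atlas unfolding manifold_def by blast

lemma openin_U: "openin (mtop M) U" and homeo: "homeomorphic_map (subtopology (mtop M) U) (top_of_set (\<phi> ` U)) \<phi>"
  using chart unfolding chart_def by auto

lemma U_subset: "U \<subseteq> carrier M"
  using openin_U openin_subset by blast

lemma inj_chart: "inj_on \<phi> U"
  using homeomorphic_imp_injective_map[OF homeo] U_subset by (simp add: topspace_subtopology Int_absorb1)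

lemma bounded_linear_proj: "bounded_linear proj"
  unfolding proj_def by (intro bounded_linear_intros)

lemma proj_inner: "b \<in> B \<Longrightarrow> proj z \<bullet> b = z \<bullet> b"
  unfolding proj_def using finite_B orthonormal
  by (simp add: inner_sum_left if_distrib[of "\<lambda>x. _ * x"] cong: if_cong)

lemma proj_in_span: "proj z \<in> span B"
  unfolding proj_def by (intro span_sum span_scale span_base)

lemma proj_span: "z \<in> span B \<Longrightarrow> proj z = z"
proof (induction rule: span_induct_alt)
  case base
  then show ?case by (simp add: proj_def)
next
  case (step c x y)
  have "proj x = x"
    unfolding proj_def using step(1) finite_B orthonormal
    by (simp add: if_distrib[of "\<lambda>r. r *\<^sub>R _"] cong: if_cong)
  then show ?case
    using step bounded_linear_proj by (simp add: linear_add linear_scale bounded_linear.linear)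
qed

lemma proj_proj [simp]: "proj (proj z) = proj z"
  by (simp add: proj_in_span proj_span)

lemma chart_in_span: "x \<in> U \<Longrightarrow> \<phi> x \<in> span B"
  using openin_imp_subset[OF open_image] by blast

lemma proj_chart: "x \<in> U \<Longrightarrow> proj (\<phi> x) = \<phi> x"
  by (simp add: proj_span chart_in_span)

lemma chart_in_dom: "x \<in> U \<Longrightarrow> \<phi> x \<in> dom"
  by (simp add: dom_def proj_chart)

lemma param_chart: "x \<in> U \<Longrightarrow> param (\<phi> x) = x"
  by (simp add: param_def proj_chart inv_into_f_f inj_chart)

lemma param_in_U: "z \<in> dom \<Longrightarrow> param z \<in> U"
  by (simp add: dom_def param_def inv_into_into)

lemma chart_param: "z \<in> dom \<Longrightarrow> \<phi> (param z) = proj z"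
  by (simp add: dom_def param_def f_inv_into_f)

lemma dom_span: "z \<in> dom \<Longrightarrow> z \<in> span B \<Longrightarrow> z \<in> \<phi> ` U"
  by (simp add: dom_def proj_span)

lemma open_proj_vimage:
  assumes "openin (top_of_set (span B)) T"
  shows "open {z. proj z \<in> T}"
proof -
  obtain S where S: "open S" "T = span B \<inter> S"
    using assms unfolding openin_open by blast
  then have "{z. proj z \<in> T} = proj -` S" by (auto simp: proj_in_span)
  then show ?thesis
    using S(1) bounded_linear_proj by (simp add: continuous_open_vimage linear_continuous_at)
qed

lemma open_dom: "open dom"
  unfolding dom_def by (rule open_proj_vimage[OF open_image])

lemma openin_chart_image:
  assumes "openin (mtop M) V"
  shows "openin (top_of_set (\<phi> ` U)) (\<phi> ` (U \<inter> V))"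
proof -
  have "openin (subtopology (mtop M) U) (U \<inter> V)"
    using assms by (metis Int_commute openin_subtopology_Int)
  then show ?thesis
    using homeomorphic_imp_open_map[OF homeo] unfolding open_map_def by blast
qed

lemma chart_image_open:
  assumes "openin (mtop M) V"
  obtains T where "open T" "\<phi> ` (U \<inter> V) = \<phi> ` U \<inter> T"
  using openin_chart_image[OF assms] unfolding openin_open by blast

lemma open_param_vimage:
  assumes "openin (mtop M) V"
  shows "open {z \<in> dom. param z \<in> V}"
proof -
  have "{z \<in> dom. param z \<in> V} = {z. proj z \<in> \<phi> ` (U \<inter> V)}"
    by (auto simp: dom_def param_def inj_chart inv_into_f_f)
  then show ?thesis
    using open_proj_vimage openin_trans[OF openin_chart_image[OF assms] open_image] by simp
qed

lemma openin_chart_vimage: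
  assumes "open W"
  shows "openin (mtop M) {x \<in> U. \<phi> x \<in> W}"
proof -
  have "openin (subtopology (mtop M) U) {x \<in> topspace (subtopology (mtop M) U). \<phi> x \<in> \<phi> ` U \<inter> W}"
    using homeomorphic_imp_continuous_map[OF homeo] assms
    by (intro openin_continuous_map_preimage) auto
  moreover have "{x \<in> topspace (subtopology (mtop M) U). \<phi> x \<in> \<phi> ` U \<inter> W} = {x \<in> U. \<phi> x \<in> W}"
    using U_subset by auto
  ultimately show ?thesis
    using openin_trans_full openin_U by metis
qed

lemma Cinf_on_param:
  assumes "f \<in> Cinf M"
  shows "Cinf_on dom (\<lambda>z. f (param z))"
proof -
  have "smooth_on (\<phi> ` U) (f \<circ> inv_into U \<phi>)" using assms atlas by (auto simp: Cinf_def)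
  from smooth_on_pullback[OF this open_dom Cinf_on_bounded_linear[OF bounded_linear_proj]]
  show ?thesis by (auto simp: dom_def param_def)
qed

text \<open>A compact set in a Hausdorff space is closed. This is what allows a function with
  compact support in a chart to be extended by zero.\<close>

lemma closedin_param_image:
  assumes "compact K" "K \<subseteq> \<phi> ` U"
  shows "closedin (mtop M) (inv_into U \<phi> ` K)"
proof -
  obtain g where g: "homeomorphic_maps (subtopology (mtop M) U) (top_of_set (\<phi> ` U)) \<phi> g"
    using homeo homeomorphic_map_maps by blast
  have "g y = inv_into U \<phi> y" if "y \<in> \<phi> ` U" for y
    using g that U_subset inj_chart unfolding homeomorphic_maps_def
    by (auto simp: inv_into_f_f)
  then have e: "inv_into U \<phi> ` K = g ` K"
    using assms(2) by (auto intro!: image_cong)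
  have "compactin (top_of_set (\<phi> ` U)) K"
    using assms by (simp add: compactin_subtopology)
  then have "compactin (subtopology (mtop M) U) (g ` K)"
    using g image_compactin unfolding homeomorphic_maps_def by blast
  then have "compactin (mtop M) (g ` K)"
    by (simp add: compactin_subtopology)
  then show ?thesis
    unfolding e using manifold compactin_imp_closedin unfolding manifold_def by blast
qed

end

lemma manifold_chart_exists:
  assumes "manifold k M" "(U, \<phi>) \<in> atlas M"
  obtains B where "manifold_chart M k U \<phi> B"
proof -
  have "chart k (mtop M) U \<phi>" using assms unfolding manifold_def by blast
  then obtain S where S: "subspace S" "openin (top_of_set S) (\<phi> ` U)"
    unfolding chart_def by blast
  obtain B where B: "B \<subseteq> S" "pairwise orthogonal B" "\<And>x. x \<in> B \<Longrightarrow> norm x = 1" "independent B" "span B = S"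
    using orthonormal_basis_subspace[OF S(1)] by metis
  have "manifold_chart M k U \<phi> B"
  proof
    show "finite B" using B(4) independent_imp_finite by blast
    fix b c assume "b \<in> B" "c \<in> B"
    then show "b \<bullet> c = (if b = c then 1 else 0)"
      using B(2,3) by (auto simp: pairwise_def orthogonal_def norm_eq_1)
  qed (use assms S B in auto)
  then show ?thesis using that by blast
qed

lemma manifold_chart_at:
  assumes "manifold k M" "x \<in> carrier M"
  obtains U \<phi> B where "manifold_chart M k U \<phi> B" "x \<in> U"
proof -
  have "x \<in> (\<Union>(U, \<phi>)\<in>atlas M. U)" using assms unfolding manifold_def by simp
  then obtain U \<phi> where "(U, \<phi>) \<in> atlas M" "x \<in> U" by blast
  then show ?thesis using manifold_chart_exists[OF assms(1)] that by metis
qed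

lemma Cinf_localI:
  assumes "manifold k M"
    and loc: "\<And>x. x \<in> carrier M \<Longrightarrow> \<exists>V g. openin (mtop M) V \<and> x \<in> V \<and> g \<in> Cinf M \<and> (\<forall>y\<in>V. f y = g y)"
  shows "f \<in> Cinf M"
  unfolding Cinf_def
proof (clarify)
  fix U \<phi> assume a: "(U, \<phi>) \<in> atlas M"
  obtain B where "manifold_chart M k U \<phi> B" using manifold_chart_exists[OF assms(1) a] .
  then interpret manifold_chart M k U \<phi> B .
  show "smooth_on (\<phi> ` U) (f \<circ> inv_into U \<phi>)"
    unfolding smooth_on_Cinf_on
  proof
    fix y assume "y \<in> \<phi> ` U"
    then obtain x where x: "x \<in> U" "y = \<phi> x" by blast
    obtain V g where V: "openin (mtop M) V" "x \<in> V" "g \<in> Cinf M" "\<forall>y\<in>V. f y = g y"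
      using loc[of x] x(1) U_subset by (metis subsetD)
    obtain T where T: "open T" "\<phi> ` (U \<inter> V) = \<phi> ` U \<inter> T" using chart_image_open[OF V(1)] .
    obtain W F where W: "open W" "y \<in> W" "Cinf_on W F" "\<And>z. z \<in> W \<Longrightarrow> z \<in> \<phi> ` U \<Longrightarrow> F z = (g \<circ> inv_into U \<phi>) z"
    proof (rule smooth_onE)
      show "smooth_on (\<phi> ` U) (g \<circ> inv_into U \<phi>)" using V(3) a by (auto simp: Cinf_def)
      show "y \<in> \<phi> ` U" using x by blast
    qed (rule that)
    have "F z = (f \<circ> inv_into U \<phi>) z" if "z \<in> W \<inter> T \<inter> \<phi> ` U" for z
    proof -
      have "z \<in> \<phi> ` (U \<inter> V)" unfolding T(2) using that by simp
      then obtain u where "z = \<phi> u" "u \<in> U \<inter> V" by (rule imageE)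
      then show ?thesis using W(4)[of z] that V(4) inj_chart by auto
    qed
    moreover have "y \<in> \<phi> ` (U \<inter> V)" using x V(2) by blast
    then have "y \<in> T" unfolding T(2) by simp
    ultimately show "\<exists>W F. open W \<and> y \<in> W \<and> Cinf_on W F \<and> (\<forall>z\<in>W \<inter> \<phi> ` U. F z = (f \<circ> inv_into U \<phi>) z)"
      using W T(1) by (intro exI[of _ "W \<inter> T"] exI[of _ F]) (auto elim: Cinf_on_subset)
  qed
qed

lemma Cinf_openin_vimage:
  assumes "manifold k M" "f \<in> Cinf M" "open W"
  shows "openin (mtop M) {x \<in> carrier M. f x \<in> W}"
proof (subst openin_subopen, clarify)
  fix x assume x: "x \<in> carrier M" "f x \<in> W"
  obtain U \<phi> B where "manifold_chart M k U \<phi> B" and xU: "x \<in> U"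
    using manifold_chart_at[OF assms(1) x(1)] .
  then interpret manifold_chart M k U \<phi> B by simp
  have "open (dom \<inter> (\<lambda>z. f (param z)) -` W)"
    using continuous_open_preimage[OF Cinf_on_continuous[OF Cinf_on_param[OF assms(2)]] open_dom assms(3)] .
  from openin_chart_vimage[OF this]
  show "\<exists>T. openin (mtop M) T \<and> x \<in> T \<and> T \<subseteq> {x \<in> carrier M. f x \<in> W}"
    by (intro exI conjI, assumption) (use x xU chart_in_dom param_chart U_subset in auto)
qed

lemma Cinf_smooth_map:
  assumes "manifold k M" "manifold l N" "smooth_map M N F" "g \<in> Cinf N"
  shows "g \<circ> F \<in> Cinf M"
  unfolding Cinf_def
proof (clarify)
  fix U \<phi> assume a: "(U, \<phi>) \<in> atlas M"
  obtain B where "manifold_chart M k U \<phi> B" using manifold_chart_exists[OF assms(1) a] .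
  then interpret manifold_chart M k U \<phi> B .
  have F: "continuous_map (mtop M) (mtop N) F" using assms(3) by (simp add: smooth_map_def)
  show "smooth_on (\<phi> ` U) (g \<circ> F \<circ> inv_into U \<phi>)"
    unfolding smooth_on_Cinf_on
  proof
    fix y assume "y \<in> \<phi> ` U"
    then obtain x where x: "x \<in> U" "y = \<phi> x" by blast
    have "F x \<in> carrier N" using F x(1) U_subset unfolding continuous_map_def by blast
    then obtain V \<psi> B' where "manifold_chart N l V \<psi> B'" and FV: "F x \<in> V"
      using manifold_chart_at[OF assms(2)] by metis
    then interpret N: manifold_chart N l V \<psi> B' by simp
    let ?V = "{x \<in> carrier M. F x \<in> V}"
    have "openin (mtop M) ?V" using openin_continuous_map_preimage[OF F N.openin_U] .
    then obtain T where T: "open T" "\<phi> ` (U \<inter> ?V) = \<phi> ` U \<inter> T" using chart_image_open by metis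
    have UV: "U \<inter> ?V = U \<inter> F -` V" using U_subset by auto
    obtain W G where W: "open W" "y \<in> W" "Cinf_on W G"
      "\<And>z. z \<in> W \<Longrightarrow> z \<in> \<phi> ` (U \<inter> F -` V) \<Longrightarrow> G z = (\<psi> \<circ> F \<circ> inv_into U \<phi>) z"
    proof (rule smooth_onE)
      show "smooth_on (\<phi> ` (U \<inter> F -` V)) (\<psi> \<circ> F \<circ> inv_into U \<phi>)"
        using assms(3) a N.atlas unfolding smooth_map_def by fast
      show "y \<in> \<phi> ` (U \<inter> F -` V)" using x FV by blast
    qed (rule that)
    have Gy: "G y = \<psi> (F x)"
      using W(4)[of y] W(2) x FV inj_chart by auto
    \<comment> \<open>The extension \<open>G\<close> may leave the chart image. On this open set its
      values lie in \<open>N.dom\<close>, where \<open>N.param\<close> still makes sense of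
      them.\<close>
    let ?W = "W \<inter> G -` N.dom"
    have o: "open ?W"
      using continuous_open_preimage[OF Cinf_on_continuous[OF W(3)] W(1) N.open_dom] .
    have "Cinf_on ?W (\<lambda>z. g (N.param (G z)))"
      by (rule Cinf_on_compose[OF o N.open_dom _ Cinf_on_subset[OF W(3)] N.Cinf_on_param[OF assms(4)]]) auto
    moreover have "y \<in> ?W \<inter> T"
    proof -
      have "y \<in> \<phi> ` (U \<inter> ?V)" using x FV U_subset by auto
      then show ?thesis using W(2) Gy N.chart_in_dom[OF FV] T(2) by auto
    qed
    moreover have "g (N.param (G z)) = (g \<circ> F \<circ> inv_into U \<phi>) z" if "z \<in> ?W \<inter> T \<inter> \<phi> ` U" for z
    proof -
      have "z \<in> \<phi> ` (U \<inter> ?V)" unfolding T(2) using that by simp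
      then obtain u where "z = \<phi> u" "u \<in> U \<inter> F -` V" unfolding UV by (rule imageE)
      then show ?thesis using W(4)[of z] that inj_chart N.param_chart by auto
    qed
    ultimately show "\<exists>W H. open W \<and> y \<in> W \<and> Cinf_on W H \<and> (\<forall>z\<in>W \<inter> \<phi> ` U. H z = (g \<circ> F \<circ> inv_into U \<phi>) z)"
      using o T(1) by (intro exI[of _ "?W \<inter> T"] exI[of _ "\<lambda>z. g (N.param (G z))"]) (auto elim: Cinf_on_subset)
  qed
qed

text \<open>Seen from another chart, the function is smooth at a point of the original patch by the
  transition map. At any other point it vanishes on a whole neighbourhood, namely the complement of
  the compact support.\<close>

lemma (in manifold_chart) Cinf_extend:
  assumes "open D" "D \<subseteq> dom" "cball c s \<subseteq> D" "Cinf_on D F" "\<And>z. z \<in> D \<Longrightarrow> z \<notin> cball c s \<Longrightarrow> F z = 0"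
  shows "(\<lambda>x. if x \<in> U \<and> \<phi> x \<in> D then F (\<phi> x) else 0) \<in> Cinf M" (is "?f \<in> _")
  unfolding Cinf_def
proof (clarify)
  fix V \<psi> assume a: "(V, \<psi>) \<in> atlas M"
  obtain B' where "manifold_chart M k V \<psi> B'" using manifold_chart_exists[OF manifold a] .
  then interpret V: manifold_chart M k V \<psi> B' .
  show "smooth_on (\<psi> ` V) (?f \<circ> inv_into V \<psi>)"
    unfolding smooth_on_Cinf_on
  proof
    fix y assume "y \<in> \<psi> ` V"
    then obtain x where x: "x \<in> V" "y = \<psi> x" by blast
    show "\<exists>W H. open W \<and> y \<in> W \<and> Cinf_on W H \<and> (\<forall>z\<in>W \<inter> \<psi> ` V. H z = (?f \<circ> inv_into V \<psi>) z)"
    proof (cases "x \<in> U \<and> \<phi> x \<in> D")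
      case True
      obtain T where T: "open T" "\<psi> ` (V \<inter> U) = \<psi> ` V \<inter> T" using V.chart_image_open[OF openin_U] .
      obtain W G where W: "open W" "y \<in> W" "Cinf_on W G"
        "\<And>z. z \<in> W \<Longrightarrow> z \<in> \<psi> ` (V \<inter> U) \<Longrightarrow> G z = (\<phi> \<circ> inv_into V \<psi>) z"
      proof (rule smooth_onE)
        show "smooth_on (\<psi> ` (V \<inter> U)) (\<phi> \<circ> inv_into V \<psi>)"
          using manifold a atlas unfolding manifold_def by fast
        show "y \<in> \<psi> ` (V \<inter> U)" using x True by blast
      qed (rule that)
      let ?W = "W \<inter> G -` D"
      have o: "open ?W"
        using continuous_open_preimage[OF Cinf_on_continuous[OF W(3)] W(1) assms(1)] .
      have "Cinf_on ?W (\<lambda>z. F (G z))"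
        by (rule Cinf_on_compose[OF o assms(1) _ Cinf_on_subset[OF W(3)] assms(4)]) auto
      moreover have "y \<in> ?W \<inter> T"
      proof -
        have "y \<in> \<psi> ` (V \<inter> U)" using x True by blast
        moreover from this have "y \<in> T" unfolding T(2) by blast
        ultimately show ?thesis using W(2) W(4)[of y] x True V.inj_chart by auto
      qed
      moreover have "F (G z) = (?f \<circ> inv_into V \<psi>) z" if "z \<in> ?W \<inter> T \<inter> \<psi> ` V" for z
      proof -
        have "z \<in> \<psi> ` (V \<inter> U)" unfolding T(2) using that by simp
        then obtain u where "z = \<psi> u" "u \<in> V \<inter> U" by (rule imageE)
        then show ?thesis using W(4)[of z] that V.inj_chart by auto
      qed
      ultimately show ?thesis
        using o T(1) by (intro exI[of _ "?W \<inter> T"] exI[of _ "\<lambda>z. F (G z)"]) (auto elim: Cinf_on_subset)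
    next
      case False
      \<comment> \<open>\<open>dom\<close> meets the model subspace only in the chart image, so this
        compact set comes from points of \<open>U\<close>.\<close>
      let ?K = "cball c s \<inter> span B"
      have K: "?K \<subseteq> \<phi> ` U" using assms(2,3) dom_span by blast
      let ?O = "carrier M - inv_into U \<phi> ` ?K"
      have "compact ?K" by (simp add: compact_Int_closed closed_subspace)
      then have "openin (mtop M) ?O"
        using closedin_param_image[OF _ K] by (simp add: openin_diff)
      then obtain T where T: "open T" "\<psi> ` (V \<inter> ?O) = \<psi> ` V \<inter> T" using V.chart_image_open by metis
      have "x \<notin> inv_into U \<phi> ` ?K"
      proof
        assume "x \<in> inv_into U \<phi> ` ?K"
        then obtain z where z: "z \<in> ?K" "x = inv_into U \<phi> z" by blast
        then have "x \<in> U" "\<phi> x = z" using K by (auto simp: inv_into_into f_inv_into_f)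
        then show False using False z assms(3) by blast
      qed
      then have "y \<in> \<psi> ` (V \<inter> ?O)" using x V.U_subset by auto
      then have "y \<in> T" using T(2) by auto
      moreover have "0 = (?f \<circ> inv_into V \<psi>) z" if "z \<in> T \<inter> \<psi> ` V" for z
      proof -
        have "z \<in> \<psi> ` (V \<inter> ?O)" unfolding T(2) using that by simp
        then obtain u where u: "z = \<psi> u" "u \<in> V \<inter> ?O" by (rule imageE)
        have "\<phi> u \<notin> cball c s" if "u \<in> U"
        proof
          assume "\<phi> u \<in> cball c s"
          then have "inv_into U \<phi> (\<phi> u) \<in> inv_into U \<phi> ` ?K"
            using chart_in_span[OF that] by blast
          then show False using u that inj_chart by (simp add: inv_into_f_f)
        qed
        then show ?thesis using u V.inj_chart assms(5) by auto
      qed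
      ultimately show ?thesis
        using T(1) by (intro exI[of _ T] exI[of _ "\<lambda>z. 0"]) auto
    qed
  qed
qed

section \<open>Local coordinates and vector fields\<close>

lemma sum_apply: "(\<Sum>i\<in>I. f i) x = (\<Sum>i\<in>I. f i x)"
  for f :: "'i \<Rightarrow> 'a \<Rightarrow> 'b::comm_monoid_add"
  by (induction I rule: infinite_finite_induct) auto

text \<open>Three radii: \<open>\<beta>\<close> equals 1 up to \<open>r\<close> and vanishes from
  \<open>2 * r\<close> on, while the ball of radius \<open>3 * r\<close> still lies in
  \<open>dom\<close>. The outer margin leaves room for an open convex set containing the support of
  \<open>\<beta>\<close>.\<close>

locale coordinates = manifold_chart M k U \<phi> B
  for M :: "('a, 'e::euclidean_space) mfd" and k U \<phi> B +
  fixes x0 :: 'a and r :: real and \<beta> :: "'e \<Rightarrow> real"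
  assumes x0: "x0 \<in> U" and r: "0 < r" and ball: "cball (\<phi> x0) (3 * r) \<subseteq> dom"
    and \<beta>: "Cinf_on UNIV \<beta>" "\<And>z. z \<in> cball (\<phi> x0) r \<Longrightarrow> \<beta> z = 1"
      "\<And>z. z \<notin> ball (\<phi> x0) (2 * r) \<Longrightarrow> \<beta> z = 0"
begin

definition nbhd :: "'a set" where "nbhd = {x \<in> U. \<phi> x \<in> ball (\<phi> x0) r}"
text \<open>Tangent vectors act on functions defined on all of M, so the coordinate functions and
  coordinate fields are cut off by \<open>\<beta>\<close>; on \<open>nbhd\<close> the cut-off has no
  effect. \<open>field b\<close> is zero on functions outside \<open>Cinf M\<close>, as the
  representation of tangent vectors demands.\<close>

definition bump :: "'a \<Rightarrow> real" where "bump = (\<lambda>x. if x \<in> U then \<beta> (\<phi> x) else 0)"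
definition coord :: "'e \<Rightarrow> 'a \<Rightarrow> real" where "coord b = (\<lambda>x. if x \<in> U then \<beta> (\<phi> x) * (\<phi> x \<bullet> b) else 0)"
definition field :: "'e \<Rightarrow> 'a vfield" where
  "field b = (\<lambda>x f. if x \<in> U \<and> f \<in> Cinf M
     then \<beta> (\<phi> x) * frechet_derivative (\<lambda>z. f (param z)) (at (\<phi> x)) b else 0)"

lemma openin_nbhd: "openin (mtop M) nbhd"
  unfolding nbhd_def by (rule openin_chart_vimage) simp

lemma x0_nbhd: "x0 \<in> nbhd"
  using x0 r by (simp add: nbhd_def)

lemma nbhd_subset_U: "nbhd \<subseteq> U"
  by (auto simp: nbhd_def)

lemma nbhd_subset: "nbhd \<subseteq> carrier M"
  using nbhd_subset_U U_subset by blast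

lemma \<beta>_nbhd: "x \<in> nbhd \<Longrightarrow> \<beta> (\<phi> x) = 1"
  using \<beta>(2) by (auto simp: nbhd_def)

lemma Cinf_extend_bump:
  assumes "open D" "D \<subseteq> dom" "cball (\<phi> x0) (2 * r) \<subseteq> D" "Cinf_on D F"
  shows "(\<lambda>x. if x \<in> U \<and> \<phi> x \<in> D then \<beta> (\<phi> x) * F (\<phi> x) else 0) \<in> Cinf M"
proof (rule Cinf_extend[OF assms(1-3)])
  show "Cinf_on D (\<lambda>z. \<beta> z * F z)"
    by (intro Cinf_on_mult assms Cinf_on_subset[OF \<beta>(1)]) simp
  show "\<beta> z * F z = 0" if "z \<notin> cball (\<phi> x0) (2 * r)" for z
    using \<beta>(3)[of z] that by simp
qed

lemma ball2: "cball (\<phi> x0) (2 * r) \<subseteq> dom"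
  using ball r by (auto simp: subset_iff)

lemma Cinf_extend_bump_dom:
  assumes "Cinf_on dom F"
  shows "(\<lambda>x. if x \<in> U then \<beta> (\<phi> x) * F (\<phi> x) else 0) \<in> Cinf M"
  using Cinf_extend_bump[OF open_dom order_refl ball2 assms] chart_in_dom by (simp cong: conj_cong)

lemma bump_Cinf: "bump \<in> Cinf M"
  unfolding bump_def using Cinf_extend_bump_dom[of "\<lambda>_. 1"] by (simp cong: if_cong)

lemma bump_nbhd: "x \<in> nbhd \<Longrightarrow> bump x = 1"
  using nbhd_subset_U \<beta>_nbhd by (auto simp: bump_def)

lemma bump_outside: "bump x \<noteq> 0 \<Longrightarrow> x \<in> U \<and> \<phi> x \<in> ball (\<phi> x0) (2 * r)"
  using \<beta>(3) by (auto simp: bump_def split: if_splits)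

lemma coord_Cinf: "coord b \<in> Cinf M"
  unfolding coord_def by (rule Cinf_extend_bump_dom) (intro Cinf_on_bounded_linear bounded_linear_inner_left)

lemma coord_nbhd: "x \<in> nbhd \<Longrightarrow> coord b x = \<phi> x \<bullet> b"
  using nbhd_subset_U \<beta>_nbhd by (auto simp: coord_def)

lemma chart_eq_sum_coord:
  assumes "x \<in> nbhd"
  shows "\<phi> x = (\<Sum>b\<in>B. coord b x *\<^sub>R b)"
proof -
  have "\<phi> x = proj (\<phi> x)" using proj_chart nbhd_subset_U assms by auto
  then show ?thesis using coord_nbhd[OF assms] by (simp add: proj_def)
qed

lemma param_differentiable: "f \<in> Cinf M \<Longrightarrow> x \<in> U \<Longrightarrow> (\<lambda>z. f (param z)) differentiable (at (\<phi> x))"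
  using Cinf_on_differentiable[OF Cinf_on_param] chart_in_dom by blast

lemma field_tangent:
  assumes "x \<in> carrier M"
  shows "field b x \<in> tangent_space M x"
proof (cases "x \<in> U")
  case False
  then show ?thesis by (simp add: tangent_space_def field_def)
next
  case True
  let ?D = "\<lambda>f. frechet_derivative (\<lambda>z. f (param z)) (at (\<phi> x))"
  have d: "((\<lambda>z. f (param z)) has_derivative ?D f) (at (\<phi> x))" if "f \<in> Cinf M" for f
    using has_frechet_derivative[OF param_differentiable[OF that True]] .
  have "?D (f + g) = (\<lambda>v. ?D f v + ?D g v)" if "f \<in> Cinf M" "g \<in> Cinf M" for f g
    using frechet_derivativeI[OF has_derivative_add[OF d[OF that(1)] d[OF that(2)]]]
    by (simp add: plus_fun_def)
  moreover have "?D (f * g) = (\<lambda>v. f x * ?D g v + ?D f v * g x)" if "f \<in> Cinf M" "g \<in> Cinf M" for f g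
    using frechet_derivativeI[OF has_derivative_mult[OF d[OF that(1)] d[OF that(2)]]]
    by (simp add: times_fun_def param_chart[OF True])
  moreover have "?D (c *\<^sub>R f) = (\<lambda>v. c * ?D f v)" if "f \<in> Cinf M" for c f
    using frechet_derivativeI[OF has_derivative_mult_right[OF d[OF that], of c]]
    by (simp add: scaleR_fun_def)
  ultimately show ?thesis
    by (auto simp: tangent_space_def field_def Cinf_add Cinf_mult Cinf_scaleR algebra_simps)
qed

lemma field_vfield: "field b \<in> vfields M"
proof -
  have "vapply (field b) f \<in> Cinf M" if "f \<in> Cinf M" for f
    using Cinf_extend_bump_dom[OF Cinf_on_derivative[OF Cinf_on_param[OF that]], of b] that
    by (simp add: vapply_def field_def cong: if_cong)
  then show ?thesis
    using field_tangent U_subset by (auto simp: vfields_def field_def fun_eq_iff)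
qed

lemma field_nbhd:
  "x \<in> nbhd \<Longrightarrow> f \<in> Cinf M \<Longrightarrow> field b x f = frechet_derivative (\<lambda>z. f (param z)) (at (\<phi> x)) b"
  using nbhd_subset_U \<beta>_nbhd by (auto simp: field_def)

end

lemma coordinates_exist:
  fixes M :: "('a, 'b::euclidean_space) mfd"
  assumes "manifold k M" "x0 \<in> carrier M" "openin (mtop M) V" "x0 \<in> V"
  obtains U \<phi> B r \<beta> where "coordinates M k U \<phi> B x0 r \<beta>"
    "\<And>z. z \<in> cball (\<phi> x0) (3 * r) \<Longrightarrow> manifold_chart.param U \<phi> B z \<in> V"
proof -
  obtain U \<phi> B where "manifold_chart M k U \<phi> B" and x0: "x0 \<in> U"
    using manifold_chart_at[OF assms(1,2)] .
  then interpret manifold_chart M k U \<phi> B by simp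
  have "open {z \<in> dom. param z \<in> V}" "\<phi> x0 \<in> {z \<in> dom. param z \<in> V}"
    using open_param_vimage[OF assms(3)] x0 assms(4) chart_in_dom param_chart by auto
  then obtain e where e: "e > 0" "cball (\<phi> x0) e \<subseteq> {z \<in> dom. param z \<in> V}"
    using open_contains_cball by blast
  define r where "r = e / 3"
  have r: "0 < r" "r < 2 * r" "3 * r = e" using e by (auto simp: r_def)
  have "\<exists>\<beta>::'b \<Rightarrow> real. Cinf_on UNIV \<beta> \<and> (\<forall>z\<in>cball (\<phi> x0) r. \<beta> z = 1) \<and> (\<forall>z. z \<notin> ball (\<phi> x0) (2 * r) \<longrightarrow> \<beta> z = 0)"
    using ex_bump[OF r(1,2), of "\<phi> x0"] by metis
  then obtain \<beta> :: "'b \<Rightarrow> real" where \<beta>: "Cinf_on UNIV \<beta>" "\<And>z. z \<in> cball (\<phi> x0) r \<Longrightarrow> \<beta> z = 1"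
    "\<And>z. z \<notin> ball (\<phi> x0) (2 * r) \<Longrightarrow> \<beta> z = 0"
    by blast
  have "coordinates M k U \<phi> B x0 r \<beta>"
    by unfold_locales (use x0 r e \<beta> in auto)
  then show ?thesis by (rule that) (use e(2) r in auto)
qed

text \<open>The last conclusion includes points off the carrier. Tangent vectors act on functions on the whole
  type, so \<open>tangent_local\<close> needs a product that vanishes everywhere.\<close>

lemma ex_bump_function:
  assumes "manifold k M" "openin (mtop M) V" "x0 \<in> V"
  obtains g W where "g \<in> Cinf M" "openin (mtop M) W" "x0 \<in> W" "W \<subseteq> V"
    "\<And>x. x \<in> W \<Longrightarrow> g x = 1" "\<And>x. x \<notin> V \<Longrightarrow> g x = 0"
proof -
  have "x0 \<in> carrier M" using assms(2,3) openin_subset by blast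
  then obtain U \<phi> B r \<beta> where "coordinates M k U \<phi> B x0 r \<beta>"
    and V: "\<And>z. z \<in> cball (\<phi> x0) (3 * r) \<Longrightarrow> manifold_chart.param U \<phi> B z \<in> V"
    using coordinates_exist[OF assms(1) _ assms(2,3)] by metis
  then interpret coordinates M k U \<phi> B x0 r \<beta> by simp
  have V: "x \<in> V" if "x \<in> U" "\<phi> x \<in> ball (\<phi> x0) (2 * r)" for x
    using V[of "\<phi> x"] param_chart[OF that(1)] that(2) r by simp
  show ?thesis
  proof (rule that)
    show "nbhd \<subseteq> V" using V r by (auto simp: nbhd_def)
    show "bump x = 0" if "x \<notin> V" for x using bump_outside V that by blast
  qed (use bump_Cinf openin_nbhd x0_nbhd bump_nbhd in auto)
qed

text \<open>For a bump \<open>\<beta>\<close> at \<open>x\<close> supported in \<open>V\<close> the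
  product of \<open>f - g\<close> and \<open>\<beta>\<close> is zero. The product rule then leaves
  only \<open>v (f - g)\<close>, because \<open>f - g\<close> vanishes at \<open>x\<close> and
  \<open>\<beta>\<close> is 1 there.\<close>

lemma tangent_local:
  assumes "manifold k M" "v \<in> tangent_space M x" "f \<in> Cinf M" "g \<in> Cinf M"
    and "openin (mtop M) V" "x \<in> V" "\<And>y. y \<in> V \<Longrightarrow> f y = g y"
  shows "v f = v g"
proof -
  obtain \<beta> W where \<beta>: "\<beta> \<in> Cinf M" "x \<in> W" "\<And>y. y \<in> W \<Longrightarrow> \<beta> y = 1" "\<And>y. y \<notin> V \<Longrightarrow> \<beta> y = 0"
    using ex_bump_function[OF assms(1,5,6)] by metis
  have "(f - g) * \<beta> = 0" using \<beta>(4) assms(7) by (auto simp: fun_eq_iff)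
  then have "v ((f - g) * \<beta>) = 0" using tangent_zero[OF assms(2)] by simp
  then have "v (f - g) = 0"
    using tangent_mult[OF assms(2) Cinf_diff[OF assms(3,4)] \<beta>(1)] assms(6,7) \<beta>(2,3) by simp
  then show ?thesis using tangent_diff[OF assms(2-4)] by simp
qed

context coordinates
begin

text \<open>Hadamard's lemma at \<open>\<phi> x\<close> writes \<open>f\<close> near
  \<open>x\<close> as a constant plus products \<open>h b * g b\<close> with
  \<open>h b x = 0\<close>, and a derivation reduces each product to \<open>v (coord b)\<close>
  times \<open>g b x\<close>. The Hadamard factors live only on a ball, hence their multiplication
  by \<open>\<beta>\<close>.\<close>

lemma tangent_expansion:
  assumes "x \<in> nbhd" "v \<in> tangent_space M x" "f \<in> Cinf M"
  shows "v f = (\<Sum>b\<in>B. v (coord b) * field b x f)"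
proof -
  \<comment> \<open>Convex, as Hadamard's lemma requires, and containing
    \<open>cball (\<phi> x0) (2 * r)\<close>, as \<open>Cinf_extend_bump\<close> requires.\<close>
  let ?D = "ball (\<phi> x0) (3 * r)" and ?F = "\<lambda>z. f (param z)"
  have xU: "x \<in> U" and xb: "\<phi> x \<in> ball (\<phi> x0) r" using assms(1) by (auto simp: nbhd_def)
  have D: "?D \<subseteq> dom" using ball ball_subset_cball by blast
  have "\<phi> x \<in> ?D" using xb r by auto
  then obtain G where G: "\<And>b. Cinf_on ?D (G b)" "\<And>b. G b (\<phi> x) = frechet_derivative ?F (at (\<phi> x)) b"
    "\<And>z I c. z \<in> ?D \<Longrightarrow> finite I \<Longrightarrow> z - \<phi> x = (\<Sum>b\<in>I. c b *\<^sub>R b) \<Longrightarrow> ?F z = ?F (\<phi> x) + (\<Sum>b\<in>I. c b * G b z)"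
    by (rule Hadamard[OF open_ball convex_ball _ Cinf_on_subset[OF Cinf_on_param[OF assms(3)] D]]) (rule that)
  define g where "g = (\<lambda>b y. if y \<in> U \<and> \<phi> y \<in> ?D then \<beta> (\<phi> y) * G b (\<phi> y) else 0)"
  have g: "g b \<in> Cinf M" for b
    unfolding g_def using r by (intro Cinf_extend_bump open_ball D G(1)) auto
  have gy: "g b y = G b (\<phi> y)" "\<phi> y \<in> ?D" if "y \<in> nbhd" for b y
    using that \<beta>_nbhd[OF that] r by (auto simp: g_def nbhd_def)
  define h where "h = (\<lambda>b. coord b - (\<lambda>y. coord b x))"
  have h: "h b \<in> Cinf M" "h b x = 0" "v (h b) = v (coord b)" for b
    using tangent_diff[OF assms(2) coord_Cinf Cinf_const] tangent_const[OF assms(2)]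
    by (auto simp: h_def intro!: Cinf_diff coord_Cinf)
  have "f y = ((\<lambda>y. f x) + (\<Sum>b\<in>B. h b * g b)) y" if y: "y \<in> nbhd" for y
  proof -
    have "\<phi> y - \<phi> x = (\<Sum>b\<in>B. (coord b y - coord b x) *\<^sub>R b)"
      using chart_eq_sum_coord[OF y] chart_eq_sum_coord[OF assms(1)]
      by (simp add: sum_subtractf scaleR_left_diff_distrib)
    from G(3)[OF gy(2)[OF y] finite_B this] show ?thesis
      using y nbhd_subset_U assms(1) gy(1)[OF y] by (simp add: param_chart subsetD h_def sum_apply)
  qed
  then have "v f = v ((\<lambda>y. f x) + (\<Sum>b\<in>B. h b * g b))"
    by (intro tangent_local[OF manifold assms(2,3) _ openin_nbhd assms(1)] Cinf_add Cinf_sum Cinf_mult h g) auto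
  also have "\<dots> = (\<Sum>b\<in>B. v (h b * g b))"
    using tangent_add[OF assms(2) Cinf_const[of "f x"] Cinf_sum[of B "\<lambda>b. h b * g b"]]
      tangent_sum[OF assms(2), of B "\<lambda>b. h b * g b"] tangent_const[OF assms(2), of "f x"]
    by (simp add: Cinf_mult h g)
  also have "\<dots> = (\<Sum>b\<in>B. v (coord b) * field b x f)"
  proof (rule sum.cong[OF refl])
    fix b
    show "v (h b * g b) = v (coord b) * field b x f"
      using tangent_mult[OF assms(2) h(1) g, of b b] by (simp add: h gy(1) G(2) field_nbhd assms)
  qed
  finally show ?thesis .
qed

lemma field_coord:
  assumes "x \<in> nbhd" "b \<in> B" "c \<in> B"
  shows "field b x (coord c) = (if b = c then 1 else 0)"
proof -
  have x: "x \<in> U" "\<phi> x \<in> dom" using assms(1) nbhd_subset_U chart_in_dom by auto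
  have "((\<lambda>z. z \<bullet> c) has_derivative (\<lambda>v. v \<bullet> c)) (at (\<phi> x))"
    by (auto intro!: derivative_eq_intros)
  then have "((\<lambda>z. coord c (param z)) has_derivative (\<lambda>v. v \<bullet> c)) (at (\<phi> x))"
  proof (rule has_derivative_transform_within_open)
    show "open {z \<in> dom. param z \<in> nbhd}" by (rule open_param_vimage[OF openin_nbhd])
    show "\<phi> x \<in> {z \<in> dom. param z \<in> nbhd}" using assms(1) x by (simp add: param_chart)
    fix z assume "z \<in> {z \<in> dom. param z \<in> nbhd}"
    then show "z \<bullet> c = coord c (param z)"
      using assms(3) by (simp add: coord_nbhd chart_param proj_inner)
  qed
  then show ?thesis
    using field_nbhd[OF assms(1) coord_Cinf] orthonormal[OF assms(2,3)] frechet_derivativeI by fastforce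
qed

end

section \<open>Algebra of vector fields\<close>

lemma vfields_tangent: "X \<in> vfields M \<Longrightarrow> x \<in> carrier M \<Longrightarrow> X x \<in> tangent_space M x"
  and vfields_outside: "X \<in> vfields M \<Longrightarrow> x \<notin> carrier M \<Longrightarrow> X x = 0"
  and vapply_Cinf: "X \<in> vfields M \<Longrightarrow> f \<in> Cinf M \<Longrightarrow> vapply X f \<in> Cinf M"
  by (auto simp: vfields_def)

lemma vfields_tangent_all: "X \<in> vfields M \<Longrightarrow> X x \<in> tangent_space M x"
  using vfields_tangent vfields_outside tangent_space_zero by metis

lemma vfields_add: "X \<in> vfields M \<Longrightarrow> Y \<in> vfields M \<Longrightarrow> X + Y \<in> vfields M"
  using Cinf_add[of "vapply X _" M "vapply Y _"]
  by (auto simp: vfields_def vapply_def plus_fun_def intro!: tangent_space_add[unfolded plus_fun_def])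

lemma fmult_vfields: "f \<in> Cinf M \<Longrightarrow> X \<in> vfields M \<Longrightarrow> fmult f X \<in> vfields M"
  using Cinf_mult[of f M "vapply X _"]
  by (auto simp: vfields_def vapply_def fmult_def times_fun_def scaleR_fun_def
      intro!: tangent_space_scaleR[unfolded scaleR_fun_def real_scaleR_def])

lemma vfields_zero [simp]: "0 \<in> vfields M"
  using Cinf_0[of M] by (auto simp: vfields_def vapply_def zero_fun_def tangent_space_def)

lemma vfields_sum: "(\<And>i. i \<in> I \<Longrightarrow> X i \<in> vfields M) \<Longrightarrow> (\<Sum>i\<in>I. X i) \<in> vfields M"
  by (induction I rule: infinite_finite_induct) (auto intro: vfields_add)

lemma vfields_minus: "X \<in> vfields M \<Longrightarrow> - X \<in> vfields M"
  using fmult_vfields[OF Cinf_const[of "-1" M]] by (simp add: fmult_def fun_eq_iff fun_Compl_def)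

lemma vfields_diff: "X \<in> vfields M \<Longrightarrow> Y \<in> vfields M \<Longrightarrow> X - Y \<in> vfields M"
  using vfields_add[OF _ vfields_minus, of X M Y] by simp

lemma fmult_apply: "fmult f X x g = f x * X x g"
  by (simp add: fmult_def scaleR_fun_def)

lemma bracket_vfields:
  assumes "X \<in> vfields M" "Y \<in> vfields M"
  shows "bracket X Y \<in> vfields M"
proof -
  note t = vfields_tangent_all[OF assms(1)] vfields_tangent_all[OF assms(2)]
  note c = vapply_Cinf[OF assms(1)] vapply_Cinf[OF assms(2)]
  have va: "vapply Z (f + g) = vapply Z f + vapply Z g" "vapply Z (f * g) = f * vapply Z g + g * vapply Z f"
    "vapply Z (a *\<^sub>R f) = a *\<^sub>R vapply Z f"
    if "Z \<in> vfields M" "f \<in> Cinf M" "g \<in> Cinf M" for Z f g a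
    using tangent_add[OF vfields_tangent_all[OF that(1)] that(2,3)]
      tangent_mult[OF vfields_tangent_all[OF that(1)] that(2,3)]
      tangent_scaleR[OF vfields_tangent_all[OF that(1)] that(2)]
    by (simp_all add: vapply_def fun_eq_iff scaleR_fun_def)
  have v0: "vapply Z f = 0" if "Z \<in> vfields M" "f \<notin> Cinf M" for Z f
    using tangent_notin[OF vfields_tangent_all[OF that(1)] that(2)] by (simp add: vapply_def fun_eq_iff)
  have "bracket X Y x \<in> tangent_space M x" for x
  proof -
    note tX = t(1)[of x] and tY = t(2)[of x]
    have ev: "vapply Z f x = Z x f" for Z f by (simp add: vapply_def)
    show ?thesis
      unfolding tangent_space_def bracket_def using assms c
      by (auto simp: va v0 ev tangent_zero[OF tX] tangent_zero[OF tY] tangent_add[OF tX] tangent_add[OF tY]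
          tangent_scaleR[OF tX] tangent_scaleR[OF tY] tangent_mult[OF tX] tangent_mult[OF tY]
          Cinf_mult algebra_simps)
  qed
  moreover have "vapply (bracket X Y) f \<in> Cinf M" if "f \<in> Cinf M" for f
  proof -
    have "vapply (bracket X Y) f = vapply X (vapply Y f) - vapply Y (vapply X f)"
      by (auto simp: vapply_def bracket_def)
    then show ?thesis using c that by (simp add: Cinf_diff)
  qed
  ultimately show ?thesis
    using assms by (auto simp: vfields_def bracket_def fun_eq_iff)
qed

text \<open>The components of \<open>v\<close> are used as constant coefficients of the cut-off
  coordinate fields.\<close>

lemma vfield_through:
  assumes "manifold k M" "x \<in> carrier M" "v \<in> tangent_space M x"
  obtains X where "X \<in> vfields M" "X x = v"
proof -
  obtain U \<phi> B r \<beta> where "coordinates M k U \<phi> B x r \<beta>"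
    using coordinates_exist[OF assms(1,2) openin_topspace assms(2)] by metis
  then interpret coordinates M k U \<phi> B x r \<beta> .
  let ?X = "\<Sum>b\<in>B. fmult (\<lambda>_. v (coord b)) (field b)"
  have X: "?X \<in> vfields M" by (intro vfields_sum fmult_vfields field_vfield Cinf_const)
  have "?X x f = v f" for f
  proof (cases "f \<in> Cinf M")
    case True
    then show ?thesis
      using tangent_expansion[OF x0_nbhd assms(3)] by (simp add: sum_apply fmult_apply)
  next
    case False
    then show ?thesis
      using tangent_notin[OF assms(3)] tangent_notin[OF vfields_tangent_all[OF X]] by simp
  qed
  then show ?thesis using that[OF X] by (simp add: fun_eq_iff)
qed

text \<open>The reciprocal is smooth only where \<open>f\<close> is nonzero, so the coordinate ball
  is chosen inside that open set before cutting off.\<close>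

lemma Cinf_inverse_near:
  assumes "manifold k M" "x \<in> carrier M" "f \<in> Cinf M" "f x \<noteq> 0"
  obtains g V where "g \<in> Cinf M" "openin (mtop M) V" "x \<in> V" "\<And>y. y \<in> V \<Longrightarrow> g y * f y = 1"
proof -
  have o: "openin (mtop M) {y \<in> carrier M. f y \<in> - {0}}"
    by (rule Cinf_openin_vimage[OF assms(1,3)]) auto
  obtain U \<phi> B r \<beta> where "coordinates M k U \<phi> B x r \<beta>"
    and V: "\<And>z. z \<in> cball (\<phi> x) (3 * r) \<Longrightarrow> manifold_chart.param U \<phi> B z \<in> {y \<in> carrier M. f y \<in> - {0}}"
  proof (rule coordinates_exist[OF assms(1,2) o])
    show "x \<in> {y \<in> carrier M. f y \<in> - {0}}" using assms(2,4) by simp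
  qed (rule that)
  then interpret coordinates M k U \<phi> B x r \<beta> by simp
  let ?D = "dom \<inter> (\<lambda>z. f (param z)) -` (- {0})"
  have D: "open ?D"
    using continuous_open_preimage[OF Cinf_on_continuous[OF Cinf_on_param[OF assms(3)]] open_dom] by auto
  have D2: "cball (\<phi> x) (2 * r) \<subseteq> ?D"
    using ball2 V r by (auto simp: subset_iff)
  have "Cinf_on ?D (\<lambda>z. inverse (f (param z)))"
    by (rule Cinf_on_inverse[OF D _ Cinf_on_subset[OF Cinf_on_param[OF assms(3)]]]) auto
  from Cinf_extend_bump[OF D _ D2 this]
  show ?thesis
  proof (rule that[OF _ openin_nbhd x0_nbhd])
    fix y assume y: "y \<in> nbhd"
    then have "y \<in> U" "\<phi> y \<in> cball (\<phi> x) (2 * r)" using r by (auto simp: nbhd_def)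
    then show "(if y \<in> U \<and> \<phi> y \<in> ?D then \<beta> (\<phi> y) * inverse (f (param (\<phi> y))) else 0) * f y = 1"
      using D2 \<beta>_nbhd[OF y] by (auto simp: param_chart subset_iff)
  qed auto
qed

section \<open>Dual frames and locally constant functions\<close>

text \<open>Only differentiability of the inverse is recorded: the higher derivatives of functions
  on Q are reached through \<open>Cinf_on_coinduct\<close>.\<close>

lemma Cinf_inverse_function:
  fixes F :: "'e::euclidean_space \<Rightarrow> 'e"
  assumes "open D" "Cinf_on D F" "y0 \<in> D" "(F has_derivative (\<lambda>v. v)) (at y0)"
  obtains W G where "open W" "F y0 \<in> W" "G ` W \<subseteq> D" "G (F y0) = y0"
    "\<And>y. y \<in> W \<Longrightarrow> F (G y) = y" "\<And>y. y \<in> W \<Longrightarrow> G differentiable (at y)"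
proof -
  let ?f' = "\<lambda>x. Blinfun (frechet_derivative F (at x))"
  have d: "(F has_derivative blinfun_apply (?f' x)) (at x)"
    "blinfun_apply (?f' x) = frechet_derivative F (at x)" if "x \<in> D" for x
    using Cinf_on_has_derivative[OF assms(2) that]
    by (simp_all add: bounded_linear_Blinfun_apply has_derivative_bounded_linear)
  have c: "continuous_on D ?f'"
  proof (rule continuous_on_blinfun_componentwise)
    fix i :: 'e
    show "continuous_on D (\<lambda>x. blinfun_apply (?f' x) i)"
      using Cinf_on_continuous[OF Cinf_on_derivative[OF assms(2), of i]]
      by (rule continuous_on_eq) (simp add: d(2))
  qed
  \<comment> \<open>The inverse function theorem asks for a one-sided inverse of the derivative;
    since that derivative is the identity, the identity serves.\<close>
  have i: "id_blinfun o\<^sub>L ?f' y0 = id_blinfun"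
    using d(2)[OF assms(3)] frechet_derivativeI[OF assms(4)] by (intro blinfun_eqI) simp
  obtain U' V g g' where "open V" "F y0 \<in> V" and U': "U' \<subseteq> D" "y0 \<in> U'" "homeomorphism U' V F g"
    and "\<And>y. y \<in> V \<Longrightarrow> (g has_derivative g' y) (at y)"
    using inverse_function_theorem[OF assms(1) d(1) c assms(3) i] by metis
  moreover from this have "g ` V \<subseteq> D" "g (F y0) = y0" "\<And>y. y \<in> V \<Longrightarrow> F (g y) = y"
    by (auto simp: homeomorphism_def)
  ultimately show ?thesis using that[of V g] differentiableI by blast
qed

text \<open>Turns smoothness of a single chart expression into the local agreement with a globally
  smooth function that \<open>Cinf_localI\<close> asks for.\<close>

lemma (in manifold_chart) Cinf_on_param_local:
  assumes "open D" "D \<subseteq> dom" "x0 \<in> U" "\<phi> x0 \<in> D" "Cinf_on D (\<lambda>z. f (param z))"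
  shows "\<exists>V g. openin (mtop M) V \<and> x0 \<in> V \<and> g \<in> Cinf M \<and> (\<forall>y\<in>V. f y = g y)"
proof -
  obtain e where e: "e > 0" "cball (\<phi> x0) e \<subseteq> D"
    using assms(1,4) open_contains_cball by blast
  obtain \<beta> :: "'e \<Rightarrow> real" where \<beta>: "Cinf_on UNIV \<beta>" "\<forall>z\<in>cball (\<phi> x0) (e / 2). \<beta> z = 1" "\<forall>z. z \<notin> ball (\<phi> x0) e \<longrightarrow> \<beta> z = 0"
    using ex_bump[of "e / 2" e "\<phi> x0"] e(1) by (metis half_gt_zero field_sum_of_halves less_add_same_cancel1)
  let ?g = "\<lambda>x. if x \<in> U \<and> \<phi> x \<in> D then \<beta> (\<phi> x) * f (param (\<phi> x)) else 0"
  let ?V = "{x \<in> U. \<phi> x \<in> ball (\<phi> x0) (e / 2)}"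
  have "?g \<in> Cinf M"
  proof (rule Cinf_extend[OF assms(1,2) e(2)])
    show "Cinf_on D (\<lambda>z. \<beta> z * f (param z))"
      by (intro Cinf_on_mult assms Cinf_on_subset[OF \<beta>(1)]) simp
  qed (use \<beta>(3) ball_subset_cball in auto)
  moreover have "f y = ?g y" if "y \<in> ?V" for y
    using that e \<beta>(2) by (auto simp: param_chart subset_iff)
  moreover have "openin (mtop M) ?V" by (rule openin_chart_vimage) simp
  ultimately show ?thesis using assms(3) e(1) by (intro exI[of _ ?V] exI[of _ ?g]) auto
qed

text \<open>Elimination one function at a time instead of inverting a matrix of functions. From
  \<open>W l\<close> its components along the old frame are subtracted, the result is divided by its
  value on \<open>f l\<close>, which is 1 at \<open>x\<close> and hence invertible nearby, and the
  old fields are then corrected to annihilate \<open>f l\<close>.\<close>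

lemma dual_frame:
  fixes f :: "'i \<Rightarrow> 'a \<Rightarrow> real"
  assumes "manifold k M" "x \<in> carrier M" "finite J"
    and "\<And>j. j \<in> J \<Longrightarrow> f j \<in> Cinf M" "\<And>j. j \<in> J \<Longrightarrow> W j \<in> vfields M"
    and "\<And>i j. i \<in> J \<Longrightarrow> j \<in> J \<Longrightarrow> W i x (f j) = (if i = j then 1 else 0)"
  shows "\<exists>V N. openin (mtop M) N \<and> x \<in> N \<and> (\<forall>j\<in>J. V j \<in> vfields M) \<and>
    (\<forall>y\<in>N. \<forall>i\<in>J. \<forall>j\<in>J. V i y (f j) = (if i = j then 1 else 0))"
  using assms(3-6)
proof (induction J)
  case empty
  then show ?case using assms(2) by auto
next
  case (insert l J)
  have "\<exists>V N. openin (mtop M) N \<and> x \<in> N \<and> (\<forall>j\<in>J. V j \<in> vfields M) \<and>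
    (\<forall>y\<in>N. \<forall>i\<in>J. \<forall>j\<in>J. V i y (f j) = (if i = j then 1 else 0))"
    by (rule insert.IH) (use insert.prems in auto)
  then obtain V N where N: "openin (mtop M) N" "x \<in> N" and V: "\<And>j. j \<in> J \<Longrightarrow> V j \<in> vfields M"
    and d: "\<And>y i j. y \<in> N \<Longrightarrow> i \<in> J \<Longrightarrow> j \<in> J \<Longrightarrow> V i y (f j) = (if i = j then 1 else 0)"
    by metis
  have fl: "f l \<in> Cinf M" and fj: "\<And>j. j \<in> J \<Longrightarrow> f j \<in> Cinf M" and Wl: "W l \<in> vfields M" using insert.prems by auto
  define W' where "W' = W l - (\<Sum>j\<in>J. fmult (vapply (W l) (f j)) (V j))"
  have W': "W' \<in> vfields M"
    unfolding W'_def by (intro vfields_diff vfields_sum fmult_vfields vapply_Cinf Wl V fj)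
  have W'y: "W' y g = W l y g - (\<Sum>j\<in>J. W l y (f j) * V j y g)" for y g
    by (simp add: W'_def sum_apply fmult_apply vapply_def)
  have W'0: "W' y (f i) = 0" if "y \<in> N" "i \<in> J" for y i
    unfolding W'y using that insert.hyps(1) by (simp add: d if_distrib[of "\<lambda>r. _ * r"] cong: if_cong)
  have "W l x (f j) = 0" if "j \<in> J" for j
    using insert.prems(3)[of l j] insert.hyps(2) that by auto
  \<comment> \<open>Duality is assumed at \<open>x\<close> alone; there the subtracted coefficients
    vanish.\<close>
  then have "W' x (f l) = 1"
    unfolding W'y using insert.prems(3)[of l l] by simp
  then have "vapply W' (f l) x \<noteq> 0" by (simp add: vapply_def)
  from Cinf_inverse_near[OF assms(1,2) vapply_Cinf[OF W' fl] this]
  obtain g N' where g: "g \<in> Cinf M" "openin (mtop M) N'" "x \<in> N'" "\<And>y. y \<in> N' \<Longrightarrow> g y * W' y (f l) = 1"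
    unfolding vapply_def by metis
  define Vl where "Vl = fmult g W'"
  define V' where "V' = (\<lambda>i. if i = l then Vl else V i - fmult (vapply (V i) (f l)) Vl)"
  have Vl: "Vl \<in> vfields M" unfolding Vl_def by (intro fmult_vfields g W')
  have "V' j \<in> vfields M" if "j \<in> insert l J" for j
    using that unfolding V'_def by (auto intro!: Vl vfields_diff V fmult_vfields vapply_Cinf fl)
  moreover have "V' i y (f j) = (if i = j then 1 else 0)" if "y \<in> N \<inter> N'" "i \<in> insert l J" "j \<in> insert l J" for y i j
    using that insert.hyps(2) g(4)[of y] W'0[of y] d[of y]
    by (auto simp: V'_def Vl_def fmult_apply vapply_def)
  ultimately show ?case using N g(2,3)
    by (intro exI[of _ V'] exI[of _ "N \<inter> N'"]) (auto intro: openin_Int)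
qed

context coordinates
begin

lemma tangent_eq_derivative:
  assumes "x \<in> nbhd" "v \<in> tangent_space M x" "f \<in> Cinf M"
  shows "v f = frechet_derivative (\<lambda>z. f (param z)) (at (\<phi> x)) (\<Sum>b\<in>B. v (coord b) *\<^sub>R b)"
proof -
  have "linear (frechet_derivative (\<lambda>z. f (param z)) (at (\<phi> x)))"
    using param_differentiable[OF assms(3)] assms(1) nbhd_subset_U by (auto intro: linear_frechet_derivative)
  then show ?thesis
    using tangent_expansion[OF assms] by (simp add: linear_sum linear_cmul field_nbhd assms)
qed

text \<open>Along the segment from \<open>\<phi> x0\<close> to \<open>\<phi> x\<close> the velocity
  is a combination of the vectors of \<open>B\<close>. The derivative in each of them is the value
  on \<open>f\<close> of a coordinate field, a tangent vector covered by the hypothesis.\<close>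

lemma constant_on_nbhd:
  assumes "f \<in> Cinf M" "\<And>x v. x \<in> carrier M \<Longrightarrow> v \<in> tangent_space M x \<Longrightarrow> v f = 0" "x \<in> nbhd"
  shows "f x = f x0"
proof -
  let ?\<gamma> = "\<lambda>t. \<phi> x0 + t *\<^sub>R (\<phi> x - \<phi> x0)" and ?F = "\<lambda>z. f (param z)"
  let ?D = "\<lambda>z. frechet_derivative ?F (at z)"
  have xU: "x \<in> U" using assms(3) nbhd_subset_U by blast
  have \<gamma>: "\<exists>y\<in>nbhd. ?\<gamma> t = \<phi> y" if "t \<in> {0..1}" for t
  proof -
    have "?\<gamma> t = (1 - t) *\<^sub>R \<phi> x0 + t *\<^sub>R \<phi> x" by (simp add: algebra_simps)
    then have b: "?\<gamma> t \<in> ball (\<phi> x0) r"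
      using convex_ball[of "\<phi> x0" r] assms(3) r that by (auto simp: convex_alt nbhd_def)
    have s: "?\<gamma> t \<in> span B"
      using chart_in_span[OF xU] chart_in_span[OF x0] by (intro span_add span_scale span_diff)
    have "?\<gamma> t \<in> dom" using b ball r by (auto simp: subset_iff)
    then have "param (?\<gamma> t) \<in> U" "\<phi> (param (?\<gamma> t)) = ?\<gamma> t"
      using param_in_U chart_param proj_span[OF s] by auto
    then show ?thesis using b by (intro bexI[of _ "param (?\<gamma> t)"]) (auto simp: nbhd_def)
  qed
  have "((\<lambda>t. ?F (?\<gamma> t)) has_derivative (\<lambda>h. 0)) (at t within {0..1})" if t: "t \<in> {0..1}" for t
  proof -
    obtain y where y: "y \<in> nbhd" "?\<gamma> t = \<phi> y" using \<gamma>[OF t] by blast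
    have dF: "?F differentiable (at (\<phi> y))"
      using param_differentiable[OF assms(1)] y(1) nbhd_subset_U by blast
    have "?D (\<phi> y) b = 0" for b
      using field_nbhd[OF y(1) assms(1), of b] assms(2)[of y "field b y"] field_tangent nbhd_subset y(1) by auto
    moreover have "\<phi> x - \<phi> x0 = (\<Sum>b\<in>B. ((\<phi> x - \<phi> x0) \<bullet> b) *\<^sub>R b)"
      using proj_span[OF span_diff[OF chart_in_span[OF xU] chart_in_span[OF x0]]] by (simp add: proj_def)
    then have "?D (\<phi> y) (\<phi> x - \<phi> x0) = ?D (\<phi> y) (\<Sum>b\<in>B. ((\<phi> x - \<phi> x0) \<bullet> b) *\<^sub>R b)" by simp
    ultimately have z: "?D (\<phi> y) (\<phi> x - \<phi> x0) = 0"
      using linear_frechet_derivative[OF dF] by (simp only: linear_sum linear_cmul)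
    have "(?\<gamma> has_derivative (\<lambda>h. h *\<^sub>R (\<phi> x - \<phi> x0))) (at t)"
      by (auto intro!: derivative_eq_intros)
    moreover have "(?F has_derivative ?D (\<phi> y)) (at (?\<gamma> t))"
      using has_frechet_derivative[OF dF] y(2) by simp
    ultimately have "((\<lambda>t. ?F (?\<gamma> t)) has_derivative (\<lambda>h. ?D (\<phi> y) (h *\<^sub>R (\<phi> x - \<phi> x0)))) (at t)"
      by (rule has_derivative_compose)
    then show ?thesis
      using z linear_cmul[OF linear_frechet_derivative[OF dF]] by (auto intro: has_derivative_at_withinI)
  qed
  then obtain c where "\<forall>t\<in>{0..1}. ?F (?\<gamma> t) = c"
    using has_derivative_zero_constant[of "{0..1::real}" "\<lambda>t. ?F (?\<gamma> t)"] by auto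
  from this[rule_format, of 0] this[rule_format, of 1] show ?thesis
    using param_chart xU x0 by simp
qed

end

text \<open>A level set is open by local constancy, its complement by continuity. It will be applied
  to a leaf with its own topology.\<close>

lemma constant_on_connected_manifold:
  assumes "manifold k M" "connected_space (mtop M)" "f \<in> Cinf M"
    and "\<And>x v. x \<in> carrier M \<Longrightarrow> v \<in> tangent_space M x \<Longrightarrow> v f = 0"
    and "x \<in> carrier M" "y \<in> carrier M"
  shows "f x = f y"
proof (rule ccontr)
  assume ne: "f x \<noteq> f y"
  let ?A = "{z \<in> carrier M. f z = f x}" and ?B = "{z \<in> carrier M. f z \<in> - {f x}}"
  have "openin (mtop M) ?B" by (rule Cinf_openin_vimage[OF assms(1,3)]) auto
  moreover have "openin (mtop M) ?A"
  proof (subst openin_subopen, clarify)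
    fix z assume z: "z \<in> carrier M" "f z = f x"
    obtain U \<phi> B r \<beta> where "coordinates M k U \<phi> B z r \<beta>"
      using coordinates_exist[OF assms(1) z(1) openin_topspace z(1)] by metis
    then interpret coordinates M k U \<phi> B z r \<beta> .
    have "f y = f z" if "y \<in> nbhd" for y
      by (rule constant_on_nbhd[OF assms(3) _ that]) (rule assms(4))
    then show "\<exists>T. openin (mtop M) T \<and> z \<in> T \<and> T \<subseteq> ?A"
      using openin_nbhd x0_nbhd nbhd_subset z(2)
      by (intro exI[of _ nbhd]) auto
  qed
  moreover have "x \<in> ?A" "y \<in> ?B" using assms(5,6) ne by auto
  moreover have "carrier M \<subseteq> ?A \<union> ?B" "?A \<inter> ?B = {}" by auto
  ultimately show False
    using assms(2) unfolding connected_space_def by (metis (no_types, lifting) empty_iff)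
qed

section \<open>Lifting and descent along a submersion\<close>

locale manifold_submersion =
  fixes M :: "('a, 'e::euclidean_space) mfd" and k :: nat
    and Q :: "('b, 'f::euclidean_space) mfd" and l :: nat and \<pi> :: "'a \<Rightarrow> 'b"
  assumes manifold_M: "manifold k M" and manifold_Q: "manifold l Q"
    and submersion: "submersion M Q \<pi>" and surj: "\<pi> ` carrier M = carrier Q"
begin

abbreviation d\<pi> :: "'a tvec \<Rightarrow> 'b tvec" where "d\<pi> \<equiv> differential M Q \<pi>"

lemma smooth: "smooth_map M Q \<pi>"
  using submersion by (simp add: submersion_def)

lemma pullback_Cinf: "g \<in> Cinf Q \<Longrightarrow> g \<circ> \<pi> \<in> Cinf M"
  using Cinf_smooth_map[OF manifold_M manifold_Q smooth] .

lemma openin_vimage: "openin (mtop Q) V \<Longrightarrow> openin (mtop M) {x \<in> carrier M. \<pi> x \<in> V}"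
  by (rule openin_continuous_map_preimage[of "mtop M" "mtop Q"]) (use smooth in \<open>auto simp: smooth_map_def\<close>)

lemma in_carrier: "x \<in> carrier M \<Longrightarrow> \<pi> x \<in> carrier Q"
  using surj by blast

lemma d\<pi>_image: "x \<in> carrier M \<Longrightarrow> d\<pi> ` tangent_space M x = tangent_space Q (\<pi> x)"
  using submersion by (simp add: submersion_def)

lemma d\<pi>_tangent: "x \<in> carrier M \<Longrightarrow> v \<in> tangent_space M x \<Longrightarrow> d\<pi> v \<in> tangent_space Q (\<pi> x)"
  using d\<pi>_image by blast

lemma d\<pi>_apply: "g \<in> Cinf Q \<Longrightarrow> d\<pi> v g = v (g \<circ> \<pi>)"
  by (simp add: differential_def)

lemma d\<pi>_add: "d\<pi> (u + v) = d\<pi> u + d\<pi> v"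
  and d\<pi>_diff: "d\<pi> (u - v) = d\<pi> u - d\<pi> v"
  and d\<pi>_scaleR: "d\<pi> (c *\<^sub>R v) = c *\<^sub>R d\<pi> v"
  by (auto simp: differential_def fun_eq_iff scaleR_fun_def)

text \<open>Surjectivity of \<open>d\<pi>\<close> at \<open>x0\<close> gives vectors over the
  coordinate fields of Q; \<open>dual_frame\<close> makes extensions of them dual to the pulled-back
  coordinates near \<open>x0\<close>. The frame yields vertical fields, lifts, and the partial
  derivatives of functions that descend.\<close>

lemma adapted_frame:
  assumes "x0 \<in> carrier M"
  obtains U \<phi> B r \<beta> V N where "coordinates Q l U \<phi> B (\<pi> x0) r \<beta>"
    "openin (mtop M) N" "x0 \<in> N" "\<pi> ` N \<subseteq> coordinates.nbhd U \<phi> (\<pi> x0) r"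
    "\<And>b. b \<in> B \<Longrightarrow> V b \<in> vfields M"
    "\<And>x b c. x \<in> N \<Longrightarrow> b \<in> B \<Longrightarrow> c \<in> B \<Longrightarrow>
      V b x (coordinates.coord U \<phi> \<beta> c \<circ> \<pi>) = (if b = c then 1 else 0)"
proof -
  obtain U \<phi> B r \<beta> where c: "coordinates Q l U \<phi> B (\<pi> x0) r \<beta>"
    using coordinates_exist[OF manifold_Q in_carrier[OF assms] openin_topspace in_carrier[OF assms]] by metis
  then interpret coordinates Q l U \<phi> B "\<pi> x0" r \<beta> .
  have "\<exists>X\<in>vfields M. d\<pi> (X x0) = field b (\<pi> x0)" for b
  proof -
    have "field b (\<pi> x0) \<in> d\<pi> ` tangent_space M x0"
      unfolding d\<pi>_image[OF assms] by (rule field_tangent[OF in_carrier[OF assms]])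
    then obtain v where v: "v \<in> tangent_space M x0" "field b (\<pi> x0) = d\<pi> v" by blast
    obtain X where "X \<in> vfields M" "X x0 = v"
      using vfield_through[OF manifold_M assms v(1)] .
    then show ?thesis using v(2) by auto
  qed
  then obtain W where W: "\<And>b. W b \<in> vfields M" "\<And>b. d\<pi> (W b x0) = field b (\<pi> x0)" by metis
  have "W b x0 (coord c \<circ> \<pi>) = (if b = c then 1 else 0)" if "b \<in> B" "c \<in> B" for b c
    using d\<pi>_apply[OF coord_Cinf, of "W b x0" c] W(2) field_coord[OF x0_nbhd that] by simp
  then have "\<exists>V N. openin (mtop M) N \<and> x0 \<in> N \<and> (\<forall>b\<in>B. V b \<in> vfields M) \<and>
    (\<forall>x\<in>N. \<forall>b\<in>B. \<forall>c\<in>B. V b x (coord c \<circ> \<pi>) = (if b = c then 1 else 0))"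
    by (intro dual_frame[OF manifold_M assms finite_B pullback_Cinf[OF coord_Cinf] W(1)])
  then obtain V N where V: "openin (mtop M) N" "x0 \<in> N" "\<forall>b\<in>B. V b \<in> vfields M"
    "\<forall>x\<in>N. \<forall>b\<in>B. \<forall>c\<in>B. V b x (coord c \<circ> \<pi>) = (if b = c then 1 else 0)"
    by (elim exE conjE) (rule that)
  let ?N = "N \<inter> {x \<in> carrier M. \<pi> x \<in> nbhd}"
  show ?thesis
  proof (rule that[OF c])
    show "openin (mtop M) ?N" using V(1) openin_vimage[OF openin_nbhd] by blast
    show "x0 \<in> ?N" using V(2) assms x0_nbhd by blast
  qed (use V in auto)
qed

text \<open>Any extension of \<open>v\<close> becomes vertical near \<open>x0\<close> once its
  components in the adapted frame are removed, and a bump function makes it vertical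
  everywhere.\<close>

lemma vertical_vfield:
  assumes "x0 \<in> carrier M" "v \<in> tangent_space M x0" "d\<pi> v = 0"
  obtains Z where "Z \<in> vfields M" "\<And>x. x \<in> carrier M \<Longrightarrow> d\<pi> (Z x) = 0" "Z x0 = v"
proof -
  obtain U \<phi> B r \<beta> V N where c: "coordinates Q l U \<phi> B (\<pi> x0) r \<beta>"
    and N: "openin (mtop M) N" "x0 \<in> N" "\<pi> ` N \<subseteq> coordinates.nbhd U \<phi> (\<pi> x0) r"
    and V: "\<And>b. b \<in> B \<Longrightarrow> V b \<in> vfields M"
    "\<And>x b c. x \<in> N \<Longrightarrow> b \<in> B \<Longrightarrow> c \<in> B \<Longrightarrow>
      V b x (coordinates.coord U \<phi> \<beta> c \<circ> \<pi>) = (if b = c then 1 else 0)"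
    using adapted_frame[OF assms(1)] by metis
  interpret coordinates Q l U \<phi> B "\<pi> x0" r \<beta> by (rule c)
  obtain Z0 where Z0: "Z0 \<in> vfields M" "Z0 x0 = v"
    using vfield_through[OF manifold_M assms(1,2)] .
  obtain g W where g: "g \<in> Cinf M" "x0 \<in> W" "\<And>x. x \<in> W \<Longrightarrow> g x = 1" "\<And>x. x \<notin> N \<Longrightarrow> g x = 0"
    using ex_bump_function[OF manifold_M N(1,2)] by metis
  define Z1 where "Z1 = Z0 - (\<Sum>b\<in>B. fmult (vapply Z0 (coord b \<circ> \<pi>)) (V b))"
  have Z1: "Z1 \<in> vfields M"
    unfolding Z1_def by (intro vfields_diff Z0 vfields_sum fmult_vfields V vapply_Cinf pullback_Cinf coord_Cinf)
  have Z1x: "Z1 x f = Z0 x f - (\<Sum>b\<in>B. Z0 x (coord b \<circ> \<pi>) * V b x f)" for x f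
    by (simp add: Z1_def sum_apply fmult_apply vapply_def)
  have "Z1 x (coord c \<circ> \<pi>) = 0" if "x \<in> N" "c \<in> B" for x c
    unfolding Z1x using V(2)[OF that(1)] that(2) finite_B by (simp add: if_distrib[of "\<lambda>r. _ * r"] cong: if_cong)
  then have d1: "d\<pi> (Z1 x) = 0" if "x \<in> N" for x
  proof -
    have x: "x \<in> carrier M" using that N(1) openin_subset by blast
    have "d\<pi> (Z1 x) f = 0" for f
    proof (cases "f \<in> Cinf Q")
      case True
      then show ?thesis
        using tangent_expansion[OF _ d\<pi>_tangent[OF x vfields_tangent[OF Z1 x]] True] N(3) that
          \<open>\<And>x c. x \<in> N \<Longrightarrow> c \<in> B \<Longrightarrow> Z1 x (coord c \<circ> \<pi>) = 0\<close>
        by (auto simp: d\<pi>_apply[OF coord_Cinf] subset_iff)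
    qed (simp add: differential_def)
    then show ?thesis by (simp add: fun_eq_iff)
  qed
  \<comment> \<open>Because \<open>v\<close> is vertical, nothing is subtracted at \<open>x0\<close>
    itself, so the value there remains \<open>v\<close>.\<close>
  have 0: "Z0 x0 (coord b \<circ> \<pi>) = 0" for b
    using assms(3) d\<pi>_apply[OF coord_Cinf, of v b] Z0(2) by simp
  show ?thesis
  proof (rule that)
    show "fmult g Z1 \<in> vfields M" by (intro fmult_vfields g Z1)
    show "d\<pi> (fmult g Z1 x) = 0" for x
      using d1[of x] g(4)[of x] by (cases "x \<in> N") (auto simp: fmult_def d\<pi>_scaleR d\<pi>_scaleR[of 0 0, simplified])
    show "fmult g Z1 x0 = v"
      using g(2,3) Z0(2) by (auto simp: fmult_apply Z1x 0[unfolded Z0(2)] fun_eq_iff)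
  qed
qed

text \<open>The components of \<open>X'\<close> are pulled back and used as coefficients of the
  adapted frame. Both sides then have the same components in the coordinates of Q.\<close>

lemma local_lift:
  assumes "x0 \<in> carrier M" "X' \<in> vfields Q"
  obtains X N where "X \<in> vfields M" "openin (mtop M) N" "x0 \<in> N" "\<And>x. x \<in> N \<Longrightarrow> d\<pi> (X x) = X' (\<pi> x)"
proof -
  obtain U \<phi> B r \<beta> V N where c: "coordinates Q l U \<phi> B (\<pi> x0) r \<beta>"
    and N: "openin (mtop M) N" "x0 \<in> N" "\<pi> ` N \<subseteq> coordinates.nbhd U \<phi> (\<pi> x0) r"
    and V: "\<And>b. b \<in> B \<Longrightarrow> V b \<in> vfields M"
    "\<And>x b c. x \<in> N \<Longrightarrow> b \<in> B \<Longrightarrow> c \<in> B \<Longrightarrow>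
      V b x (coordinates.coord U \<phi> \<beta> c \<circ> \<pi>) = (if b = c then 1 else 0)"
    using adapted_frame[OF assms(1)] by metis
  interpret coordinates Q l U \<phi> B "\<pi> x0" r \<beta> by (rule c)
  define X where "X = (\<Sum>b\<in>B. fmult (vapply X' (coord b) \<circ> \<pi>) (V b))"
  have X: "X \<in> vfields M"
    unfolding X_def by (intro vfields_sum fmult_vfields V pullback_Cinf vapply_Cinf assms coord_Cinf)
  have Xc: "d\<pi> (X x) (coord c) = X' (\<pi> x) (coord c)" if "x \<in> N" "c \<in> B" for x c
    using V(2)[OF that(1)] that(2) finite_B
    by (simp add: d\<pi>_apply[OF coord_Cinf] X_def sum_apply fmult_apply vapply_def if_distrib[of "\<lambda>r. _ * r"] cong: if_cong)
  have "d\<pi> (X x) = X' (\<pi> x)" if "x \<in> N" for x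
  proof
    have x: "x \<in> carrier M" "\<pi> x \<in> nbhd" using that N openin_subset by blast+
    note t = d\<pi>_tangent[OF x(1) vfields_tangent[OF X x(1)]] vfields_tangent_all[OF assms(2), of "\<pi> x"]
    fix f
    show "d\<pi> (X x) f = X' (\<pi> x) f"
    proof (cases "f \<in> Cinf Q")
      case True
      then show ?thesis
        using tangent_expansion[OF x(2) t(1)] tangent_expansion[OF x(2) t(2)] Xc[OF that] by simp
    next
      case False
      then show ?thesis using tangent_notin[OF t(1)] tangent_notin[OF t(2)] by simp
    qed
  qed
  then show ?thesis using that X N by blast
qed

text \<open>The local section built from the slice is used only to see that the chart expression of
  \<open>h'\<close> is differentiable. Its derivatives are expressed through the frame
  \<open>V\<close>, so the section itself need be differentiable only once.\<close>

lemma descends_near: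
  assumes "x0 \<in> carrier M" "h \<in> Cinf M" "\<And>x. x \<in> carrier M \<Longrightarrow> h x = h' (\<pi> x)"
  shows "\<exists>V g. openin (mtop Q) V \<and> \<pi> x0 \<in> V \<and> g \<in> Cinf Q \<and> (\<forall>y\<in>V. h' y = g y)"
proof -
  obtain U \<phi> B r \<beta> V N where cQ: "coordinates Q l U \<phi> B (\<pi> x0) r \<beta>"
    and N: "openin (mtop M) N" "x0 \<in> N" "\<pi> ` N \<subseteq> coordinates.nbhd U \<phi> (\<pi> x0) r"
    and V: "\<And>b. b \<in> B \<Longrightarrow> V b \<in> vfields M"
    "\<And>x b c. x \<in> N \<Longrightarrow> b \<in> B \<Longrightarrow> c \<in> B \<Longrightarrow>
      V b x (coordinates.coord U \<phi> \<beta> c \<circ> \<pi>) = (if b = c then 1 else 0)"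
    using adapted_frame[OF assms(1)] by metis
  interpret Q: coordinates Q l U \<phi> B "\<pi> x0" r \<beta> by (rule cQ)
  obtain U' \<phi>' B' r' \<beta>' where cM: "coordinates M k U' \<phi>' B' x0 r' \<beta>'"
    using coordinates_exist[OF manifold_M assms(1) openin_topspace assms(1)] by metis
  then interpret M: coordinates M k U' \<phi>' B' x0 r' \<beta>' .

  define f where "f = (\<lambda>b. Q.coord b \<circ> \<pi>)"
  have f: "f b \<in> Cinf M" for b unfolding f_def by (intro pullback_Cinf Q.coord_Cinf)
  define N' where "N' = N \<inter> M.nbhd"
  have N': "openin (mtop M) N'" "x0 \<in> N'" "N' \<subseteq> carrier M"
    using N M.openin_nbhd M.x0_nbhd M.nbhd_subset by (auto simp: N'_def)
  \<comment> \<open>\<open>C b x\<close> is the component vector of \<open>V b\<close> at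
    \<open>x\<close>, so that \<open>V b x H\<close> becomes a directional derivative of
    \<open>H\<close> in the chart of M.\<close>
  define C where "C = (\<lambda>b x. \<Sum>c\<in>B'. V b x (M.coord c) *\<^sub>R c)"
  have VC: "V b x H = frechet_derivative (\<lambda>z. H (M.param z)) (at (\<phi>' x)) (C b x)"
    if "b \<in> B" "x \<in> N'" "H \<in> Cinf M" for b x H
    using M.tangent_eq_derivative[of x "V b x" H] vfields_tangent_all[OF V(1)] that by (simp add: C_def N'_def)
  have chart_\<pi>: "\<phi> (\<pi> x) = (\<Sum>b\<in>B. f b x *\<^sub>R b)" "\<pi> x \<in> U" if "x \<in> N'" for x
    using Q.chart_eq_sum_coord[of "\<pi> x"] N(3) Q.nbhd_subset_U that by (auto simp: f_def N'_def)
  have param_\<pi>: "Q.param y = \<pi> x" if "x \<in> N'" "Q.proj y = (\<Sum>b\<in>B. f b x *\<^sub>R b)" for x y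
    unfolding Q.param_def that(2) chart_\<pi>(1)[OF that(1), symmetric]
    by (rule inv_into_f_f[OF Q.inj_chart chart_\<pi>(2)[OF that(1)]])
  have proj_minus: "Q.proj (y - Q.proj y) = 0" for y
    using linear_diff[OF bounded_linear.linear[OF Q.bounded_linear_proj]] by simp

  define y0 where "y0 = \<phi> (\<pi> x0)"
  have py0: "Q.proj y0 = y0" unfolding y0_def by (rule Q.proj_chart[OF Q.x0])
  \<comment> \<open>An affine slice through \<open>x0\<close> in the directions of the frame; it is
    transverse to the fibre because the frame is dual to pulled-back coordinates.\<close>
  define A where "A = (\<lambda>y. \<phi>' x0 + (\<Sum>b\<in>B. ((y - y0) \<bullet> b) *\<^sub>R C b x0))"
  have A: "Cinf_on UNIV A"
  proof -
    have "Cinf_on UNIV (\<lambda>y. \<Sum>b\<in>B. (y \<bullet> b) *\<^sub>R C b x0)"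
      by (intro Cinf_on_bounded_linear bounded_linear_intros)
    then have "Cinf_on UNIV (\<lambda>y. (\<phi>' x0 - (\<Sum>b\<in>B. (y0 \<bullet> b) *\<^sub>R C b x0)) + (\<Sum>b\<in>B. (y \<bullet> b) *\<^sub>R C b x0))"
      by (intro Cinf_on_add Cinf_on_const open_UNIV)
    then show ?thesis
      by (simp add: A_def inner_diff_left scaleR_left_diff_distrib sum_subtractf algebra_simps)
  qed
  have A0: "A y0 = \<phi>' x0" by (simp add: A_def)
  define D where "D = A -` M.dom"
  have oD: "open D" "y0 \<in> D"
    using open_vimage[OF M.open_dom] Cinf_on_continuous[OF A] A0 M.chart_in_dom[OF M.x0] by (auto simp: D_def)
  have fA: "Cinf_on D (\<lambda>y. H (M.param (A y)))" if "H \<in> Cinf M" for H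
    by (rule Cinf_on_compose[OF oD(1) M.open_dom _ Cinf_on_subset[OF A] M.Cinf_on_param[OF that]])
      (auto simp: D_def)
  \<comment> \<open>The first part is \<open>\<pi>\<close> along the slice in coordinates of Q.
    Adding the normal component \<open>y - Q.proj y\<close> makes the derivative at
    \<open>y0\<close> the identity of the whole ambient space, even if the model subspace is
    proper.\<close>
  define F where "F = (\<lambda>y. (\<Sum>b\<in>B. f b (M.param (A y)) *\<^sub>R b) + (y - Q.proj y))"
  have F: "Cinf_on D F"
    unfolding F_def
    by (intro Cinf_on_add Cinf_on_sum Cinf_on_scaleR Cinf_on_const fA f oD
        Cinf_on_bounded_linear bounded_linear_sub Q.bounded_linear_proj bounded_linear_ident)
  have fx0: "(\<Sum>b\<in>B. f b x0 *\<^sub>R b) = y0" using chart_\<pi>(1)[OF N'(2)] by (simp add: y0_def)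
  have F0: "F y0 = y0"
    using fx0 by (simp add: F_def A0 M.param_chart[OF M.x0] py0)
  have DA: "(A has_derivative (\<lambda>v. \<Sum>b\<in>B. (v \<bullet> b) *\<^sub>R C b x0)) (at y)" for y
    unfolding A_def by (auto intro!: derivative_eq_intros)
  have DF: "(F has_derivative (\<lambda>v. v)) (at y0)"
  proof -
    have "((\<lambda>y. f b (M.param (A y))) has_derivative (\<lambda>v. v \<bullet> b)) (at y0)" if b: "b \<in> B" for b
    proof -
      let ?Df = "frechet_derivative (\<lambda>z. f b (M.param z)) (at (\<phi>' x0))"
      have "((\<lambda>z. f b (M.param z)) has_derivative ?Df) (at (A y0))"
        using has_frechet_derivative[OF M.param_differentiable[OF f M.x0]] by (simp add: A0)
      from has_derivative_compose[OF DA this]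
      have "((\<lambda>y. f b (M.param (A y))) has_derivative (\<lambda>v. ?Df (\<Sum>c\<in>B. (v \<bullet> c) *\<^sub>R C c x0))) (at y0)" .
      moreover have "?Df (\<Sum>c\<in>B. (v \<bullet> c) *\<^sub>R C c x0) = v \<bullet> b" for v
      proof -
        have "?Df (\<Sum>c\<in>B. (v \<bullet> c) *\<^sub>R C c x0) = (\<Sum>c\<in>B. (v \<bullet> c) * ?Df (C c x0))"
          using linear_frechet_derivative[OF M.param_differentiable[OF f M.x0]]
          by (simp add: linear_sum linear_cmul)
        also have "\<dots> = (\<Sum>c\<in>B. (v \<bullet> c) * (if c = b then 1 else 0))"
          using VC[OF _ N'(2) f] V(2)[OF N(2) _ b] by (intro sum.cong) (auto simp: f_def)
        also have "\<dots> = v \<bullet> b"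
          using b Q.finite_B by (simp add: if_distrib[of "\<lambda>r. _ * r"] cong: if_cong)
        finally show ?thesis .
      qed
      ultimately show ?thesis by simp
    qed
    then have "(F has_derivative (\<lambda>v. (\<Sum>b\<in>B. (v \<bullet> b) *\<^sub>R b) + (v - Q.proj v))) (at y0)"
      unfolding F_def
      by (intro has_derivative_add has_derivative_sum has_derivative_scaleR_left has_derivative_diff
          has_derivative_ident bounded_linear_imp_has_derivative Q.bounded_linear_proj)
    then show ?thesis by (simp add: Q.proj_def)
  qed
  obtain W G where W: "open W" "y0 \<in> W" "G ` W \<subseteq> D" "G y0 = y0"
    and G: "\<And>y. y \<in> W \<Longrightarrow> F (G y) = y" "\<And>y. y \<in> W \<Longrightarrow> G differentiable (at y)"
    using Cinf_inverse_function[OF oD(1) F oD(2) DF] F0 by metis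

  \<comment> \<open>Shrinks \<open>W\<close> so that the section lands in \<open>N'\<close>, where
    the frame is dual to the coordinates, and \<open>y\<close> itself stays in
    \<open>Q.dom\<close>.\<close>
  define W' where "W' = (W \<inter> (\<lambda>y. A (G y)) -` {z \<in> M.dom. M.param z \<in> N'}) \<inter> Q.dom"
  have W': "open W'" "y0 \<in> W'" "W' \<subseteq> Q.dom"
  proof -
    have "continuous_on W G"
      using G(2) by (simp add: continuous_at_imp_continuous_on differentiable_imp_continuous_within)
    then have "continuous_on W (\<lambda>y. A (G y))"
      using continuous_on_compose2[OF Cinf_on_continuous[OF A]] by blast
    from continuous_open_preimage[OF this W(1) M.open_param_vimage[OF N'(1)]]
    show "open W'" unfolding W'_def using Q.open_dom by (rule open_Int)
    show "y0 \<in> W'"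
      using W(2,4) A0 N'(2) M.chart_in_dom[OF M.x0] Q.chart_in_dom[OF Q.x0] M.param_chart[OF M.x0]
      by (simp add: W'_def y0_def)
  qed (simp add: W'_def)
  define \<sigma> where "\<sigma> = (\<lambda>y. M.param (A (G y)))"
  have \<sigma>: "\<sigma> y \<in> N'" "\<pi> (\<sigma> y) = Q.param y" if "y \<in> W'" for y
  proof -
    show s: "\<sigma> y \<in> N'" using that by (simp add: W'_def \<sigma>_def)
    have "Q.proj (F (G y)) = Q.proj (\<Sum>b\<in>B. f b (\<sigma> y) *\<^sub>R b)"
      using linear_add[OF bounded_linear.linear[OF Q.bounded_linear_proj]] proj_minus by (simp add: F_def \<sigma>_def)
    also have "\<dots> = (\<Sum>b\<in>B. f b (\<sigma> y) *\<^sub>R b)"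
      by (intro Q.proj_span span_sum span_scale span_base)
    finally show "\<pi> (\<sigma> y) = Q.param y"
      using param_\<pi>[OF s, of y] G(1)[of y] that by (simp add: W'_def)
  qed

  \<comment> \<open>If \<open>k\<close> pulls back to \<open>H\<close>, its derivative in direction \<open>b\<close> pulls back to \<open>V b H\<close>; so \<open>K\<close> is
    closed under differentiation, while differentiability itself comes from the local section \<open>\<sigma>\<close>.\<close>
  define K where "K = {k. \<exists>H\<in>Cinf M. \<forall>y\<in>W'. \<forall>x\<in>N'. \<pi> x = Q.param y \<longrightarrow> k y = H x}"
  have "Cinf_on W' (\<lambda>y. h' (Q.param y))"
  proof (rule Cinf_on_coinduct[OF W'(1), of _ K])
    have "\<forall>y\<in>W'. \<forall>x\<in>N'. \<pi> x = Q.param y \<longrightarrow> h' (Q.param y) = h x"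
      using assms(3) N'(3) by (metis subsetD)
    then show "(\<lambda>y. h' (Q.param y)) \<in> K" unfolding K_def using assms(2) by blast
  next
    fix k assume "k \<in> K"
    then obtain H where H: "H \<in> Cinf M" and kH: "\<And>y x. y \<in> W' \<Longrightarrow> x \<in> N' \<Longrightarrow> \<pi> x = Q.param y \<Longrightarrow> k y = H x"
      unfolding K_def by blast
    show diff: "k differentiable (at y)" if y: "y \<in> W'" for y
    proof -
      have "(\<lambda>y. H (M.param (A y))) differentiable (at (G y))"
        using Cinf_on_differentiable[OF fA[OF H]] W(3) y by (auto simp: W'_def)
      moreover have "G differentiable (at y)" using G(2) y by (simp add: W'_def)
      ultimately have "(\<lambda>y. H (\<sigma> y)) differentiable (at y)"
        unfolding \<sigma>_def by (rule differentiable_compose)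
      then show ?thesis
        by (rule frechet_derivative_cong_open(1)[OF W'(1) y, rotated]) (auto simp: kH[OF _ \<sigma>])
    qed
    \<comment> \<open>This has to hold at every \<open>x\<close> in \<open>N'\<close> over
      \<open>y\<close>, not just at \<open>\<sigma> y\<close>, because membership in
      \<open>K\<close> quantifies over all such points.\<close>
    have key: "frechet_derivative k (at y) v = (\<Sum>b\<in>B. (v \<bullet> b) * V b x H)"
      if y: "y \<in> W'" and x: "x \<in> N'" "\<pi> x = Q.param y" for y x v
    proof -
      let ?Dk = "frechet_derivative k (at y)"
      have Dk: "(k has_derivative ?Dk) (at y)" using has_frechet_derivative[OF diff[OF y]] .
      have lin: "linear ?Dk" using linear_frechet_derivative[OF diff[OF y]] .
      \<comment> \<open>\<open>Q.param\<close> ignores the normal component, so \<open>k\<close> is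
        constant along \<open>y + t *\<^sub>R w\<close> for small \<open>t\<close>.\<close>
      have vert: "?Dk w = 0" if w: "Q.proj w = 0" for w
      proof -
        have "((\<lambda>t::real. y + t *\<^sub>R w) has_derivative (\<lambda>t. t *\<^sub>R w)) (at 0)"
          by (auto intro!: derivative_eq_intros)
        moreover have "(k has_derivative ?Dk) (at (y + 0 *\<^sub>R w))" using Dk by simp
        ultimately have "((\<lambda>t::real. k (y + t *\<^sub>R w)) has_derivative (\<lambda>t. ?Dk (t *\<^sub>R w))) (at 0)"
          by (rule has_derivative_compose)
        then have "((\<lambda>t::real. k y) has_derivative (\<lambda>t. ?Dk (t *\<^sub>R w))) (at 0)"
        proof (rule has_derivative_transform_within_open)
          show "open ((\<lambda>t::real. y + t *\<^sub>R w) -` W')"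
            by (rule open_vimage[OF W'(1)]) (intro continuous_intros)
          fix t assume t: "t \<in> (\<lambda>t::real. y + t *\<^sub>R w) -` W'"
          have "Q.proj (y + t *\<^sub>R w) = Q.proj y"
            using w bounded_linear.linear[OF Q.bounded_linear_proj] by (simp add: linear_add linear_scale)
          then have "Q.param (y + t *\<^sub>R w) = Q.param y" by (simp add: Q.param_def)
          then show "k (y + t *\<^sub>R w) = k y" using kH[OF y x] kH[of "y + t *\<^sub>R w" x] t x by simp
        qed (use y in simp)
        then have "(\<lambda>t. ?Dk (t *\<^sub>R w)) = (\<lambda>t. 0)" using has_derivative_unique has_derivative_const by blast
        from fun_cong[OF this, of 1] show ?thesis by simp
      qed
      have base: "?Dk b = V b x H" if b: "b \<in> B" for b
      proof -
        \<comment> \<open>\<open>\<pi>\<close> read in the two charts, shifted by the normal part of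
          \<open>y\<close> so that it passes through \<open>y\<close>. Near \<open>\<phi>' x\<close>
          the composite of \<open>k\<close> with \<open>\<theta>\<close> is \<open>H\<close> in the
          chart; differentiating in direction \<open>C b x\<close> gives \<open>V b x H\<close> on
          one side and \<open>?Dk b\<close> on the other.\<close>
        define \<theta> where "\<theta> = (\<lambda>z. (\<Sum>c\<in>B. f c (M.param z) *\<^sub>R c) + (y - Q.proj y))"
        have xU: "x \<in> U'" using x(1) M.nbhd_subset_U by (auto simp: N'_def)
        have dx: "\<phi>' x \<in> M.dom" using M.chart_in_dom[OF xU] .
        have \<theta>: "Cinf_on M.dom \<theta>"
          unfolding \<theta>_def by (intro Cinf_on_add Cinf_on_sum Cinf_on_scaleR Cinf_on_const M.Cinf_on_param f M.open_dom)
        have "\<phi> (\<pi> x) = Q.proj y" using Q.chart_param W'(3) y x(2) by auto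
        then have \<theta>x: "\<theta> (\<phi>' x) = y" using chart_\<pi>(1)[OF x(1)] by (simp add: \<theta>_def M.param_chart[OF xU])
        have k\<theta>: "k (\<theta> z) = H (M.param z)" if "M.param z \<in> N'" "\<theta> z \<in> W'" for z
        proof (rule kH[OF that(2,1)])
          have "Q.proj (\<theta> z) = Q.proj (\<Sum>c\<in>B. f c (M.param z) *\<^sub>R c)"
            using linear_add[OF bounded_linear.linear[OF Q.bounded_linear_proj]] proj_minus by (simp add: \<theta>_def)
          also have "\<dots> = (\<Sum>c\<in>B. f c (M.param z) *\<^sub>R c)"
            by (intro Q.proj_span span_sum span_scale span_base)
          finally show "\<pi> (M.param z) = Q.param (\<theta> z)" using param_\<pi>[OF that(1)] by simp
        qed
        let ?S = "{z \<in> M.dom. M.param z \<in> N'} \<inter> (M.dom \<inter> \<theta> -` W')"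
        have S: "open ?S" "\<phi>' x \<in> ?S"
          using M.open_param_vimage[OF N'(1)] continuous_open_preimage[OF Cinf_on_continuous[OF \<theta>] M.open_dom W'(1)]
            dx x(1) \<theta>x y by (auto simp: M.param_chart[OF xU])
        have f1: "((\<lambda>z. f c (M.param z)) has_derivative frechet_derivative (\<lambda>z. f c (M.param z)) (at (\<phi>' x))) (at (\<phi>' x))" for c
          by (rule has_frechet_derivative[OF M.param_differentiable[OF f xU]])
        have "(\<theta> has_derivative (\<lambda>w. (\<Sum>c\<in>B. frechet_derivative (\<lambda>z. f c (M.param z)) (at (\<phi>' x)) w *\<^sub>R c) + 0)) (at (\<phi>' x))"
          unfolding \<theta>_def
          by (intro has_derivative_add has_derivative_sum has_derivative_scaleR_left f1 has_derivative_const)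
        then have "((\<lambda>z. k (\<theta> z)) has_derivative
            (\<lambda>w. ?Dk ((\<Sum>c\<in>B. frechet_derivative (\<lambda>z. f c (M.param z)) (at (\<phi>' x)) w *\<^sub>R c) + 0))) (at (\<phi>' x))"
          by (rule has_derivative_compose) (simp add: \<theta>x Dk)
        then have "((\<lambda>z. H (M.param z)) has_derivative
            (\<lambda>w. ?Dk ((\<Sum>c\<in>B. frechet_derivative (\<lambda>z. f c (M.param z)) (at (\<phi>' x)) w *\<^sub>R c) + 0))) (at (\<phi>' x))"
          by (rule has_derivative_transform_within_open[OF _ S]) (auto intro: k\<theta>)
        from fun_cong[OF frechet_derivativeI[OF this], of "C b x"]
        have "V b x H = ?Dk (\<Sum>c\<in>B. V b x (f c) *\<^sub>R c)"
          using VC[OF b x(1) H] VC[OF b x(1) f] by simp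
        also have "(\<Sum>c\<in>B. V b x (f c) *\<^sub>R c) = (\<Sum>c\<in>B. (if b = c then 1 else 0) *\<^sub>R c)"
          using V(2)[of x b] b x(1) by (intro sum.cong) (auto simp: f_def N'_def)
        also have "\<dots> = b" using b Q.finite_B by (simp add: if_distrib[of "\<lambda>r. r *\<^sub>R _"] cong: if_cong)
        finally show ?thesis ..
      qed
      have "?Dk v = ?Dk (Q.proj v + (v - Q.proj v))" by simp
      also have "\<dots> = ?Dk (Q.proj v)" using linear_add[OF lin, of "Q.proj v" "v - Q.proj v"] vert[OF proj_minus, of v] by simp
      also have "\<dots> = (\<Sum>b\<in>B. (v \<bullet> b) * ?Dk b)" unfolding Q.proj_def using lin by (simp add: linear_sum linear_cmul)
      finally show ?thesis using base by simp
    qed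
    fix v
    have "(\<Sum>b\<in>B. (v \<bullet> b) *\<^sub>R vapply (V b) H) \<in> Cinf M"
      by (intro Cinf_sum Cinf_scaleR vapply_Cinf V H)
    moreover have "(\<Sum>b\<in>B. (v \<bullet> b) *\<^sub>R vapply (V b) H) x = (\<Sum>b\<in>B. (v \<bullet> b) * V b x H)" for x
      by (simp add: sum_apply scaleR_fun_def vapply_def)
    ultimately have "(\<lambda>y. frechet_derivative k (at y) v) \<in> K"
      unfolding K_def using key by (intro CollectI bexI[rotated]) auto
    then show "\<exists>g\<in>K. \<forall>y\<in>W'. frechet_derivative k (at y) v = g y" by (rule bexI[rotated]) simp
  qed
  then show ?thesis
    using Q.Cinf_on_param_local[OF W'(1,3) Q.x0] W'(2) by (simp add: y0_def)
qed

lemma descends: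
  assumes "h \<in> Cinf M" "\<And>x. x \<in> carrier M \<Longrightarrow> h x = h' (\<pi> x)"
  shows "h' \<in> Cinf Q"
proof (rule Cinf_localI[OF manifold_Q])
  fix q assume "q \<in> carrier Q"
  then obtain x where "x \<in> carrier M" "q = \<pi> x" using surj by blast
  then show "\<exists>V g. openin (mtop Q) V \<and> q \<in> V \<and> g \<in> Cinf Q \<and> (\<forall>y\<in>V. h' y = g y)"
    using descends_near assms by blast
qed

end

section \<open>The reduced connection\<close>

lemma bracket_zero_left: "X \<in> vfields M \<Longrightarrow> bracket 0 X = 0"
  using tangent_zero[OF vfields_tangent_all]
  by (fastforce simp: bracket_def vapply_def fun_eq_iff zero_fun_def)

locale form_reduction = manifold_submersion M k Q l \<pi>
  for M :: "('a, 'e::euclidean_space) mfd" and k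
    and Q :: "('b, 'f::euclidean_space) mfd" and l and \<pi> +
  fixes \<omega> :: "'a form2" and \<omega>' :: "'b form2"
  assumes form_M: "two_form M \<omega>" and form_Q: "two_form Q \<omega>'"
    and nondegenerate: "\<And>q. q \<in> carrier Q \<Longrightarrow> ker2 Q \<omega>' q = {0}"
    and pullback: "\<And>x v w. x \<in> carrier M \<Longrightarrow> v \<in> tangent_space M x \<Longrightarrow> w \<in> tangent_space M x \<Longrightarrow>
      \<omega>' (\<pi> x) (d\<pi> v) (d\<pi> w) = \<omega> x v w"
begin

lemma ker2_iff:
  assumes "x \<in> carrier M" "v \<in> tangent_space M x"
  shows "v \<in> ker2 M \<omega> x \<longleftrightarrow> d\<pi> v = 0"
proof
  note q = in_carrier[OF assms(1)]
  assume "d\<pi> v = 0"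
  moreover have "\<omega>' (\<pi> x) 0 u = 0" if "u \<in> tangent_space Q (\<pi> x)" for u
  proof -
    have "\<omega>' (\<pi> x) (0 *\<^sub>R u) u = 0 * \<omega>' (\<pi> x) u u"
      using form_Q q that unfolding two_form_def by blast
    then show ?thesis by simp
  qed
  ultimately have "\<omega> x v w = 0" if "w \<in> tangent_space M x" for w
    using pullback[OF assms that] d\<pi>_tangent[OF assms(1) that] by simp
  then show "v \<in> ker2 M \<omega> x" using assms(2) by (simp add: ker2_def)
next
  assume v: "v \<in> ker2 M \<omega> x"
  have "\<omega>' (\<pi> x) (d\<pi> v) u = 0" if "u \<in> tangent_space Q (\<pi> x)" for u
  proof -
    have "u \<in> d\<pi> ` tangent_space M x" using that d\<pi>_image[OF assms(1)] by simp
    then obtain w where w: "u = d\<pi> w" "w \<in> tangent_space M x" by (rule imageE)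
    then show ?thesis using pullback[OF assms w(2)] v by (simp add: ker2_def)
  qed
  then have "d\<pi> v \<in> ker2 Q \<omega>' (\<pi> x)"
    using d\<pi>_tangent[OF assms] by (simp add: ker2_def)
  then show "d\<pi> v = 0" using nondegenerate[OF in_carrier[OF assms(1)]] by simp
qed

lemma ker2_d\<pi>: "x \<in> carrier M \<Longrightarrow> v \<in> ker2 M \<omega> x \<Longrightarrow> d\<pi> v = 0"
  using ker2_iff[of x v] by (simp add: ker2_def)

lemma d\<pi>_zero: "d\<pi> 0 = 0"
  using d\<pi>_scaleR[of 0 0] by simp

end

text \<open>Leaves enter only through \<open>fibre_constant\<close>, which the final theorem derives
  from their connectedness; the rest uses just the submersion and the forms.\<close>

locale connection_reduction = form_reduction M k Q l \<pi> \<omega> \<omega>'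
  for M :: "('a, 'e::euclidean_space) mfd" and k
    and Q :: "('b, 'f::euclidean_space) mfd" and l and \<pi> and \<omega> and \<omega>' +
  fixes \<D> :: "'a conn"
  assumes connection: "presymplectic_connection M \<omega> \<D>"
    and curvature: "\<And>Z X Y x w. Z \<in> sections M (ker2 M \<omega>) \<Longrightarrow> X \<in> vfields M \<Longrightarrow> Y \<in> vfields M \<Longrightarrow>
      x \<in> carrier M \<Longrightarrow> w \<in> tangent_space M x \<Longrightarrow> \<omega> x (curvature \<D> Z X Y x) w = 0"
    and fibre_constant: "\<And>f x y. f \<in> Cinf M \<Longrightarrow>
      (\<And>Z x. Z \<in> sections M (ker2 M \<omega>) \<Longrightarrow> x \<in> carrier M \<Longrightarrow> Z x f = 0) \<Longrightarrow>
      x \<in> carrier M \<Longrightarrow> y \<in> carrier M \<Longrightarrow> \<pi> x = \<pi> y \<Longrightarrow> f x = f y"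
begin

lemma linear_conn: "linear_connection M \<D>" and parallel: "parallel2 M \<D> \<omega>"
  using connection by (simp_all add: presymplectic_connection_def)

lemma conn_vfields: "X \<in> vfields M \<Longrightarrow> Y \<in> vfields M \<Longrightarrow> \<D> X Y \<in> vfields M"
  and conn_add_left: "X \<in> vfields M \<Longrightarrow> X' \<in> vfields M \<Longrightarrow> Y \<in> vfields M \<Longrightarrow> \<D> (X + X') Y = \<D> X Y + \<D> X' Y"
  and conn_add_right: "X \<in> vfields M \<Longrightarrow> Y \<in> vfields M \<Longrightarrow> Y' \<in> vfields M \<Longrightarrow> \<D> X (Y + Y') = \<D> X Y + \<D> X Y'"
  and conn_fmult_left: "f \<in> Cinf M \<Longrightarrow> X \<in> vfields M \<Longrightarrow> Y \<in> vfields M \<Longrightarrow> \<D> (fmult f X) Y = fmult f (\<D> X Y)"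
  and conn_fmult_right: "f \<in> Cinf M \<Longrightarrow> X \<in> vfields M \<Longrightarrow> Y \<in> vfields M \<Longrightarrow>
    \<D> X (fmult f Y) = fmult (vapply X f) Y + fmult f (\<D> X Y)"
  using linear_conn unfolding linear_connection_def by blast+

lemma d\<pi>_torsion:
  assumes "X \<in> vfields M" "Y \<in> vfields M" "x \<in> carrier M"
  shows "d\<pi> (\<D> X Y x) = d\<pi> (\<D> Y X x) + d\<pi> (bracket X Y x)"
proof -
  have "torsion \<D> X Y x \<in> ker2 M \<omega> x"
    using connection assms unfolding presymplectic_connection_def by blast
  then have "d\<pi> (\<D> X Y x - \<D> Y X x - bracket X Y x) = 0"
    using ker2_d\<pi>[OF assms(3)] by (simp add: torsion_def)
  then have "d\<pi> (\<D> X Y x) - d\<pi> (\<D> Y X x) - d\<pi> (bracket X Y x) = 0" unfolding d\<pi>_diff .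
  then show ?thesis by (simp add: algebra_simps)
qed

text \<open>Taking \<open>X' = 0\<close> expresses that \<open>X\<close> is vertical on
  \<open>N\<close>, so facts about lifts also cover vertical fields.\<close>

definition lifts :: "'a set \<Rightarrow> 'a vfield \<Rightarrow> 'b vfield \<Rightarrow> bool" where
  "lifts N X X' \<longleftrightarrow> openin (mtop M) N \<and> X \<in> vfields M \<and> X' \<in> vfields Q \<and> (\<forall>x\<in>N. d\<pi> (X x) = X' (\<pi> x))"

section \<open>Local lifts of vector fields\<close>

lemma lifts_vfields: "lifts N X X' \<Longrightarrow> X \<in> vfields M" "lifts N X X' \<Longrightarrow> X' \<in> vfields Q"
  by (simp_all add: lifts_def)

lemma lifts_open: "lifts N X X' \<Longrightarrow> openin (mtop M) N" "lifts N X X' \<Longrightarrow> x \<in> N \<Longrightarrow> x \<in> carrier M"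
  using openin_subset by (auto simp: lifts_def)

lemma lifts_d\<pi>: "lifts N X X' \<Longrightarrow> x \<in> N \<Longrightarrow> d\<pi> (X x) = X' (\<pi> x)"
  by (simp add: lifts_def)

lemma lifts_subset: "lifts N X X' \<Longrightarrow> openin (mtop M) N' \<Longrightarrow> N' \<subseteq> N \<Longrightarrow> lifts N' X X'"
  by (auto simp: lifts_def)

lemma lifts_exist:
  assumes "X' \<in> vfields Q" "x \<in> carrier M"
  obtains N X where "x \<in> N" "lifts N X X'"
  using local_lift[OF assms(2,1)] assms(1) unfolding lifts_def by metis

lemma lifts_exist2:
  assumes "X' \<in> vfields Q" "Y' \<in> vfields Q" "x \<in> carrier M"
  obtains N X Y where "x \<in> N" "lifts N X X'" "lifts N Y Y'"
proof -
  obtain N1 X where X: "x \<in> N1" "lifts N1 X X'" using lifts_exist[OF assms(1,3)] .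
  obtain N2 Y where Y: "x \<in> N2" "lifts N2 Y Y'" using lifts_exist[OF assms(2,3)] .
  have o: "openin (mtop M) (N1 \<inter> N2)" using lifts_open(1)[OF X(2)] lifts_open(1)[OF Y(2)] by (rule openin_Int)
  show ?thesis
    by (rule that[OF _ lifts_subset[OF X(2) o] lifts_subset[OF Y(2) o]]) (use X Y in auto)
qed

lemma lifts_exist3:
  assumes "X' \<in> vfields Q" "Y' \<in> vfields Q" "Z' \<in> vfields Q" "x \<in> carrier M"
  obtains N X Y Z where "x \<in> N" "lifts N X X'" "lifts N Y Y'" "lifts N Z Z'"
proof -
  obtain N1 X Y where XY: "x \<in> N1" "lifts N1 X X'" "lifts N1 Y Y'" using lifts_exist2[OF assms(1,2,4)] .
  obtain N2 Z where Z: "x \<in> N2" "lifts N2 Z Z'" using lifts_exist[OF assms(3,4)] .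
  have o: "openin (mtop M) (N1 \<inter> N2)" using lifts_open(1)[OF XY(2)] lifts_open(1)[OF Z(2)] by (rule openin_Int)
  show ?thesis
    by (rule that[OF _ lifts_subset[OF XY(2) o] lifts_subset[OF XY(3) o] lifts_subset[OF Z(2) o]]) (use XY Z in auto)
qed

lemma lifts_apply:
  assumes "lifts N X X'" "g \<in> Cinf Q" "x \<in> N"
  shows "X x (g \<circ> \<pi>) = X' (\<pi> x) g"
  using lifts_d\<pi>[OF assms(1,3)] d\<pi>_apply[OF assms(2), of "X x"] by simp

lemma lifts_add: "lifts N X X' \<Longrightarrow> lifts N Y Y' \<Longrightarrow> lifts N (X + Y) (X' + Y')"
  by (auto simp: lifts_def vfields_add d\<pi>_add)

lemma lifts_diff: "lifts N X X' \<Longrightarrow> lifts N Y Y' \<Longrightarrow> lifts N (X - Y) (X' - Y')"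
  by (auto simp: lifts_def vfields_diff d\<pi>_diff)

lemma lifts_fmult: "f \<in> Cinf Q \<Longrightarrow> lifts N X X' \<Longrightarrow> lifts N (fmult (f \<circ> \<pi>) X) (fmult f X')"
  using pullback_Cinf by (auto simp: lifts_def fmult_vfields) (simp add: fmult_def d\<pi>_scaleR)

lemma lifts_bracket:
  assumes "lifts N X X'" "lifts N Y Y'"
  shows "lifts N (bracket X Y) (bracket X' Y')"
  unfolding lifts_def
proof (intro conjI ballI)
  note v = lifts_vfields[OF assms(1)] lifts_vfields[OF assms(2)]
  show "openin (mtop M) N" using lifts_open[OF assms(1)] by simp
  show "bracket X Y \<in> vfields M" and b: "bracket X' Y' \<in> vfields Q" using v bracket_vfields by auto
  have step: "U x (vapply W (g \<circ> \<pi>)) = U' (\<pi> x) (vapply W' g)"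
    if "lifts N U U'" "lifts N W W'" "g \<in> Cinf Q" "x \<in> N" for U U' W W' g x
  proof -
    note c = vapply_Cinf[OF lifts_vfields(2)[OF that(2)] that(3)]
    \<comment> \<open>The two functions agree only on \<open>N\<close>, so the locality of the
      derivation \<open>U x\<close> is needed.\<close>
    have "U x (vapply W (g \<circ> \<pi>)) = U x (vapply W' g \<circ> \<pi>)"
      by (rule tangent_local[OF manifold_M vfields_tangent_all[OF lifts_vfields(1)[OF that(1)]]
            vapply_Cinf[OF lifts_vfields(1)[OF that(2)] pullback_Cinf[OF that(3)]] pullback_Cinf[OF c]
            lifts_open(1)[OF that(1)] that(4)])
        (use lifts_apply[OF that(2,3)] in \<open>simp add: vapply_def\<close>)
    then show ?thesis using lifts_apply[OF that(1) c that(4)] by simp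
  qed
  fix x assume x: "x \<in> N"
  show "d\<pi> (bracket X Y x) = bracket X' Y' (\<pi> x)"
  proof
    fix g
    show "d\<pi> (bracket X Y x) g = bracket X' Y' (\<pi> x) g"
    proof (cases "g \<in> Cinf Q")
      case True
      then show ?thesis
        using step[OF assms True x] step[OF assms(2,1) True x] by (simp add: differential_def bracket_def)
    next
      case False
      then show ?thesis using tangent_notin[OF vfields_tangent_all[OF b]] by (simp add: differential_def)
    qed
  qed
qed

lemma section_lifts_zero: "Z \<in> sections M (ker2 M \<omega>) \<longleftrightarrow> lifts (carrier M) Z 0"
  using ker2_iff vfields_tangent by (fastforce simp: sections_def lifts_def)

text \<open>In the Leibniz rule for \<open>\<omega>\<close> applied to \<open>Z\<close> and
  \<open>W\<close>, the function \<open>eval2 \<omega> Z W\<close> vanishes on all of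
  \<open>N\<close>, so its derivative along \<open>X\<close> vanishes there. The term with
  \<open>\<D> X W\<close> is zero as \<open>Z\<close> is in the kernel, leaving only the pairing of
  \<open>\<D> X Z\<close> with an arbitrary \<open>W\<close>.\<close>

lemma vertical_conn_right:
  assumes "lifts N Z 0" "X \<in> vfields M"
  shows "lifts N (\<D> X Z) 0"
proof -
  note Z = lifts_vfields(1)[OF assms(1)]
  have "d\<pi> (\<D> X Z x) = 0" if xN: "x \<in> N" for x
  proof -
    have x: "x \<in> carrier M" using lifts_open(2)[OF assms(1) xN] .
    have ker: "Z y \<in> ker2 M \<omega> y" if "y \<in> N" for y
    proof -
      have y: "y \<in> carrier M" using lifts_open(2)[OF assms(1) that] .
      show ?thesis using ker2_iff[OF y vfields_tangent[OF Z y]] lifts_d\<pi>[OF assms(1) that] by simp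
    qed
    have "\<omega> x (\<D> X Z x) w = 0" if w: "w \<in> tangent_space M x" for w
    proof -
      obtain W where W: "W \<in> vfields M" "W x = w" using vfield_through[OF manifold_M x w] .
      have "X x (eval2 \<omega> Z W) = X x 0"
      proof (rule tangent_local[OF manifold_M vfields_tangent[OF assms(2) x] _ Cinf_0 lifts_open(1)[OF assms(1)] xN])
        show "eval2 \<omega> Z W \<in> Cinf M" using form_M Z W(1) unfolding two_form_def by blast
        show "eval2 \<omega> Z W y = 0 y" if "y \<in> N" for y
          using ker[OF that] vfields_tangent[OF W(1) lifts_open(2)[OF assms(1) that]]
          by (simp add: eval2_def ker2_def)
      qed
      then have "X x (eval2 \<omega> Z W) = 0" using tangent_zero[OF vfields_tangent[OF assms(2) x]] by simp
      moreover have "eval2 \<omega> Z (\<D> X W) x = 0"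
        using ker[OF xN] vfields_tangent[OF conn_vfields[OF assms(2) W(1)] x] by (simp add: eval2_def ker2_def)
      moreover have "X x (eval2 \<omega> Z W) - eval2 \<omega> (\<D> X Z) W x - eval2 \<omega> Z (\<D> X W) x = 0"
        using parallel assms(2) Z W(1) x unfolding parallel2_def by blast
      ultimately show ?thesis using W(2) by (simp add: eval2_def)
    qed
    then have "\<D> X Z x \<in> ker2 M \<omega> x"
      using vfields_tangent[OF conn_vfields[OF assms(2) Z] x] by (simp add: ker2_def)
    then show ?thesis using ker2_d\<pi>[OF x] by simp
  qed
  then show ?thesis using lifts_open(1)[OF assms(1)] conn_vfields[OF assms(2) Z] by (simp add: lifts_def)
qed

lemma vertical_conn_left:
  assumes "lifts N Z 0" "lifts N Y Y'"
  shows "lifts N (\<D> Z Y) 0"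
proof -
  note v = lifts_vfields(1)[OF assms(1)] lifts_vfields(1)[OF assms(2)]
  have "lifts N (bracket Z Y) 0"
    using lifts_bracket[OF assms] bracket_zero_left[OF lifts_vfields(2)[OF assms(2)]] by simp
  then have "d\<pi> (\<D> Z Y x) = 0" if "x \<in> N" for x
    using d\<pi>_torsion[OF v lifts_open(2)[OF assms(1) that]] that
      lifts_d\<pi>[OF vertical_conn_right[OF assms(1) v(2)] that] lifts_d\<pi> by fastforce
  then show ?thesis using lifts_open(1)[OF assms(1)] conn_vfields[OF v] by (simp add: lifts_def)
qed

text \<open>The curvature hypothesis and the torsion condition combine to \<open>[Z, \<D> X Y] \<in> I\<close>,
  the infinitesimal form of projectability.\<close>

lemma vertical_derivative_conn:
  assumes "lifts N X X'" "lifts N Y Y'" "Z \<in> sections M (ker2 M \<omega>)" "g \<in> Cinf Q" "x \<in> N"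
  shows "Z x (vapply (\<D> X Y) (g \<circ> \<pi>)) = 0"
proof -
  have x: "x \<in> carrier M" using lifts_open(2)[OF assms(1,5)] .
  note X = lifts_vfields(1)[OF assms(1)] and Y = lifts_vfields(1)[OF assms(2)]
  have ZM: "lifts (carrier M) Z 0" using assms(3) section_lifts_zero by simp
  note Z = lifts_vfields(1)[OF ZM]
  have ZN: "lifts N Z 0"
    using lifts_subset[OF ZM lifts_open(1)[OF assms(1)]] openin_subset[OF lifts_open(1)[OF assms(1)]] by simp
  define W where "W = \<D> X Y"
  have W: "W \<in> vfields M" unfolding W_def using conn_vfields X Y .
  have "lifts N (bracket Z X) 0"
    using lifts_bracket[OF ZN assms(1)] bracket_zero_left[OF lifts_vfields(2)[OF assms(1)]] by simp
  then have "d\<pi> (\<D> (bracket Z X) Y x) = 0"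
    using lifts_d\<pi>[OF vertical_conn_left[OF _ assms(2)] assms(5)] by simp
  moreover have "d\<pi> (\<D> X (\<D> Z Y) x) = 0"
    using lifts_d\<pi>[OF vertical_conn_right[OF vertical_conn_left[OF ZN assms(2)] X] assms(5)] by simp
  moreover have "d\<pi> (curvature \<D> Z X Y x) = 0"
  proof (rule ker2_d\<pi>[OF x])
    have "curvature \<D> Z X Y \<in> vfields M"
      unfolding curvature_def by (intro vfields_diff conn_vfields bracket_vfields X Y Z)
    then show "curvature \<D> Z X Y x \<in> ker2 M \<omega> x"
      using curvature[OF assms(3) X Y x] vfields_tangent x by (simp add: ker2_def)
  qed
  \<comment> \<open>The other two terms of the curvature are already known to be vertical.\<close>
  ultimately have "d\<pi> (\<D> Z W x) = 0"
    by (simp add: curvature_def d\<pi>_diff W_def)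
  moreover have "d\<pi> (\<D> W Z x) = 0"
    using lifts_d\<pi>[OF vertical_conn_right[OF ZN W] assms(5)] by simp
  ultimately have "d\<pi> (bracket Z W x) = 0"
    using d\<pi>_torsion[OF Z W x] by simp
  then have "Z x (vapply W (g \<circ> \<pi>)) - W x (vapply Z (g \<circ> \<pi>)) = 0"
    using d\<pi>_apply[OF assms(4), of "bracket Z W x"] by (simp add: bracket_def)
  \<comment> \<open>This must be an equality on the whole type before \<open>W x\<close> is applied
    to it; off the carrier it holds because \<open>Z\<close> is zero there.\<close>
  moreover have "vapply Z (g \<circ> \<pi>) = 0"
  proof
    fix y show "vapply Z (g \<circ> \<pi>) y = 0 y"
      using lifts_apply[OF ZM assms(4), of y] vfields_outside[OF Z, of y]
      by (cases "y \<in> carrier M") (auto simp: vapply_def)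
  qed
  ultimately show ?thesis using tangent_zero[OF vfields_tangent[OF W x]] by (simp add: W_def)
qed

text \<open>The two arguments are changed one after the other; each change adds the connection
  applied to a difference of lifts, which is vertical on \<open>N\<close>.\<close>

lemma d\<pi>_conn_unique:
  assumes "lifts N X1 X'" "lifts N X2 X'" "lifts N Y1 Y'" "lifts N Y2 Y'" "x \<in> N"
  shows "d\<pi> (\<D> X1 Y1 x) = d\<pi> (\<D> X2 Y2 x)"
proof -
  note X = lifts_vfields(1)[OF assms(1)] lifts_vfields(1)[OF assms(2)]
    and Y = lifts_vfields(1)[OF assms(3)] lifts_vfields(1)[OF assms(4)]
  have dX: "lifts N (X1 - X2) 0" and dY: "lifts N (Y1 - Y2) 0"
    using lifts_diff[OF assms(1,2)] lifts_diff[OF assms(3,4)] by simp_all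
  have "\<D> X1 Y1 = \<D> (X1 - X2) Y1 + \<D> X2 Y1"
    using conn_add_left[OF vfields_diff[OF X] X(2) Y(1)] by simp
  also have "\<D> X2 Y1 = \<D> X2 (Y1 - Y2) + \<D> X2 Y2"
    using conn_add_right[OF X(2) vfields_diff[OF Y] Y(2)] by simp
  finally have "\<D> X1 Y1 x = \<D> (X1 - X2) Y1 x + (\<D> X2 (Y1 - Y2) x + \<D> X2 Y2 x)"
    unfolding plus_fun_apply[symmetric] by (rule fun_cong)
  moreover have "d\<pi> (\<D> (X1 - X2) Y1 x) = 0" "d\<pi> (\<D> X2 (Y1 - Y2) x) = 0"
    using lifts_d\<pi>[OF vertical_conn_left[OF dX assms(3)] assms(5)]
      lifts_d\<pi>[OF vertical_conn_right[OF dY X(2)] assms(5)] by simp_all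
  ultimately show ?thesis by (metis d\<pi>_add add_0)
qed

text \<open>The projected derivative is first defined at points of M rather than Q, so that its
  dependence on the point of the fibre can be stated and then removed.\<close>

definition conn_at :: "'b vfield \<Rightarrow> 'b vfield \<Rightarrow> 'a \<Rightarrow> 'b tvec" where
  "conn_at X' Y' x = (SOME u. \<exists>N X Y. x \<in> N \<and> lifts N X X' \<and> lifts N Y Y' \<and> u = d\<pi> (\<D> X Y x))"

lemma conn_at_eq:
  assumes "lifts N X X'" "lifts N Y Y'" "x \<in> N"
  shows "conn_at X' Y' x = d\<pi> (\<D> X Y x)"
proof -
  have "\<exists>u N X Y. x \<in> N \<and> lifts N X X' \<and> lifts N Y Y' \<and> u = d\<pi> (\<D> X Y x)" using assms by blast
  then have "\<exists>N X Y. x \<in> N \<and> lifts N X X' \<and> lifts N Y Y' \<and> conn_at X' Y' x = d\<pi> (\<D> X Y x)"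
    unfolding conn_at_def by (rule someI_ex)
  then obtain N1 X1 Y1 where 1: "x \<in> N1" "lifts N1 X1 X'" "lifts N1 Y1 Y'" "conn_at X' Y' x = d\<pi> (\<D> X1 Y1 x)"
    by metis
  have o: "openin (mtop M) (N \<inter> N1)" using lifts_open(1) assms(1) 1(2) openin_Int by blast
  note sub = lifts_subset[OF _ o]
  show ?thesis
    unfolding 1(4) using 1(1) assms(3)
    by (intro d\<pi>_conn_unique[of "N \<inter> N1" _ X' _ _ Y'] sub[OF 1(2)] sub[OF assms(1)] sub[OF 1(3)] sub[OF assms(2)]) auto
qed

text \<open>One pair of lifts serves a whole neighbourhood, on which the function equals
  \<open>vapply (\<D> X Y) (g \<circ> \<pi>)\<close>. Smoothness and vanishing vertical derivatives
  are inherited from there.\<close>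

lemma conn_at_Cinf:
  assumes "X' \<in> vfields Q" "Y' \<in> vfields Q" "g \<in> Cinf Q"
  shows "(\<lambda>x. conn_at X' Y' x g) \<in> Cinf M"
    and "Z \<in> sections M (ker2 M \<omega>) \<Longrightarrow> x \<in> carrier M \<Longrightarrow> Z x (\<lambda>x. conn_at X' Y' x g) = 0"
proof -
  have loc: "\<exists>N X Y. x \<in> N \<and> lifts N X X' \<and> lifts N Y Y' \<and>
      (\<forall>y\<in>N. conn_at X' Y' y g = vapply (\<D> X Y) (g \<circ> \<pi>) y)" if xM: "x \<in> carrier M" for x
  proof -
    obtain N X Y where N: "x \<in> N" "lifts N X X'" "lifts N Y Y'"
      using lifts_exist2[OF assms(1,2) xM] .
    have "conn_at X' Y' y g = vapply (\<D> X Y) (g \<circ> \<pi>) y" if "y \<in> N" for y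
      using conn_at_eq[OF N(2,3) that] d\<pi>_apply[OF assms(3)] by (simp add: vapply_def)
    then show ?thesis using N by blast
  qed
  have c: "vapply (\<D> X Y) (g \<circ> \<pi>) \<in> Cinf M" if "lifts N X X'" "lifts N Y Y'" for N X Y
    using that lifts_vfields(1) by (blast intro: vapply_Cinf conn_vfields pullback_Cinf assms(3))
  show C: "(\<lambda>x. conn_at X' Y' x g) \<in> Cinf M"
  proof (rule Cinf_localI[OF manifold_M])
    fix x assume "x \<in> carrier M"
    then obtain N X Y where N: "x \<in> N" "lifts N X X'" "lifts N Y Y'"
      "\<forall>y\<in>N. conn_at X' Y' y g = vapply (\<D> X Y) (g \<circ> \<pi>) y" using loc by metis
    then show "\<exists>N h. openin (mtop M) N \<and> x \<in> N \<and> h \<in> Cinf M \<and> (\<forall>y\<in>N. conn_at X' Y' y g = h y)"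
      using c[OF N(2,3)] lifts_open(1)[OF N(2)] by (intro exI[of _ N] exI[of _ "vapply (\<D> X Y) (g \<circ> \<pi>)"]) simp
  qed
  assume Z: "Z \<in> sections M (ker2 M \<omega>)" and x: "x \<in> carrier M"
  obtain N X Y where N: "x \<in> N" "lifts N X X'" "lifts N Y Y'"
    "\<forall>y\<in>N. conn_at X' Y' y g = vapply (\<D> X Y) (g \<circ> \<pi>) y" using loc[OF x] by metis
  have "Z \<in> vfields M" using Z by (simp add: sections_def)
  have "Z x (\<lambda>x. conn_at X' Y' x g) = Z x (vapply (\<D> X Y) (g \<circ> \<pi>))"
    by (rule tangent_local[OF manifold_M vfields_tangent[OF \<open>Z \<in> vfields M\<close> x] C c[OF N(2,3)] lifts_open(1)[OF N(2)] N(1)])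
      (use N(4) in blast)
  then show "Z x (\<lambda>x. conn_at X' Y' x g) = 0"
    using vertical_derivative_conn[OF N(2,3) Z assms(3) N(1)] by simp
qed

definition reduced_conn :: "'b conn" where
  "reduced_conn X' Y' q =
     (if q \<in> carrier Q then conn_at X' Y' (SOME x. x \<in> carrier M \<and> \<pi> x = q) else 0)"

text \<open>Vectors at the two points of a fibre are compared by their action on each
  \<open>g\<close>: \<open>fibre_constant\<close> settles smooth \<open>g\<close>, and on all other
  \<open>g\<close> both are zero by the definition of the differential.\<close>

lemma reduced_conn_\<pi>:
  assumes "X' \<in> vfields Q" "Y' \<in> vfields Q" "x \<in> carrier M"
  shows "reduced_conn X' Y' (\<pi> x) = conn_at X' Y' x"
proof -
  define y where "y = (SOME y. y \<in> carrier M \<and> \<pi> y = \<pi> x)"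
  have y: "y \<in> carrier M" "\<pi> y = \<pi> x"
    using someI[of "\<lambda>y. y \<in> carrier M \<and> \<pi> y = \<pi> x" x] assms(3) unfolding y_def by auto
  have "conn_at X' Y' y g = conn_at X' Y' x g" for g
  proof (cases "g \<in> Cinf Q")
    case True
    show ?thesis
      by (intro fibre_constant[where f = "\<lambda>x. conn_at X' Y' x g"] conn_at_Cinf[OF assms(1,2) True] y assms(3))
  next
    case False
    have "conn_at X' Y' z g = 0" if z: "z \<in> carrier M" for z
    proof -
      obtain N X Y where "z \<in> N" "lifts N X X'" "lifts N Y Y'" using lifts_exist2[OF assms(1,2) z] .
      then show ?thesis using conn_at_eq False by (simp add: differential_def)
    qed
    then show ?thesis using y(1) assms(3) by simp
  qed
  then show ?thesis
    using in_carrier[OF assms(3)] by (auto simp: reduced_conn_def y_def[symmetric] fun_eq_iff)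
qed

lemma reduced_conn_lifts:
  assumes "lifts N X X'" "lifts N Y Y'" "x \<in> N"
  shows "reduced_conn X' Y' (\<pi> x) = d\<pi> (\<D> X Y x)"
  using reduced_conn_\<pi>[OF lifts_vfields(2)[OF assms(1)] lifts_vfields(2)[OF assms(2)] lifts_open(2)[OF assms(1,3)]]
    conn_at_eq[OF assms] by simp

lemma reduced_conn_vfields:
  assumes "X' \<in> vfields Q" "Y' \<in> vfields Q"
  shows "reduced_conn X' Y' \<in> vfields Q"
proof -
  have "reduced_conn X' Y' q \<in> tangent_space Q q" if "q \<in> carrier Q" for q
  proof -
    obtain x where x: "x \<in> carrier M" "q = \<pi> x" using \<open>q \<in> carrier Q\<close> surj by blast
    obtain N X Y where N: "x \<in> N" "lifts N X X'" "lifts N Y Y'" using lifts_exist2[OF assms x(1)] .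
    show ?thesis
      using reduced_conn_lifts[OF N(2,3,1)] x
        d\<pi>_tangent[OF x(1) vfields_tangent[OF conn_vfields[OF lifts_vfields(1)[OF N(2)] lifts_vfields(1)[OF N(3)]] x(1)]]
      by simp
  qed
  moreover have "vapply (reduced_conn X' Y') g \<in> Cinf Q" if "g \<in> Cinf Q" for g
    by (rule descends[OF conn_at_Cinf(1)[OF assms that]]) (simp add: vapply_def reduced_conn_\<pi>[OF assms])
  ultimately show ?thesis by (auto simp: vfields_def reduced_conn_def)
qed

section \<open>The axioms of a symplectic connection on Q\<close>

lemma vfield_eqI:
  assumes "\<And>x. x \<in> carrier M \<Longrightarrow> F (\<pi> x) = G (\<pi> x)" "\<And>q. q \<notin> carrier Q \<Longrightarrow> F q = G q"
  shows "F = G"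
  using assms surj by (metis (no_types, lifting) ext imageE)

lemma reduced_conn_outside: "q \<notin> carrier Q \<Longrightarrow> reduced_conn X' Y' q = 0"
  by (simp add: reduced_conn_def)

text \<open>Sums of lifts, and multiples of lifts by pulled-back functions, are again lifts. Each
  axiom at \<open>\<pi> x\<close> is therefore the projection of the axiom for \<open>\<D>\<close>
  at \<open>x\<close>.\<close>

lemma linear_reduced_conn: "linear_connection Q reduced_conn"
  unfolding linear_connection_def
proof (intro conjI ballI)
  fix X' Y' assume XY: "X' \<in> vfields Q" "Y' \<in> vfields Q"
  show "reduced_conn X' Y' \<in> vfields Q" using reduced_conn_vfields[OF XY] .
  {
    fix Z' assume Z: "Z' \<in> vfields Q"
    show "reduced_conn (X' + Y') Z' = reduced_conn X' Z' + reduced_conn Y' Z'"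
    proof (rule vfield_eqI)
      fix x assume "x \<in> carrier M"
      then obtain N X Y Z where N: "x \<in> N" "lifts N X X'" "lifts N Y Y'" "lifts N Z Z'"
        using lifts_exist3[OF XY Z] by metis
      show "reduced_conn (X' + Y') Z' (\<pi> x) = (reduced_conn X' Z' + reduced_conn Y' Z') (\<pi> x)"
        using N lifts_vfields(1)
        by (simp add: reduced_conn_lifts[OF lifts_add[OF N(2,3)] N(4,1)] reduced_conn_lifts[OF N(2,4,1)]
            reduced_conn_lifts[OF N(3,4,1)] conn_add_left d\<pi>_add)
    qed (simp add: reduced_conn_outside)
    show "reduced_conn X' (Y' + Z') = reduced_conn X' Y' + reduced_conn X' Z'"
    proof (rule vfield_eqI)
      fix x assume "x \<in> carrier M"
      then obtain N X Y Z where N: "x \<in> N" "lifts N X X'" "lifts N Y Y'" "lifts N Z Z'"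
        using lifts_exist3[OF XY Z] by metis
      show "reduced_conn X' (Y' + Z') (\<pi> x) = (reduced_conn X' Y' + reduced_conn X' Z') (\<pi> x)"
        using N lifts_vfields(1)
        by (simp add: reduced_conn_lifts[OF N(2) lifts_add[OF N(3,4)] N(1)] reduced_conn_lifts[OF N(2,3,1)]
            reduced_conn_lifts[OF N(2,4,1)] conn_add_right d\<pi>_add)
    qed (simp add: reduced_conn_outside)
  }
  fix f X' Y' assume f: "f \<in> Cinf Q" and XY: "X' \<in> vfields Q" "Y' \<in> vfields Q"
  have f\<pi>: "f \<circ> \<pi> \<in> Cinf M" using pullback_Cinf[OF f] .
  show "reduced_conn (fmult f X') Y' = fmult f (reduced_conn X' Y')"
  proof (rule vfield_eqI)
    fix x assume "x \<in> carrier M"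
    then obtain N X Y where N: "x \<in> N" "lifts N X X'" "lifts N Y Y'" using lifts_exist2[OF XY] by metis
    have "\<D> (fmult (f \<circ> \<pi>) X) Y = fmult (f \<circ> \<pi>) (\<D> X Y)"
      using conn_fmult_left[OF f\<pi>] N lifts_vfields(1) by blast
    then show "reduced_conn (fmult f X') Y' (\<pi> x) = fmult f (reduced_conn X' Y') (\<pi> x)"
      using reduced_conn_lifts[OF lifts_fmult[OF f N(2)] N(3,1)] reduced_conn_lifts[OF N(2,3,1)]
      by (simp add: fmult_def d\<pi>_scaleR)
  qed (simp add: reduced_conn_outside fmult_def)
  show "reduced_conn X' (fmult f Y') = fmult (vapply X' f) Y' + fmult f (reduced_conn X' Y')"
  proof (rule vfield_eqI)
    fix x assume "x \<in> carrier M"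
    then obtain N X Y where N: "x \<in> N" "lifts N X X'" "lifts N Y Y'" using lifts_exist2[OF XY] by metis
    have "\<D> X (fmult (f \<circ> \<pi>) Y) = fmult (vapply X (f \<circ> \<pi>)) Y + fmult (f \<circ> \<pi>) (\<D> X Y)"
      using conn_fmult_right[OF f\<pi>] N lifts_vfields(1) by blast
    then show "reduced_conn X' (fmult f Y') (\<pi> x) = (fmult (vapply X' f) Y' + fmult f (reduced_conn X' Y')) (\<pi> x)"
      using reduced_conn_lifts[OF N(2) lifts_fmult[OF f N(3)] N(1)] reduced_conn_lifts[OF N(2,3,1)]
        lifts_apply[OF N(2) f N(1)] lifts_d\<pi>[OF N(3,1)]
      by (simp add: fmult_def d\<pi>_scaleR d\<pi>_add vapply_def)
  qed (simp add: reduced_conn_outside fmult_def vfields_outside[OF XY(2)])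
qed

text \<open>Near \<open>x\<close> the pullback of \<open>eval2 \<omega>' Y' Z'\<close> is
  \<open>eval2 \<omega> Y Z\<close>, and \<open>\<omega>\<close> is the pullback of
  \<open>\<omega>'\<close>, so each term corresponds to one on M.\<close>

lemma parallel_reduced_conn: "parallel2 Q reduced_conn \<omega>'"
  unfolding parallel2_def
proof (intro ballI)
  fix X' Y' Z' q assume XYZ: "X' \<in> vfields Q" "Y' \<in> vfields Q" "Z' \<in> vfields Q" and "q \<in> carrier Q"
  then obtain x where x: "x \<in> carrier M" "q = \<pi> x" using surj by blast
  obtain N X Y Z where N: "x \<in> N" "lifts N X X'" "lifts N Y Y'" "lifts N Z Z'"
    using lifts_exist3[OF XYZ x(1)] .
  note X = lifts_vfields(1)[OF N(2)] and Y = lifts_vfields(1)[OF N(3)] and Z = lifts_vfields(1)[OF N(4)]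
  have e: "eval2 \<omega>' Y' Z' \<in> Cinf Q" "eval2 \<omega> Y Z \<in> Cinf M"
    using form_Q form_M XYZ Y Z unfolding two_form_def by blast+
  have "X' q (eval2 \<omega>' Y' Z') = X x (eval2 \<omega>' Y' Z' \<circ> \<pi>)"
    using lifts_apply[OF N(2) e(1) N(1)] x by simp
  also have "\<dots> = X x (eval2 \<omega> Y Z)"
  proof (rule tangent_local[OF manifold_M vfields_tangent[OF X x(1)] pullback_Cinf[OF e(1)] e(2) lifts_open(1)[OF N(2)] N(1)])
    fix y assume y: "y \<in> N"
    note c = lifts_open(2)[OF N(2) y]
    show "(eval2 \<omega>' Y' Z' \<circ> \<pi>) y = eval2 \<omega> Y Z y"
      using pullback[OF c vfields_tangent[OF Y c] vfields_tangent[OF Z c]] lifts_d\<pi>[OF N(3) y] lifts_d\<pi>[OF N(4) y]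
      by (simp add: eval2_def)
  qed
  also have "\<dots> = eval2 \<omega> (\<D> X Y) Z x + eval2 \<omega> Y (\<D> X Z) x"
  proof -
    have "X x (eval2 \<omega> Y Z) - eval2 \<omega> (\<D> X Y) Z x - eval2 \<omega> Y (\<D> X Z) x = 0"
      using parallel X Y Z x(1) unfolding parallel2_def by blast
    then show ?thesis by simp
  qed
  also have "eval2 \<omega> (\<D> X Y) Z x = eval2 \<omega>' (reduced_conn X' Y') Z' q"
    using pullback[OF x(1) vfields_tangent[OF conn_vfields[OF X Y] x(1)] vfields_tangent[OF Z x(1)]]
      reduced_conn_lifts[OF N(2,3,1)] lifts_d\<pi>[OF N(4,1)] x(2) by (simp add: eval2_def)
  also have "eval2 \<omega> Y (\<D> X Z) x = eval2 \<omega>' Y' (reduced_conn X' Z') q"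
    using pullback[OF x(1) vfields_tangent[OF Y x(1)] vfields_tangent[OF conn_vfields[OF X Z] x(1)]]
      reduced_conn_lifts[OF N(2,4,1)] lifts_d\<pi>[OF N(3,1)] x(2) by (simp add: eval2_def)
  finally show "X' q (eval2 \<omega>' Y' Z') - eval2 \<omega>' (reduced_conn X' Y') Z' q - eval2 \<omega>' Y' (reduced_conn X' Z') q = 0"
    by simp
qed

lemma torsion_reduced_conn:
  assumes "X' \<in> vfields Q" "Y' \<in> vfields Q"
  shows "torsion reduced_conn X' Y' = 0"
proof (rule vfield_eqI)
  fix x assume x: "x \<in> carrier M"
  then obtain N X Y where N: "x \<in> N" "lifts N X X'" "lifts N Y Y'" using lifts_exist2[OF assms] by metis
  show "torsion reduced_conn X' Y' (\<pi> x) = 0 (\<pi> x)"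
    using reduced_conn_lifts[OF N(2,3,1)] reduced_conn_lifts[OF N(3,2,1)]
      d\<pi>_torsion[OF lifts_vfields(1)[OF N(2)] lifts_vfields(1)[OF N(3)] x] lifts_d\<pi>[OF lifts_bracket[OF N(2,3)] N(1)]
    by (simp add: torsion_def)
next
  fix q assume "q \<notin> carrier Q"
  then show "torsion reduced_conn X' Y' q = 0 q"
    using vfields_outside[OF bracket_vfields[OF assms]] by (simp add: torsion_def reduced_conn_outside)
qed

lemma induced_reduced_conn: "induced_connection M Q \<pi> \<D> reduced_conn"
  unfolding induced_connection_def projects_to_def
proof (intro ballI impI, elim conjE)
  fix X' Y' X Y x
  assume "X' \<in> vfields Q" "Y' \<in> vfields Q" "X \<in> vfields M" "Y \<in> vfields M"
    "\<forall>x\<in>carrier M. d\<pi> (X x) = X' (\<pi> x)" "\<forall>x\<in>carrier M. d\<pi> (Y x) = Y' (\<pi> x)" and x: "x \<in> carrier M"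
  then have "lifts (carrier M) X X'" "lifts (carrier M) Y Y'" by (auto simp: lifts_def)
  then show "d\<pi> (\<D> X Y x) = reduced_conn X' Y' (\<pi> x)" using reduced_conn_lifts x by metis
qed

end

theorem proposition3p2:
  fixes M :: "('a, 'e::euclidean_space) mfd"
    and \<omega> :: "'a form2"
    and \<D> :: "'a conn"
    and n p :: nat
    and Q :: "('a set, 'e) mfd"
    and \<pi> :: "'a \<Rightarrow> 'a set"
    and \<omega>' :: "'a set form2"
  assumes "presymplectic_manifold n p M \<omega>"
    and "presymplectic_connection M \<omega> \<D>"
    and "\<forall>Z\<in>sections M (ker2 M \<omega>). \<forall>X\<in>vfields M. \<forall>Y\<in>vfields M.
           \<forall>x\<in>carrier M. \<forall>w\<in>tangent_space M x. \<omega> x (curvature \<D> Z X Y x) w = 0"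
    and "reduced_symplectic_manifold n p M \<omega> Q \<pi> \<omega>'"
  shows "\<exists>\<D>'. symplectic_connection Q \<omega>' \<D>' \<and> induced_connection M Q \<pi> \<D> \<D>'"
proof -
  have M: "manifold (2 * n + p) M" "two_form M \<omega>"
    using assms(1) by (auto simp: presymplectic_manifold_def)
  have Q: "manifold (2 * n) Q" "two_form Q \<omega>'" "\<And>q. q \<in> carrier Q \<Longrightarrow> ker2 Q \<omega>' q = {0}"
    using assms(4) by (auto simp: reduced_symplectic_manifold_def symplectic_manifold_def)
  have leaves: "carrier Q = {L. leaf p M (ker2 M \<omega>) L}"
    and \<pi>: "\<And>x L. x \<in> carrier M \<Longrightarrow> L \<in> carrier Q \<Longrightarrow> \<pi> x = L \<longleftrightarrow> x \<in> L"
    and quot: "quotient_map (mtop M) (mtop Q) \<pi>" and sub: "submersion M Q \<pi>"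
    and pull: "\<And>x v w. x \<in> carrier M \<Longrightarrow> v \<in> tangent_space M x \<Longrightarrow> w \<in> tangent_space M x \<Longrightarrow>
        \<omega>' (\<pi> x) (differential M Q \<pi> v) (differential M Q \<pi> w) = \<omega> x v w"
    using assms(4) by (auto simp: reduced_symplectic_manifold_def)
  interpret form_reduction M "2 * n + p" Q "2 * n" \<pi> \<omega> \<omega>'
    using M Q sub pull quotient_imp_surjective_map[OF quot] by unfold_locales
  have fibre: "f x = f y"
    if f: "f \<in> Cinf M" and vert: "\<And>Z x. Z \<in> sections M (ker2 M \<omega>) \<Longrightarrow> x \<in> carrier M \<Longrightarrow> Z x f = 0"
      and xy: "x \<in> carrier M" "y \<in> carrier M" "\<pi> x = \<pi> y" for f x y
  proof -
    have L: "\<pi> x \<in> carrier Q" by (rule in_carrier[OF xy(1)])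
    have "leaf p M (ker2 M \<omega>) (\<pi> x)" using L leaves by simp
    \<comment> \<open>\<open>N\<close> is the leaf with its own atlas and a topology possibly finer
      than the induced one; it is connected in that topology.\<close>
    then obtain N :: "('a, 'e) mfd" where N: "manifold p N" "carrier N = \<pi> x" "connected_space (mtop N)"
      "immersion N M (\<lambda>x. x)"
      and ker: "\<And>z. z \<in> \<pi> x \<Longrightarrow> differential N M (\<lambda>x. x) ` tangent_space N z = ker2 M \<omega> z"
      unfolding leaf_def integral_manifold_def by blast
    have sm: "smooth_map N M (\<lambda>x. x)" using N(4) by (simp add: immersion_def)
    have fN: "f \<in> Cinf N" using Cinf_smooth_map[OF N(1) M(1) sm f] by (simp add: o_def)
    have "v f = 0" if z: "z \<in> carrier N" and v: "v \<in> tangent_space N z" for z v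
    proof -
      have zM: "z \<in> carrier M"
        using sm z by (auto simp: smooth_map_def continuous_map_def)
      let ?u = "differential N M (\<lambda>x. x) v"
      have u: "?u \<in> ker2 M \<omega> z" using ker N(2) z v by blast
      then have "?u \<in> tangent_space M z" by (simp add: ker2_def)
      \<comment> \<open>The hypothesis on \<open>f\<close> speaks of sections of the characteristic
        distribution, so the single vector tangent to the leaf is extended to one.\<close>
      then obtain Z where Z: "Z \<in> vfields M" "\<And>x. x \<in> carrier M \<Longrightarrow> d\<pi> (Z x) = 0" "Z z = ?u"
        using vertical_vfield[OF zM _ ker2_d\<pi>[OF zM u]] by metis
      then have "Z \<in> sections M (ker2 M \<omega>)"
        using ker2_iff vfields_tangent[OF Z(1)] by (simp add: sections_def)
      then have "?u f = 0" using vert[OF _ zM] Z(3) by metis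
      then show ?thesis using f by (simp add: differential_def o_def)
    qed
    then show ?thesis
      by (rule constant_on_connected_manifold[OF N(1,3) fN])
        (use \<pi>[OF xy(1) L] \<pi>[OF xy(2) L] xy(3) N(2) in auto)
  qed
  interpret connection_reduction M "2 * n + p" Q "2 * n" \<pi> \<omega> \<omega>' \<D>
    by unfold_locales (use assms(2,3) fibre in blast)+
  have "symplectic_connection Q \<omega>' reduced_conn"
    using linear_reduced_conn parallel_reduced_conn torsion_reduced_conn
    by (simp add: symplectic_connection_def)
  then show ?thesis using induced_reduced_conn by blast
qed

end
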